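(* Let $\Phi\colon\Sigma\to\mathbb{S}^2\times\mathbb{H}^2$ be a PMC surface whose Hopf differential $\Theta$ vanishes identically. Then, for all $p\in\Sigma$, the intersection of $T_p\Sigma$ with either $T_{\pi_1(p)}\mathbb{S}^2\times\{0\}$ or $\{0\}\times T_{\pi_2(p)}\mathbb{H}^2$ is non-trivial.
   Context: $\mathbb{S}^2$ and $\mathbb{H}^2$ are the sphere and hyperbolic plane of curvature $1$ and $-1$; $\mathbb{S}^2\times\mathbb{H}^2$ is their Riemannian product with projections $\pi_1,\pi_2$, and $T_p(\mathbb{S}^2\times\mathbb{H}^2)\cong T_{\pi_1(p)}\mathbb{S}^2\times T_{\pi_2(p)}\mathbb{H}^2$. The product structure is the $(1,1)$-tensor field $F(v_1,v_2)=(v_1,-v_2)$. A surface $\Sigma$ is (locally) identified with its image under the immersion $\Phi$. For an isometric immersion of a surface with second fundamental form $h$, $H=\frac12\mathrm{tr}(h)$ is the mean curvature vector field; the immersion is PMC (parallel mean curvature) if $\nabla^\perp H=0$ and $H\neq0$, with $\nabla^\perp$ the normal connection. Hopf differential: for a local conformal coordinate $z=x+iy$ on $\Sigma$ (metric $e^{2u}(dx^2+dy^2)$), with $\partial_z=(\partial_x-i\partial_y)/2$ and all tensors extended complex linearly, $$\Theta=\left(4\langle h(\partial_z,\partial_z),H\rangle+\langle F\partial_z,\partial_z\rangle\right)dz\otimes dz .$$ For a PMC surface this is a well-defined holomorphic quadratic differential. *)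

theory Defs
  imports "HOL-Analysis.Analysis"
begin

section \<open>Smooth surfaces\<close>

primrec Ck_on :: "nat \<Rightarrow> 'a::real_normed_vector set \<Rightarrow> ('a \<Rightarrow> 'b::real_normed_vector) \<Rightarrow> bool" where
  "Ck_on 0 U f \<longleftrightarrow> continuous_on U f"
| "Ck_on (Suc k) U f \<longleftrightarrow>
     f differentiable_on U \<and> (\<forall>v. Ck_on k U (\<lambda>x. frechet_derivative f (at x) v))"

text \<open>Only meaningful for open \<open>U\<close>, which is how it is used below.\<close>

definition smooth_on :: "'a::real_normed_vector set \<Rightarrow> ('a \<Rightarrow> 'b::real_normed_vector) \<Rightarrow> bool" where
  "smooth_on U f \<longleftrightarrow> (\<forall>k. Ck_on k U f)"

text \<open>
  A local coordinate \<open>z = x + i y\<close> on a surface is a pair \<open>(V, \<phi>)\<close> with domain \<open>V\<close> and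
  \<open>\<phi> = z\<close>, the coordinate plane \<open>\<real>\<^sup>2\<close> being identified with \<^typ>\<open>complex\<close> viewed as a
  \<^emph>\<open>real\<close> vector space: the coordinate vectors \<open>\<partial>\<^sub>x\<close>, \<open>\<partial>\<^sub>y\<close> are \<open>1\<close> and \<open>\<i>\<close>.
  All derivatives are real Frechet derivatives.
\<close>

type_synonym 'a coord = "'a set \<times> ('a \<Rightarrow> complex)"

definition coord_image :: "'a coord \<Rightarrow> complex set" where
  "coord_image c = snd c ` fst c"

definition coord_inv :: "'a coord \<Rightarrow> complex \<Rightarrow> 'a" where
  "coord_inv c = inv_into (fst c) (snd c)"

definition is_coord :: "'a topology \<Rightarrow> 'a coord \<Rightarrow> bool" where
  "is_coord X c \<longleftrightarrow> openin X (fst c) \<and> open (coord_image c) \<and>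
     homeomorphic_map (subtopology X (fst c)) (top_of_set (coord_image c)) (snd c)"

definition smooth_compatible :: "'a coord \<Rightarrow> 'a coord \<Rightarrow> bool" where
  "smooth_compatible c d \<longleftrightarrow>
     smooth_on (snd c ` (fst c \<inter> fst d)) (snd d \<circ> coord_inv c) \<and>
     smooth_on (snd d ` (fst c \<inter> fst d)) (snd c \<circ> coord_inv d)"

text \<open>A smooth surface is a Hausdorff, second countable space with a maximal smooth atlas \<open>A\<close>
  (neither connectedness nor orientability is required).\<close>

definition smooth_surface :: "'a topology \<Rightarrow> 'a coord set \<Rightarrow> bool" where
  "smooth_surface X A \<longleftrightarrow>
     Hausdorff_space X \<and> second_countable X \<and>
     (\<forall>p\<in>topspace X. \<exists>c\<in>A. p \<in> fst c) \<and>
     (\<forall>c\<in>A. is_coord X c) \<and>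
     (\<forall>c\<in>A. \<forall>d\<in>A. smooth_compatible c d) \<and>
     (\<forall>c. is_coord X c \<and> (\<forall>d\<in>A. smooth_compatible c d) \<longrightarrow> c \<in> A)"

section \<open>The product of the sphere and the hyperbolic plane\<close>

text \<open>\<open>S2\<close> is the unit sphere in Euclidean 3-space and \<open>H2\<close> the upper sheet of the
  unit hyperboloid in Minkowski 3-space, so the product lies in \<open>\<real>\<^sup>3 \<times> \<real>\<^sup>3\<close> with the flat
  indefinite metric \<open>amb\<close>, which restricts to the Riemannian product metric.\<close>

type_synonym r33 = "(real^3) \<times> (real^3)"

definition lorentz :: "real^3 \<Rightarrow> real^3 \<Rightarrow> real" where
  "lorentz v w = v$1 * w$1 + v$2 * w$2 - v$3 * w$3"

definition S2 :: "(real^3) set" where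
  "S2 = {a. a \<bullet> a = 1}"

definition H2 :: "(real^3) set" where
  "H2 = {b. lorentz b b = -1 \<and> b$3 > 0}"

definition tangent_S2 :: "real^3 \<Rightarrow> (real^3) set" where
  "tangent_S2 a = {v. a \<bullet> v = 0}"

definition tangent_H2 :: "real^3 \<Rightarrow> (real^3) set" where
  "tangent_H2 b = {v. lorentz b v = 0}"

definition tangent_S2H2 :: "r33 \<Rightarrow> r33 set" where
  "tangent_S2H2 p = tangent_S2 (fst p) \<times> tangent_H2 (snd p)"

definition amb :: "r33 \<Rightarrow> r33 \<Rightarrow> real" where
  "amb v w = fst v \<bullet> fst w + lorentz (snd v) (snd w)"

definition prod_str :: "r33 \<Rightarrow> r33" where
  "prod_str v = (fst v, - snd v)"

text \<open>The \<open>amb\<close>-orthogonal projection onto a subspace \<open>V\<close>; it is used only when \<open>amb\<close> is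
  positive definite on \<open>V\<close>, so that existence and uniqueness hold.\<close>

definition orth_proj :: "r33 set \<Rightarrow> r33 \<Rightarrow> r33" where
  "orth_proj V w = (THE v. v \<in> V \<and> (\<forall>u\<in>V. amb (w - v) u = 0))"

section \<open>Local geometry of an immersed surface\<close>

text \<open>Throughout, \<open>f\<close> is the expression of the immersion in a local coordinate, \<open>q\<close> a point of
  the coordinate domain, and \<open>v\<close>, \<open>w\<close> are coordinate vectors.\<close>

definition push :: "(complex \<Rightarrow> r33) \<Rightarrow> complex \<Rightarrow> complex \<Rightarrow> r33" where
  "push f q v = frechet_derivative f (at q) v"

definition first_ff :: "(complex \<Rightarrow> r33) \<Rightarrow> complex \<Rightarrow> complex \<Rightarrow> complex \<Rightarrow> real" where
  "first_ff f q v w = amb (push f q v) (push f q w)"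

definition normal_space :: "(complex \<Rightarrow> r33) \<Rightarrow> complex \<Rightarrow> r33 set" where
  "normal_space f q = {n \<in> tangent_S2H2 (f q). \<forall>v. amb n (push f q v) = 0}"

text \<open>Levi-Civita derivative in the product of a vector field \<open>Y\<close> along \<open>f\<close> (tangent to the
  product): the tangential part of the flat derivative.\<close>

definition cov_deriv :: "(complex \<Rightarrow> r33) \<Rightarrow> (complex \<Rightarrow> r33) \<Rightarrow> complex \<Rightarrow> complex \<Rightarrow> r33" where
  "cov_deriv f Y q v = orth_proj (tangent_S2H2 (f q)) (frechet_derivative Y (at q) v)"

definition second_ff :: "(complex \<Rightarrow> r33) \<Rightarrow> complex \<Rightarrow> complex \<Rightarrow> complex \<Rightarrow> r33" where
  "second_ff f q v w = orth_proj (normal_space f q) (cov_deriv f (\<lambda>x. push f x w) q v)"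

definition normal_conn :: "(complex \<Rightarrow> r33) \<Rightarrow> (complex \<Rightarrow> r33) \<Rightarrow> complex \<Rightarrow> complex \<Rightarrow> r33" where
  "normal_conn f N q v = orth_proj (normal_space f q) (cov_deriv f N q v)"

text \<open>The trace \<open>g\<^sup>i\<^sup>j B\<^sub>i\<^sub>j\<close> of a bilinear form \<open>B\<close> with respect to a metric \<open>g\<close> on the coordinate
  plane, with the inverse matrix of \<open>g\<close> written out.\<close>

definition metric_trace ::
    "(complex \<Rightarrow> complex \<Rightarrow> real) \<Rightarrow> (complex \<Rightarrow> complex \<Rightarrow> r33) \<Rightarrow> r33" where
  "metric_trace g B =
     (1 / (g 1 1 * g \<i> \<i> - g 1 \<i> * g \<i> 1)) *\<^sub>R
       (g \<i> \<i> *\<^sub>R B 1 1 - g 1 \<i> *\<^sub>R B 1 \<i> - g \<i> 1 *\<^sub>R B \<i> 1 + g 1 1 *\<^sub>R B \<i> \<i>)"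

definition mean_curv :: "(complex \<Rightarrow> r33) \<Rightarrow> complex \<Rightarrow> r33" where
  "mean_curv f q = (1/2) *\<^sub>R metric_trace (first_ff f q) (second_ff f q)"

section \<open>PMC surfaces\<close>

text \<open>\<open>Phi\<close> is a smooth immersion into the product; the surface carries the induced metric, so
  that it is isometric.\<close>

definition immersion_S2H2 :: "'a topology \<Rightarrow> 'a coord set \<Rightarrow> ('a \<Rightarrow> r33) \<Rightarrow> bool" where
  "immersion_S2H2 X A Phi \<longleftrightarrow>
     (\<forall>p\<in>topspace X. Phi p \<in> S2 \<times> H2) \<and>
     (\<forall>c\<in>A. smooth_on (coord_image c) (Phi \<circ> coord_inv c) \<and>
        (\<forall>q\<in>coord_image c. inj (push (Phi \<circ> coord_inv c) q)))"

definition PMC :: "'a topology \<Rightarrow> 'a coord set \<Rightarrow> ('a \<Rightarrow> r33) \<Rightarrow> bool" where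
  "PMC X A Phi \<longleftrightarrow>
     immersion_S2H2 X A Phi \<and>
     (\<forall>c\<in>A. let f = Phi \<circ> coord_inv c in \<forall>q\<in>coord_image c.
        mean_curv f q \<noteq> 0 \<and> (\<forall>v. normal_conn f (mean_curv f) q v = 0))"

text \<open>Tangent vectors of the surface at \<open>p\<close> are represented by pairs of a coordinate around \<open>p\<close>
  and a coordinate vector; this is their image under the differential of \<open>Phi\<close>.\<close>

definition tangent_surface :: "'a coord set \<Rightarrow> ('a \<Rightarrow> r33) \<Rightarrow> 'a \<Rightarrow> r33 set" where
  "tangent_surface A Phi p =
     {push (Phi \<circ> coord_inv c) (snd c p) v | c v. c \<in> A \<and> p \<in> fst c}"

section \<open>The Hopf differential\<close>

definition conformal_coord :: "('a \<Rightarrow> r33) \<Rightarrow> 'a coord \<Rightarrow> bool" where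
  "conformal_coord Phi c \<longleftrightarrow>
     (\<exists>u :: complex \<Rightarrow> real. \<forall>q\<in>coord_image c. \<forall>v w.
        first_ff (Phi \<circ> coord_inv c) q v w = exp (2 * u q) * (v \<bullet> w))"

text \<open>Complex bilinear extension of a real bilinear form \<open>B\<close> on the coordinate plane. An element
  \<open>(a, b)\<close> of the complexified coordinate plane stands for the formal combination of the coordinate
  vectors \<open>a\<close> and \<open>b\<close> with coefficients \<open>1\<close> and the imaginary unit; in particular
  \<open>\<partial>\<^sub>z = (\<partial>\<^sub>x - i \<partial>\<^sub>y) / 2\<close> has real part \<open>\<partial>\<^sub>x / 2\<close> and imaginary part \<open>- \<partial>\<^sub>y / 2\<close>.\<close>

definition complexify ::
    "(complex \<Rightarrow> complex \<Rightarrow> real) \<Rightarrow> complex \<times> complex \<Rightarrow> complex \<times> complex \<Rightarrow> complex" where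
  "complexify B Z W =
     Complex (B (fst Z) (fst W) - B (snd Z) (snd W)) (B (fst Z) (snd W) + B (snd Z) (fst W))"

definition del_z :: "complex \<times> complex" where
  "del_z = ((1/2) *\<^sub>R 1, - ((1/2) *\<^sub>R \<i>))"

definition hopf_coeff :: "(complex \<Rightarrow> r33) \<Rightarrow> complex \<Rightarrow> complex" where
  "hopf_coeff f q =
     4 * complexify (\<lambda>v w. amb (second_ff f q v w) (mean_curv f q)) del_z del_z
     + complexify (\<lambda>v w. amb (prod_str (push f q v)) (push f q w)) del_z del_z"

text \<open>A quadratic differential vanishes at \<open>p\<close> iff its coefficient at \<open>p\<close> vanishes in one, hence in
  every, conformal coordinate around \<open>p\<close>. With the existential form the definition does not become
  vacuous by depending on the existence of isothermal coordinates.\<close>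

definition hopf_vanishes :: "'a topology \<Rightarrow> 'a coord set \<Rightarrow> ('a \<Rightarrow> r33) \<Rightarrow> bool" where
  "hopf_vanishes X A Phi \<longleftrightarrow>
     (\<forall>p\<in>topspace X. \<exists>c\<in>A. p \<in> fst c \<and> conformal_coord Phi c \<and>
        hopf_coeff (Phi \<circ> coord_inv c) (snd c p) = 0)"

end

theory Submission
  imports Defs
begin

text \<open>Suppose that at some point neither projection of the tangent plane to a factor degenerates.
  Then nearby the compression of the product structure to the tangent plane has eigenvalues
  \<open>a, b\<close> strictly between \<open>-1\<close> and \<open>1\<close>, and in an orthonormal eigenframe \<open>e1, e2\<close> it sends
  \<open>e1\<close> to \<open>a e1 + A n1\<close> and \<open>e2\<close> to \<open>b e2 + B n2\<close> with \<open>n1, n2\<close> an orthonormal normal frame and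
  \<open>A, B > 0\<close>. If \<open>a = b\<close> on an open set, parallelism of the product structure forces \<open>H = 0\<close>.
  Otherwise \<open>\<Theta> = 0\<close> and the Ricci equation make both shape operators diagonal, and the second one
  is \<open>\<tau>\<close> times the first up to traces. The Codazzi equation gives the gradient of \<open>\<tau>\<close> algebraically;
  its integrability condition and the two derivatives of that condition determine \<open>\<tau>\<^sup>2 = 25/3\<close>.
  So \<open>\<tau>\<close> is constant, its gradient vanishes, and the integrability condition again forces \<open>H = 0\<close>.\<close>

section \<open>Calculus of smooth maps\<close>

text \<open>No curvature tensor is introduced. All fields take values in flat R^3 x R^3, where
  \<open>prod_str\<close> is a constant linear map, and each structure equation is the symmetry of
  second derivatives, applied to a parallel normal field or to \<tau> along two non-commuting
  fields. The curvature of the product survives only as a component along the position vector. The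
  system closes for two reasons. The planes spanned by \<open>e1, n1\<close> and by
  \<open>e2, n2\<close> are invariant under \<open>prod_str\<close>, so its parallelism expresses
  both connection forms through the second fundamental form once \<open>a\<close> and
  \<open>b\<close> differ. And the trace-free part of that form is \<open>k\<close> times the single
  normal vector \<open>e3 + \<tau> e4\<close>. The number 25/3 is 28/3 - 1: the squared length of
  \<open>e3 + \<tau> e4\<close> is 1 + \<tau>^2, and the polynomial equations force it to be 28/3.
  The obstacle is that a smooth eigenframe is available only where the eigenvalues agree on an open
  set or differ. The contradiction is therefore sought on a small ball, which need not contain the
  point started from.\<close>

abbreviation fd :: "('a::real_normed_vector \<Rightarrow> 'b::real_normed_vector) \<Rightarrow> 'a \<Rightarrow> 'a \<Rightarrow> 'b" where
  "fd f x \<equiv> frechet_derivative f (at x)"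

lemma fd_eqI: "(f has_derivative f') (at x) \<Longrightarrow> fd f x v = f' v"
  by (simp flip: frechet_derivative_at)

text \<open>Differentiability is not assumed: if one map fails to be differentiable, so does the
  other, and both derivatives are the same choice from the same empty predicate.\<close>

lemma fd_cong:
  assumes "open U" "x \<in> U" "\<And>x. x \<in> U \<Longrightarrow> f x = g x"
  shows "fd f x = fd g x"
proof (cases "f differentiable at x")
  case True
  then show ?thesis using frechet_derivative_transform_within_open assms by blast
next
  case False
  moreover have "\<not> g differentiable at x"
  proof
    assume "g differentiable at x"
    then obtain g' where "(g has_derivative g') (at x)" unfolding differentiable_def by blast
    then have "(f has_derivative g') (at x)"
      using has_derivative_transform_within_open assms by metis
    with False show False unfolding differentiable_def by blast
  qed
  ultimately have "(\<lambda>D. (f has_derivative D) (at x)) = (\<lambda>D. (g has_derivative D) (at x))"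
    unfolding differentiable_def by blast
  then show ?thesis unfolding frechet_derivative_def by simp
qed

section \<open>Closure properties of C^k and smooth maps\<close>

lemma Ck_on_has_derivative:
  assumes "open U" "x \<in> U" "Ck_on (Suc k) U f"
  shows "(f has_derivative fd f x) (at x)"
  using assms by (simp add: differentiable_on_eq_differentiable_at frechet_derivative_works)

lemma Ck_on_cong:
  assumes "open U" "\<And>x. x \<in> U \<Longrightarrow> f x = g x" "Ck_on k U f"
  shows "Ck_on k U g"
  using assms(2,3)
proof (induction k arbitrary: f g)
  case 0
  then show ?case using continuous_on_cong[OF refl, of U f g] by simp
next
  case (Suc k)
  have "Ck_on k U (\<lambda>x. fd g x v)" for v
  proof (rule Suc.IH)
    show "fd f x v = fd g x v" if "x \<in> U" for x
      using fd_cong[OF assms(1) that, of f g] Suc.prems by auto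
    show "Ck_on k U (\<lambda>x. fd f x v)" using Suc.prems by simp
  qed
  moreover have "g differentiable_on U"
    unfolding differentiable_on_def
  proof
    fix x assume x: "x \<in> U"
    have "(f has_derivative fd f x) (at x)"
      by (rule Ck_on_has_derivative[OF assms(1) x Suc.prems(2)])
    then have "(g has_derivative fd f x) (at x)"
      using has_derivative_transform_within_open[OF _ assms(1) x] Suc.prems(1) by blast
    then show "g differentiable at x within U"
      unfolding differentiable_def using has_derivative_at_withinI by blast
  qed
  ultimately show ?case by simp
qed

lemma Ck_on_Suc_imp: "Ck_on (Suc k) U f \<Longrightarrow> Ck_on k U f"
proof (induction k arbitrary: f)
  case 0
  then show ?case by (simp add: differentiable_imp_continuous_on)
next
  case (Suc k)
  then have "Ck_on k U (\<lambda>x. fd f x v)" for v by (intro Suc.IH) simp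
  then show ?case using Suc.prems by simp
qed

text \<open>\<open>Ck_on\<close> is phrased with the chosen \<open>frechet_derivative\<close>. This
  rule accepts any explicit derivative formula, so each closure property becomes a derivative rule
  plus the induction hypothesis.\<close>

lemma Ck_on_SucI:
  assumes "open U" "\<And>x. x \<in> U \<Longrightarrow> (f has_derivative f' x) (at x)"
    "\<And>v. Ck_on k U (\<lambda>x. f' x v)"
  shows "Ck_on (Suc k) U f"
proof -
  have "Ck_on k U (\<lambda>x. fd f x v)" for v
    by (rule Ck_on_cong[OF assms(1) _ assms(3)[of v]]) (simp add: fd_eqI[OF assms(2)])
  then show ?thesis
    using assms(1,2) unfolding Ck_on.simps differentiable_on_eq_differentiable_at[OF assms(1)] differentiable_def by blast
qed

lemma Ck_on_const: "Ck_on k U (\<lambda>x. c)"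
  by (induction k arbitrary: c) (auto simp: differentiable_on_def)

lemma Ck_on_linear:
  assumes "open U" "bounded_linear L" "Ck_on k U f"
  shows "Ck_on k U (\<lambda>x. L (f x))"
  using assms(3)
proof (induction k arbitrary: f)
  case 0
  then show ?case using assms(2) by (auto intro: bounded_linear.continuous_on)
next
  case (Suc k)
  show ?case
  proof (rule Ck_on_SucI[OF assms(1)])
    show "((\<lambda>x. L (f x)) has_derivative (\<lambda>v. L (fd f x v))) (at x)" if "x \<in> U" for x
      by (rule bounded_linear.has_derivative[OF assms(2) Ck_on_has_derivative[OF assms(1) that Suc.prems]])
    show "Ck_on k U (\<lambda>x. L (fd f x v))" for v
      by (rule Suc.IH) (use Suc.prems in simp)
  qed
qed

lemma Ck_on_add:
  assumes "open U" "Ck_on k U f" "Ck_on k U g"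
  shows "Ck_on k U (\<lambda>x. f x + g x)"
  using assms(2,3)
proof (induction k arbitrary: f g)
  case 0
  then show ?case by (auto intro: continuous_on_add)
next
  case (Suc k)
  show ?case
  proof (rule Ck_on_SucI[OF assms(1)])
    show "((\<lambda>x. f x + g x) has_derivative (\<lambda>v. fd f x v + fd g x v)) (at x)" if "x \<in> U" for x
      by (rule has_derivative_add[OF Suc.prems[THEN Ck_on_has_derivative[OF assms(1) that]]])
    show "Ck_on k U (\<lambda>x. fd f x v + fd g x v)" for v
      by (rule Suc.IH) (use Suc.prems in simp_all)
  qed
qed

lemma Ck_on_bilinear:
  assumes "open U" "bounded_bilinear B" "Ck_on k U f" "Ck_on k U g"
  shows "Ck_on k U (\<lambda>x. B (f x) (g x))"
  using assms(3,4)
proof (induction k arbitrary: f g)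
  case 0
  then show ?case using bounded_bilinear.continuous_on[OF assms(2)] by auto
next
  case (Suc k)
  note lower = Suc.prems[THEN Ck_on_Suc_imp]
  show ?case
  proof (rule Ck_on_SucI[OF assms(1), where f' = "\<lambda>x v. B (f x) (fd g x v) + B (fd f x v) (g x)"])
    show "((\<lambda>x. B (f x) (g x)) has_derivative (\<lambda>v. B (f x) (fd g x v) + B (fd f x v) (g x))) (at x)"
      if "x \<in> U" for x
      by (rule bounded_bilinear.FDERIV[OF assms(2) Suc.prems[THEN Ck_on_has_derivative[OF assms(1) that]]])
    show "Ck_on k U (\<lambda>x. B (f x) (fd g x v) + B (fd f x v) (g x))" for v
      by (intro Ck_on_add assms(1) Suc.IH) (use Suc.prems lower in simp_all)
  qed
qed

text \<open>The derivative formula contains \<open>inverse (f x)\<close> again, so the induction on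
  \<open>k\<close> keeps \<open>f\<close> fixed. The square root is treated in the same way.\<close>

lemma Ck_on_inverse:
  fixes f :: "'a::real_normed_vector \<Rightarrow> real"
  assumes "open U" "\<And>x. x \<in> U \<Longrightarrow> f x \<noteq> 0" "Ck_on k U f"
  shows "Ck_on k U (\<lambda>x. inverse (f x))"
  using assms(3)
proof (induction k)
  case 0
  then show ?case using assms(2) by (auto intro: continuous_on_inverse)
next
  case (Suc k)
  then have IH: "Ck_on k U (\<lambda>x. inverse (f x))" using Ck_on_Suc_imp by blast
  show ?case
  proof (rule Ck_on_SucI[OF assms(1), where f' = "\<lambda>x v. - (inverse (f x) * fd f x v * inverse (f x))"])
    show "((\<lambda>x. inverse (f x)) has_derivative (\<lambda>v. - (inverse (f x) * fd f x v * inverse (f x)))) (at x)"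
      if "x \<in> U" for x
      by (rule Deriv.has_derivative_inverse[OF assms(2)[OF that] Ck_on_has_derivative[OF assms(1) that Suc.prems]])
    have "Ck_on k U (\<lambda>x. inverse (f x) * fd f x v * inverse (f x))" for v
      using IH Suc.prems by (intro Ck_on_bilinear[OF assms(1) bounded_bilinear_mult]) auto
    then show "Ck_on k U (\<lambda>x. - (inverse (f x) * fd f x v * inverse (f x)))" for v
      by (rule Ck_on_linear[OF assms(1) bounded_linear_minus[OF bounded_linear_ident]])
  qed
qed

lemma Ck_on_sqrt:
  fixes f :: "'a::real_normed_vector \<Rightarrow> real"
  assumes "open U" "\<And>x. x \<in> U \<Longrightarrow> f x > 0" "Ck_on k U f"
  shows "Ck_on k U (\<lambda>x. sqrt (f x))"
  using assms(3)
proof (induction k)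
  case 0
  then show ?case by (auto intro: continuous_intros)
next
  case (Suc k)
  then have IH: "Ck_on k U (\<lambda>x. sqrt (f x))" using Ck_on_Suc_imp by blast
  show ?case
  proof (rule Ck_on_SucI[OF assms(1), where f' = "\<lambda>x v. fd f x v * (1/2 * inverse (sqrt (f x)))"])
    show "((\<lambda>x. sqrt (f x)) has_derivative (\<lambda>v. fd f x v * (1/2 * inverse (sqrt (f x))))) (at x)"
      if "x \<in> U" for x
      by (rule has_derivative_real_sqrt[THEN has_derivative_eq_rhs])
        (use assms(2)[OF that] Ck_on_has_derivative[OF assms(1) that Suc.prems] in \<open>auto simp: field_simps\<close>)
    show "Ck_on k U (\<lambda>x. fd f x v * (1/2 * inverse (sqrt (f x))))" for v
      using IH Suc.prems assms(2)
      by (intro Ck_on_bilinear[OF assms(1) bounded_bilinear_mult] Ck_on_const Ck_on_inverse assms(1))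
        (auto simp: less_imp_neq[THEN not_sym])
  qed
qed

named_theorems smooth_intros

lemma smooth_on_const [smooth_intros]: "smooth_on U (\<lambda>x. c)"
  by (simp add: smooth_on_def Ck_on_const)

lemma smooth_on_bounded_linear:
  "bounded_linear L \<Longrightarrow> open U \<Longrightarrow> smooth_on U f \<Longrightarrow> smooth_on U (\<lambda>x. L (f x))"
  by (simp add: smooth_on_def Ck_on_linear)

lemma smooth_on_bilinear:
  "bounded_bilinear B \<Longrightarrow> open U \<Longrightarrow> smooth_on U f \<Longrightarrow> smooth_on U g \<Longrightarrow> smooth_on U (\<lambda>x. B (f x) (g x))"
  by (simp add: smooth_on_def Ck_on_bilinear)

lemma smooth_on_add [smooth_intros]:
  "open U \<Longrightarrow> smooth_on U f \<Longrightarrow> smooth_on U g \<Longrightarrow> smooth_on U (\<lambda>x. f x + g x)"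
  by (simp add: smooth_on_def Ck_on_add)

lemmas smooth_on_uminus [smooth_intros] =
  smooth_on_bounded_linear[OF bounded_linear_minus[OF bounded_linear_ident]]

lemma smooth_on_diff [smooth_intros]:
  "open U \<Longrightarrow> smooth_on U f \<Longrightarrow> smooth_on U g \<Longrightarrow> smooth_on U (\<lambda>x. f x - g x)"
  using smooth_on_add[OF _ _ smooth_on_uminus, of U f g] by simp

lemmas smooth_on_scaleR [smooth_intros] = smooth_on_bilinear[OF bounded_bilinear_scaleR]

lemma smooth_on_mult [smooth_intros]:
  fixes f g :: "'a::real_normed_vector \<Rightarrow> real"
  shows "open U \<Longrightarrow> smooth_on U f \<Longrightarrow> smooth_on U g \<Longrightarrow> smooth_on U (\<lambda>x. f x * g x)"
  by (rule smooth_on_bilinear[OF bounded_bilinear_mult])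

lemma smooth_on_power [smooth_intros]:
  fixes f :: "'a::real_normed_vector \<Rightarrow> real"
  shows "open U \<Longrightarrow> smooth_on U f \<Longrightarrow> smooth_on U (\<lambda>x. f x ^ n)"
  by (induction n) (auto intro: smooth_on_const smooth_on_mult)

lemma smooth_on_divide [smooth_intros]:
  fixes f g :: "'a::real_normed_vector \<Rightarrow> real"
  assumes "open U" "smooth_on U f" "smooth_on U g" "\<And>x. x \<in> U \<Longrightarrow> g x \<noteq> 0"
  shows "smooth_on U (\<lambda>x. f x / g x)"
proof -
  have "smooth_on U (\<lambda>x. inverse (g x))"
    using assms by (simp add: smooth_on_def Ck_on_inverse)
  then show ?thesis using smooth_on_mult[OF assms(1,2)] by (simp add: divide_inverse)
qed

lemma smooth_on_sqrt [smooth_intros]: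
  fixes f :: "'a::real_normed_vector \<Rightarrow> real"
  shows "open U \<Longrightarrow> smooth_on U f \<Longrightarrow> (\<And>x. x \<in> U \<Longrightarrow> f x > 0) \<Longrightarrow> smooth_on U (\<lambda>x. sqrt (f x))"
  by (simp add: smooth_on_def Ck_on_sqrt)

lemma smooth_on_fd [smooth_intros]: "smooth_on U f \<Longrightarrow> smooth_on U (\<lambda>x. fd f x v)"
  unfolding smooth_on_def
proof
  fix k assume "\<forall>k. Ck_on k U f"
  then have "Ck_on (Suc k) U f" by blast
  then show "Ck_on k U (\<lambda>x. fd f x v)" by simp
qed

lemma smooth_on_cong:
  "open U \<Longrightarrow> smooth_on U f \<Longrightarrow> (\<And>x. x \<in> U \<Longrightarrow> f x = g x) \<Longrightarrow> smooth_on U g"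
  unfolding smooth_on_def using Ck_on_cong by blast

lemma smooth_on_subset: "smooth_on U f \<Longrightarrow> V \<subseteq> U \<Longrightarrow> smooth_on V f"
proof -
  have "Ck_on k U f \<Longrightarrow> V \<subseteq> U \<Longrightarrow> Ck_on k V f" for k
    by (induction k arbitrary: f) (auto intro: continuous_on_subset differentiable_on_subset)
  then show "smooth_on U f \<Longrightarrow> V \<subseteq> U \<Longrightarrow> smooth_on V f" by (auto simp: smooth_on_def)
qed

lemma smooth_on_has_derivative:
  "open U \<Longrightarrow> smooth_on U f \<Longrightarrow> x \<in> U \<Longrightarrow> (f has_derivative fd f x) (at x)"
  unfolding smooth_on_def using Ck_on_has_derivative by blast

lemma smooth_on_imp_continuous_on: "smooth_on U f \<Longrightarrow> continuous_on U f"
  unfolding smooth_on_def by (drule spec[of _ 0]) simp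

lemma fd_linear_arg:
  assumes "open U" "smooth_on U f" "x \<in> U"
  shows "linear (fd f x)"
  using smooth_on_has_derivative[OF assms] has_derivative_linear by blast

lemma linear_complex_expand: "linear (L :: complex \<Rightarrow> 'b::real_vector) \<Longrightarrow> L z = Re z *\<^sub>R L 1 + Im z *\<^sub>R L \<i>"
proof -
  assume L: "linear L"
  have "z = Re z *\<^sub>R 1 + Im z *\<^sub>R \<i>" by (simp add: complex_eq_iff)
  then have "L z = L (Re z *\<^sub>R 1 + Im z *\<^sub>R \<i>)" by simp
  then show ?thesis using L by (simp add: linear_add linear_scale)
qed

text \<open>\<open>smooth_on\<close> speaks of derivatives in constant directions only; a variable
  direction is split along \<open>1\<close> and \<open>\<i>\<close>.\<close>

lemma smooth_on_fd_field [smooth_intros]: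
  fixes f :: "complex \<Rightarrow> 'b::real_normed_vector"
  assumes "open U" "smooth_on U f" "smooth_on U E"
  shows "smooth_on U (\<lambda>x. fd f x (E x))"
proof (rule smooth_on_cong)
  show "smooth_on U (\<lambda>x. Re (E x) *\<^sub>R fd f x 1 + Im (E x) *\<^sub>R fd f x \<i>)"
    by (intro smooth_intros assms smooth_on_bounded_linear[OF bounded_linear_Re]
        smooth_on_bounded_linear[OF bounded_linear_Im])
  show "Re (E x) *\<^sub>R fd f x 1 + Im (E x) *\<^sub>R fd f x \<i> = fd f x (E x)" if "x \<in> U" for x
    by (rule linear_complex_expand[OF fd_linear_arg[OF assms(1,2) that], symmetric])
qed (rule assms)

text \<open>Second difference quotients: both mixed second derivatives are limits of
  \<open>(g(x+tv+tw) - g(x+tv) - g(x+tw) + g x) / t\<^sup>2\<close>.\<close>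

lemma second_difference:
  fixes g :: "'a::real_normed_vector \<Rightarrow> real"
  assumes U: "open U" and g: "smooth_on U g" and t: "t > 0"
    and seg: "\<And>s r. 0 \<le> s \<Longrightarrow> s \<le> t \<Longrightarrow> 0 \<le> r \<Longrightarrow> r \<le> t \<Longrightarrow> x + s *\<^sub>R v + r *\<^sub>R w \<in> U"
  obtains s r where "0 \<le> s" "s \<le> t" "0 \<le> r" "r \<le> t"
    "g (x + t *\<^sub>R v + t *\<^sub>R w) - g (x + t *\<^sub>R v) - g (x + t *\<^sub>R w) + g x
      = t * t * fd (\<lambda>y. fd g y v) (x + s *\<^sub>R v + r *\<^sub>R w) w"
proof -
  \<comment> \<open>The mean value theorem is applied to this increment in direction
    \<open>w\<close> as a function of \<open>s\<close>, then once more in \<open>r\<close>. The term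
    \<open>0 *\<^sub>R w\<close> keeps both ends in the form to which \<open>dg\<close> and
    \<open>seg\<close> apply.\<close>
  define \<psi> where "\<psi> s = g (x + s *\<^sub>R v + t *\<^sub>R w) - g (x + s *\<^sub>R v + 0 *\<^sub>R w)" for s
  define \<psi>' where "\<psi>' s = fd g (x + s *\<^sub>R v + t *\<^sub>R w) v - fd g (x + s *\<^sub>R v + 0 *\<^sub>R w) v" for s
  have line: "((\<lambda>s. x + s *\<^sub>R v + r *\<^sub>R w) has_derivative (\<lambda>h. h *\<^sub>R v)) (at s)"
    "((\<lambda>r. x + s *\<^sub>R v + r *\<^sub>R w) has_derivative (\<lambda>h. h *\<^sub>R w)) (at r)" for s r
    by (auto intro!: derivative_eq_intros)
  have dg: "((\<lambda>s. g (x + s *\<^sub>R v + r *\<^sub>R w)) has_derivative (\<lambda>h. fd g (x + s *\<^sub>R v + r *\<^sub>R w) (h *\<^sub>R v))) (at s)"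
    if "0 \<le> s" "s \<le> t" "0 \<le> r" "r \<le> t" for s r
    by (rule has_derivative_compose[OF line(1)]) (rule smooth_on_has_derivative[OF U g seg[OF that]])
  have scale: "fd h y (c *\<^sub>R z) = c *\<^sub>R fd h y z" if "smooth_on U h" "y \<in> U" for h :: "'a \<Rightarrow> real" and y c z
    using fd_linear_arg[OF U that] by (rule linear_scale)
  have "\<exists>s. 0 < s \<and> s < t \<and> \<psi> t - \<psi> 0 = (t - 0) * \<psi>' s"
  proof (rule MVT2[OF t])
    fix s assume s: "0 \<le> s" "s \<le> t"
    have "(\<psi> has_derivative (\<lambda>h. fd g (x + s *\<^sub>R v + t *\<^sub>R w) (h *\<^sub>R v) - fd g (x + s *\<^sub>R v + 0 *\<^sub>R w) (h *\<^sub>R v))) (at s)"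
      unfolding \<psi>_def by (rule has_derivative_diff[OF dg dg]) (use s t in simp_all)
    then show "(\<psi> has_real_derivative \<psi>' s) (at s)"
      unfolding has_field_derivative_def \<psi>'_def
      by (rule has_derivative_eq_rhs)
        (use scale[OF g seg[OF s, of t]] scale[OF g seg[OF s, of 0]] t in \<open>simp add: fun_eq_iff right_diff_distrib mult.commute\<close>)
  qed
  then obtain s where "0 < s" "s < t" "\<psi> t - \<psi> 0 = (t - 0) * \<psi>' s" by blast
  then have s: "0 \<le> s" "s \<le> t" "\<psi> t - \<psi> 0 = t * \<psi>' s" by simp_all
  have g': "smooth_on U (\<lambda>y. fd g y v)" by (rule smooth_on_fd[OF g])
  have "\<exists>r. 0 < r \<and> r < t \<and> fd g (x + s *\<^sub>R v + t *\<^sub>R w) v - fd g (x + s *\<^sub>R v + 0 *\<^sub>R w) v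
      = (t - 0) * fd (\<lambda>y. fd g y v) (x + s *\<^sub>R v + r *\<^sub>R w) w"
  proof (rule MVT2[OF t, of "\<lambda>r. fd g (x + s *\<^sub>R v + r *\<^sub>R w) v"])
    fix r assume r: "0 \<le> r" "r \<le> t"
    have "((\<lambda>r. fd g (x + s *\<^sub>R v + r *\<^sub>R w) v) has_derivative
        (\<lambda>h. fd (\<lambda>y. fd g y v) (x + s *\<^sub>R v + r *\<^sub>R w) (h *\<^sub>R w))) (at r)"
      by (rule has_derivative_compose[OF line(2)]) (rule smooth_on_has_derivative[OF U g' seg[OF s(1,2) r]])
    then show "((\<lambda>r. fd g (x + s *\<^sub>R v + r *\<^sub>R w) v) has_real_derivative
        fd (\<lambda>y. fd g y v) (x + s *\<^sub>R v + r *\<^sub>R w) w) (at r)"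
      unfolding has_field_derivative_def
      by (rule has_derivative_eq_rhs) (simp add: scale[OF g' seg[OF s(1,2) r]] fun_eq_iff mult.commute)
  qed
  then obtain r where "0 < r" "r < t" "\<psi>' s = (t - 0) * fd (\<lambda>y. fd g y v) (x + s *\<^sub>R v + r *\<^sub>R w) w"
    unfolding \<psi>'_def by blast
  then have r: "0 \<le> r" "r \<le> t" "\<psi>' s = t * fd (\<lambda>y. fd g y v) (x + s *\<^sub>R v + r *\<^sub>R w) w"
    by simp_all
  show ?thesis
    by (rule that[OF s(1,2) r(1,2)]) (use s(3) r(3) in \<open>simp add: \<psi>_def algebra_simps\<close>)
qed

lemma fd_fd_swap_real:
  fixes g :: "'a::real_normed_vector \<Rightarrow> real"
  assumes U: "open U" and g: "smooth_on U g" and x: "x \<in> U"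
  shows "fd (\<lambda>y. fd g y v) x w = fd (\<lambda>y. fd g y w) x v"
proof (rule field_le_epsilon[THEN antisym[OF _ field_le_epsilon]])
  have *: "fd (\<lambda>y. fd g y v) x w \<le> fd (\<lambda>y. fd g y w) x v + \<epsilon>" if \<epsilon>: "\<epsilon> > 0" for \<epsilon> :: real and v w
  proof -
    have "continuous_on U (\<lambda>y. fd (\<lambda>y. fd g y a) y b)" for a b
      by (intro smooth_on_imp_continuous_on smooth_on_fd g)
    then have "isCont (\<lambda>y. fd (\<lambda>y. fd g y a) y b) x" for a b
      using U x by (simp add: continuous_on_eq_continuous_at)
    then have "((\<lambda>y. fd (\<lambda>y. fd g y a) y b) \<longlongrightarrow> fd (\<lambda>y. fd g y a) x b) (nhds x)" for a b
      unfolding isCont_def using tendsto_at_iff_tendsto_nhds[of "\<lambda>y. fd (\<lambda>y. fd g y a) y b" x] by blast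
    from tendstoD[OF this, of "\<epsilon>/2"]
    have "\<forall>\<^sub>F y in nhds x. dist (fd (\<lambda>y. fd g y a) y b) (fd (\<lambda>y. fd g y a) x b) < \<epsilon>/2" for a b
      using \<epsilon> by simp
    then have "\<forall>\<^sub>F y in nhds x. y \<in> U \<and> dist (fd (\<lambda>y. fd g y v) y w) (fd (\<lambda>y. fd g y v) x w) < \<epsilon>/2
        \<and> dist (fd (\<lambda>y. fd g y w) y v) (fd (\<lambda>y. fd g y w) x v) < \<epsilon>/2"
      by (intro eventually_conj eventually_nhds_in_open U x)
    then obtain d where d: "d > 0" "\<And>y. dist y x < d \<Longrightarrow> y \<in> U \<and> dist (fd (\<lambda>y. fd g y v) y w) (fd (\<lambda>y. fd g y v) x w) < \<epsilon>/2
        \<and> dist (fd (\<lambda>y. fd g y w) y v) (fd (\<lambda>y. fd g y w) x v) < \<epsilon>/2"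
      unfolding eventually_nhds_metric by blast
    \<comment> \<open>This keeps the whole parallelogram inside the ball of radius \<open>d\<close>;
      the summand 1 covers the case that \<open>v\<close> and \<open>w\<close> are both
      zero.\<close>
    define t where "t = d / (norm v + norm w + 1) / 2"
    have n: "norm v + norm w + 1 > 0" by (smt (verit) norm_ge_zero)
    have t: "t > 0" unfolding t_def using d(1) n by simp
    have small: "dist (x + s *\<^sub>R v + r *\<^sub>R w) x < d" if "0 \<le> s" "s \<le> t" "0 \<le> r" "r \<le> t" for s r
    proof -
      have "dist (x + s *\<^sub>R v + r *\<^sub>R w) x = norm (s *\<^sub>R v + r *\<^sub>R w)" by (simp add: dist_norm)
      also have "\<dots> \<le> s * norm v + r * norm w"
        by (rule norm_triangle_le) (use that in simp)
      also have "\<dots> \<le> t * norm v + t * norm w"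
        by (intro add_mono mult_right_mono) (use that in simp_all)
      also have "\<dots> \<le> t * (norm v + norm w + 1)" using t by (simp add: algebra_simps)
      also have "\<dots> = d / 2" unfolding t_def using n by (simp add: field_simps)
      finally show ?thesis using d(1) by simp
    qed
    have seg: "x + s *\<^sub>R v + r *\<^sub>R w \<in> U" "x + r *\<^sub>R w + s *\<^sub>R v \<in> U"
      if "0 \<le> s" "s \<le> t" "0 \<le> r" "r \<le> t" for s r
      using d(2)[OF small[OF that]] by (simp_all add: algebra_simps)
    obtain s r where sr: "0 \<le> s" "s \<le> t" "0 \<le> r" "r \<le> t"
      and 1: "g (x + t *\<^sub>R v + t *\<^sub>R w) - g (x + t *\<^sub>R v) - g (x + t *\<^sub>R w) + g x
        = t * t * fd (\<lambda>y. fd g y v) (x + s *\<^sub>R v + r *\<^sub>R w) w"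
      by (rule second_difference[OF U g t seg(1)])
    obtain s' r' where sr': "0 \<le> s'" "s' \<le> t" "0 \<le> r'" "r' \<le> t"
      and 2: "g (x + t *\<^sub>R w + t *\<^sub>R v) - g (x + t *\<^sub>R w) - g (x + t *\<^sub>R v) + g x
        = t * t * fd (\<lambda>y. fd g y w) (x + s' *\<^sub>R w + r' *\<^sub>R v) v"
      by (rule second_difference[OF U g t seg(2)])
    have "t * t * fd (\<lambda>y. fd g y v) (x + s *\<^sub>R v + r *\<^sub>R w) w = t * t * fd (\<lambda>y. fd g y w) (x + s' *\<^sub>R w + r' *\<^sub>R v) v"
      using 1 2 by (simp add: algebra_simps)
    then have "fd (\<lambda>y. fd g y v) (x + s *\<^sub>R v + r *\<^sub>R w) w = fd (\<lambda>y. fd g y w) (x + s' *\<^sub>R w + r' *\<^sub>R v) v"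
      using t by simp
    then show ?thesis
      using d(2)[OF small[OF sr]] d(2)[OF small[OF sr'(3,4,1,2)]] unfolding dist_real_def
      by (simp add: algebra_simps abs_if split: if_splits)
  qed
  show "fd (\<lambda>y. fd g y v) x w \<le> fd (\<lambda>y. fd g y w) x v + \<epsilon>" if "\<epsilon> > 0" for \<epsilon> by (rule *[OF that])
  show "fd (\<lambda>y. fd g y w) x v \<le> fd (\<lambda>y. fd g y v) x w + \<epsilon>" if "\<epsilon> > 0" for \<epsilon> by (rule *[OF that])
qed

section \<open>Symmetric second derivatives and Lie brackets\<close>

lemma fd_bounded_linear:
  assumes "open U" "smooth_on U f" "x \<in> U" "bounded_linear L"
  shows "fd (\<lambda>x. L (f x)) x v = L (fd f x v)"
  by (rule fd_eqI) (rule bounded_linear.has_derivative[OF assms(4) smooth_on_has_derivative[OF assms(1-3)]])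

lemma fd_fd_swap:
  fixes g :: "'a::real_normed_vector \<Rightarrow> 'b::real_inner"
  assumes U: "open U" and g: "smooth_on U g" and x: "x \<in> U"
  shows "fd (\<lambda>y. fd g y v) x w = fd (\<lambda>y. fd g y w) x v"
proof -
  have "fd (\<lambda>y. fd g y v) x w \<bullet> b = fd (\<lambda>y. fd g y w) x v \<bullet> b" for b
  proof -
    have *: "fd (\<lambda>y. fd g y v) x w \<bullet> b = fd (\<lambda>y. fd (\<lambda>y. g y \<bullet> b) y v) x w" for v w
    proof -
      have "fd (\<lambda>y. fd (\<lambda>y. g y \<bullet> b) y v) x = fd (\<lambda>y. fd g y v \<bullet> b) x"
        by (rule fd_cong[OF U x]) (rule fd_bounded_linear[OF U g _ bounded_linear_inner_left])
      then show ?thesis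
        by (simp add: fd_bounded_linear[OF U smooth_on_fd[OF g] x bounded_linear_inner_left])
    qed
    show ?thesis
      unfolding * by (rule fd_fd_swap_real[OF U smooth_on_bounded_linear[OF bounded_linear_inner_left U g] x])
  qed
  then show ?thesis using vector_eq_rdot by blast
qed

text \<open>Product rule for the operator \<open>fd G y\<close> applied to the vector
  \<open>E y\<close>. Expanding along \<open>1\<close> and \<open>\<i>\<close> avoids
  differentiating an operator-valued map.\<close>

lemma fd_along_field:
  fixes G :: "complex \<Rightarrow> 'b::real_normed_vector"
  assumes U: "open U" and G: "smooth_on U G" and E: "smooth_on U E" and x: "x \<in> U"
  shows "fd (\<lambda>y. fd G y (E y)) x v = fd (\<lambda>y. fd G y (E x)) x v + fd G x (fd E x v)"
proof -
  have exp: "fd G y z = Re z *\<^sub>R fd G y 1 + Im z *\<^sub>R fd G y \<i>" if "y \<in> U" for y z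
    by (rule linear_complex_expand[OF fd_linear_arg[OF U G that]])
  have GD: "((\<lambda>y. fd G y a) has_derivative (\<lambda>v. fd (\<lambda>y. fd G y a) x v)) (at x)" for a
    by (rule smooth_on_has_derivative[OF U smooth_on_fd[OF G] x])
  have ED: "(E has_derivative fd E x) (at x)" by (rule smooth_on_has_derivative[OF U E x])
  have "fd (\<lambda>y. fd G y (E y)) x = fd (\<lambda>y. Re (E y) *\<^sub>R fd G y 1 + Im (E y) *\<^sub>R fd G y \<i>) x"
    by (rule fd_cong[OF U x]) (rule exp)
  then have "fd (\<lambda>y. fd G y (E y)) x v = fd (\<lambda>y. Re (E y) *\<^sub>R fd G y 1 + Im (E y) *\<^sub>R fd G y \<i>) x v"
    by (rule fun_cong)
  also have "\<dots> = (Re (E x) *\<^sub>R fd (\<lambda>y. fd G y 1) x v + Re (fd E x v) *\<^sub>R fd G x 1)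
      + (Im (E x) *\<^sub>R fd (\<lambda>y. fd G y \<i>) x v + Im (fd E x v) *\<^sub>R fd G x \<i>)"
    by (rule fd_eqI) (intro has_derivative_add has_derivative_scaleR GD has_derivative_Re has_derivative_Im ED)
  also have "\<dots> = (Re (E x) *\<^sub>R fd (\<lambda>y. fd G y 1) x v + Im (E x) *\<^sub>R fd (\<lambda>y. fd G y \<i>) x v) + fd G x (fd E x v)"
    by (simp add: exp[OF x, of "fd E x v"])
  also have "Re (E x) *\<^sub>R fd (\<lambda>y. fd G y 1) x v + Im (E x) *\<^sub>R fd (\<lambda>y. fd G y \<i>) x v
      = fd (\<lambda>y. Re (E x) *\<^sub>R fd G y 1 + Im (E x) *\<^sub>R fd G y \<i>) x v"
    by (rule fd_eqI[symmetric]) (intro has_derivative_add has_derivative_scaleR_right GD)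
  also have "\<dots> = fd (\<lambda>y. fd G y (E x)) x v"
    by (rule fun_cong[OF fd_cong[OF U x]]) (rule exp[symmetric])
  finally show ?thesis .
qed

text \<open>On the right \<open>G\<close> is differentiated along the Lie bracket of
  \<open>E1\<close> and \<open>E2\<close>; the pure second derivatives cancel by symmetry. The
  Ricci, Codazzi and integrability conditions below all come from this identity.\<close>

lemma fd_bracket:
  fixes G :: "complex \<Rightarrow> 'b::real_inner"
  assumes U: "open U" and G: "smooth_on U G" and E: "smooth_on U E1" "smooth_on U E2" and x: "x \<in> U"
  shows "fd (\<lambda>y. fd G y (E2 y)) x (E1 x) - fd (\<lambda>y. fd G y (E1 y)) x (E2 x)
    = fd G x (fd E2 x (E1 x) - fd E1 x (E2 x))"
  using fd_fd_swap[OF U G x, of "E1 x" "E2 x"] linear_diff[OF fd_linear_arg[OF U G x]]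
  by (simp add: fd_along_field[OF U G E(1) x] fd_along_field[OF U G E(2) x])

section \<open>Linear algebra of the product\<close>

lemma bounded_bilinear_amb: "bounded_bilinear amb"
proof -
  have "bilinear amb"
    unfolding bilinear_def amb_def lorentz_def by (auto intro!: linearI simp: algebra_simps inner_simps)
  then show ?thesis by (simp add: bilinear_conv_bounded_bilinear)
qed

interpretation amb: bounded_bilinear amb by (rule bounded_bilinear_amb)

lemmas amb_simps = amb.add_left amb.add_right amb.diff_left amb.diff_right
  amb.scaleR_left amb.scaleR_right amb.minus_left amb.minus_right amb.zero_left amb.zero_right

lemma amb_commute: "amb v w = amb w v"
  by (simp add: amb_def lorentz_def inner_commute mult.commute)

lemma bounded_linear_prod_str: "bounded_linear prod_str"
proof -
  have "linear prod_str" by (rule linearI) (auto simp: prod_str_def)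
  then show ?thesis by (simp add: linear_conv_bounded_linear)
qed

lemma prod_str_simps: "prod_str (v + w) = prod_str v + prod_str w" "prod_str (v - w) = prod_str v - prod_str w"
  "prod_str (a *\<^sub>R v) = a *\<^sub>R prod_str v" "prod_str (- v) = - prod_str v" "prod_str 0 = 0"
  by (simp_all add: prod_str_def zero_prod_def)

lemma prod_str_involution [simp]: "prod_str (prod_str v) = v"
  by (simp add: prod_str_def)

lemma amb_prod_str: "amb (prod_str v) w = amb v (prod_str w)"
  by (simp add: amb_def prod_str_def lorentz_def)

lemma amb_prod_str_commute: "amb (prod_str v) w = amb (prod_str w) v"
  by (simp add: amb_prod_str amb_commute[of v])

lemma amb_prod_str_prod_str [simp]: "amb (prod_str v) (prod_str w) = amb v w"
  by (simp add: amb_prod_str)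

lemmas smooth_on_amb [smooth_intros] = smooth_on_bilinear[OF bounded_bilinear_amb]
lemmas smooth_on_prod_str [smooth_intros] = smooth_on_bounded_linear[OF bounded_linear_prod_str]

text \<open>The conditions in the two factors are half the sum and half the difference of these, so
  \<open>p\<close> and \<open>prod_str p\<close> span the normal plane of the product in flat
  space.\<close>

lemma tangent_S2H2_iff: "v \<in> tangent_S2H2 p \<longleftrightarrow> amb p v = 0 \<and> amb (prod_str p) v = 0"
  by (auto simp: tangent_S2H2_def tangent_S2_def tangent_H2_def amb_def prod_str_def lorentz_def mem_Times_iff)

lemma S2H2_iff_amb:
  assumes "p \<in> S2 \<times> H2"
  shows "amb p p = 0" "amb p (prod_str p) = 2"
  using assms by (auto simp: S2_def H2_def amb_def prod_str_def lorentz_def)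

text \<open>Tangent planes of the hyperboloid are spacelike: after multiplication by
  \<open>b$3 * b$3 = 1 + ?r\<close>, Lagrange's identity turns \<open>lorentz v v\<close> into a sum
  of squares.\<close>

lemma lorentz_tangent_nonneg:
  assumes "b \<in> H2" "v \<in> tangent_H2 b"
  shows "lorentz v v \<ge> 0" "lorentz v v = 0 \<Longrightarrow> v = 0"
proof -
  let ?r = "b$1 * b$1 + b$2 * b$2" and ?s = "v$1 * v$1 + v$2 * v$2"
  have b: "b$3 * b$3 = 1 + ?r" and bv: "b$3 * v$3 = b$1 * v$1 + b$2 * v$2"
    using assms by (auto simp: H2_def tangent_H2_def lorentz_def)
  have "(1 + ?r) * (v$3 * v$3) = (b$3 * v$3) * (b$3 * v$3)"
    by (simp add: b[symmetric])
  also have "\<dots> = ?r * ?s - (b$1 * v$2 - b$2 * v$1)\<^sup>2"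
    unfolding bv by (simp add: power2_eq_square algebra_simps)
  finally have eq: "(1 + ?r) * lorentz v v = ?s + (b$1 * v$2 - b$2 * v$1)\<^sup>2"
    by (simp add: lorentz_def algebra_simps)
  have r: "1 + ?r > 0" by (smt (verit) zero_le_square)
  have s: "?s \<ge> 0" by (simp add: zero_le_square)
  have "(1 + ?r) * lorentz v v \<ge> 0" unfolding eq using s by simp
  then show "lorentz v v \<ge> 0" using r by (simp add: zero_le_mult_iff)
  assume "lorentz v v = 0"
  then have "?s + (b$1 * v$2 - b$2 * v$1)\<^sup>2 = 0" using eq by simp
  then have "?s = 0" using s by (simp add: add_nonneg_eq_0_iff)
  then have v12: "v$1 = 0" "v$2 = 0" by (simp_all add: sum_squares_eq_zero_iff)
  then have "v$3 = 0" using \<open>lorentz v v = 0\<close> by (simp add: lorentz_def)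
  with v12 show "v = 0" by (simp add: vec_eq_iff forall_3)
qed

lemma amb_split: "amb v v = (fst v \<bullet> fst v) + lorentz (snd v) (snd v)"
  "amb (prod_str v) v = (fst v \<bullet> fst v) - lorentz (snd v) (snd v)"
  by (simp_all add: amb_def prod_str_def lorentz_def)

lemma tangent_S2H2_prod_str: "v \<in> tangent_S2H2 p \<Longrightarrow> prod_str v \<in> tangent_S2H2 p"
  by (simp add: tangent_S2H2_iff amb_prod_str[symmetric])

lemma tangent_S2H2_scaleR_diff: "v \<in> tangent_S2H2 p \<Longrightarrow> w \<in> tangent_S2H2 p \<Longrightarrow> r *\<^sub>R (v - t *\<^sub>R w) \<in> tangent_S2H2 p"
  by (simp add: tangent_S2H2_iff amb_simps)

lemma abs_prod_str_le:
  assumes "p \<in> S2 \<times> H2" "v \<in> tangent_S2H2 p" "amb v v = 1"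
  shows "\<bar>amb (prod_str v) v\<bar> \<le> 1"
proof -
  have "lorentz (snd v) (snd v) \<ge> 0"
    using lorentz_tangent_nonneg(1)[of "snd p" "snd v"] assms by (auto simp: tangent_S2H2_def)
  moreover have "fst v \<bullet> fst v \<ge> 0" by simp
  ultimately show ?thesis using assms(3) unfolding amb_split by linarith
qed

locale ortho_frame =
  fixes p e1 e2 n1 n2 :: r33
  assumes p: "p \<in> S2 \<times> H2"
    and tangent: "e1 \<in> tangent_S2H2 p" "e2 \<in> tangent_S2H2 p" "n1 \<in> tangent_S2H2 p" "n2 \<in> tangent_S2H2 p"
    and unit: "amb e1 e1 = 1" "amb e2 e2 = 1" "amb n1 n1 = 1" "amb n2 n2 = 1"
    and orth: "amb e1 e2 = 0" "amb e1 n1 = 0" "amb e1 n2 = 0" "amb e2 n1 = 0" "amb e2 n2 = 0" "amb n1 n2 = 0"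
begin

lemma orth': "amb e2 e1 = 0" "amb n1 e1 = 0" "amb n2 e1 = 0" "amb n1 e2 = 0" "amb n2 e2 = 0" "amb n2 n1 = 0"
  using orth by (simp_all add: amb_commute)

lemma position:
  "amb p p = 0" "amb p (prod_str p) = 2" "amb (prod_str p) p = 2" "amb (prod_str p) (prod_str p) = 0"
  "amb p e1 = 0" "amb p e2 = 0" "amb p n1 = 0" "amb p n2 = 0"
  "amb e1 p = 0" "amb e2 p = 0" "amb n1 p = 0" "amb n2 p = 0"
  "amb (prod_str p) e1 = 0" "amb (prod_str p) e2 = 0" "amb (prod_str p) n1 = 0" "amb (prod_str p) n2 = 0"
  "amb e1 (prod_str p) = 0" "amb e2 (prod_str p) = 0" "amb n1 (prod_str p) = 0" "amb n2 (prod_str p) = 0"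
  using S2H2_iff_amb[OF p] tangent unfolding tangent_S2H2_iff by (simp_all add: amb_commute)

lemmas frame_simps = unit orth orth' position amb_simps

text \<open>\<open>amb\<close> is indefinite, so this is a dimension count: the six pairings form a
  linear map of a six-dimensional space to itself, which is onto by an explicit preimage and hence
  injective.\<close>

lemma eq_zero_if_orthogonal:
  assumes "amb w e1 = 0" "amb w e2 = 0" "amb w n1 = 0" "amb w n2 = 0" "amb w p = 0" "amb w (prod_str p) = 0"
  shows "w = 0"
proof -
  define L :: "r33 \<Rightarrow> r33" where "L w = (vector [amb w e1, amb w e2, amb w n1],
     vector [amb w n2, amb w p, amb w (prod_str p)])" for w
  have lin: "linear L"
    by (rule linearI) (auto simp: L_def vec_eq_iff forall_3 vector_3 amb_simps)
  have "surj L"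
  proof (rule surjI)
    fix y :: r33
    \<comment> \<open>\<open>p\<close> and \<open>prod_str p\<close> are null with mutual pairing 2,
      so the coefficient of each is half the pairing with the other.\<close>
    show "L (fst y $ 1 *\<^sub>R e1 + fst y $ 2 *\<^sub>R e2 + fst y $ 3 *\<^sub>R n1 + snd y $ 1 *\<^sub>R n2
      + (snd y $ 3 / 2) *\<^sub>R p + (snd y $ 2 / 2) *\<^sub>R prod_str p) = y"
      by (simp add: L_def prod_eq_iff vec_eq_iff forall_3 vector_3 frame_simps)
  qed
  then have "inj L" using lin linear_surjective_imp_injective by blast
  moreover have "L w = L 0" using assms by (simp add: L_def amb_simps)
  ultimately show ?thesis by (simp add: inj_eq)
qed

text \<open>\<open>p\<close> and \<open>prod_str p\<close> form a null basis of the normal bundle of the product in flat space.\<close>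

lemma expand:
  "w = amb w e1 *\<^sub>R e1 + amb w e2 *\<^sub>R e2 + amb w n1 *\<^sub>R n1 + amb w n2 *\<^sub>R n2
     + (amb w (prod_str p) / 2) *\<^sub>R p + (amb w p / 2) *\<^sub>R prod_str p" (is "w = ?r")
proof -
  have "w - ?r = 0"
    by (rule eq_zero_if_orthogonal) (simp_all add: frame_simps)
  then show ?thesis by simp
qed

lemma position_tangent: "u \<in> tangent_S2H2 p \<Longrightarrow> amb u p = 0" "u \<in> tangent_S2H2 p \<Longrightarrow> amb u (prod_str p) = 0"
  by (simp_all add: tangent_S2H2_iff amb_commute)

text \<open>\<open>orth_proj\<close> is a definite description, so both existence and uniqueness
  have to be shown; an orthonormal frame reduces both to pairings with its four vectors.\<close>

lemma orth_proj_tangent: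
  "orth_proj (tangent_S2H2 p) w = amb w e1 *\<^sub>R e1 + amb w e2 *\<^sub>R e2 + amb w n1 *\<^sub>R n1 + amb w n2 *\<^sub>R n2"
  (is "_ = ?v")
  unfolding orth_proj_def
proof (rule the_equality)
  have "amb (w - ?v) u = 0" if u: "u \<in> tangent_S2H2 p" for u
  proof -
    have "u = amb u e1 *\<^sub>R e1 + amb u e2 *\<^sub>R e2 + amb u n1 *\<^sub>R n1 + amb u n2 *\<^sub>R n2"
      by (rule expand[of u, THEN trans]) (simp add: position_tangent[OF u])
    then have "amb (w - ?v) u = amb (w - ?v) (\<dots>)" by (rule arg_cong)
    also have "\<dots> = 0" by (simp only: frame_simps) (simp add: algebra_simps)
    finally show ?thesis .
  qed
  moreover have "?v \<in> tangent_S2H2 p" by (simp add: tangent_S2H2_iff frame_simps)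
  ultimately show "?v \<in> tangent_S2H2 p \<and> (\<forall>u\<in>tangent_S2H2 p. amb (w - ?v) u = 0)" by blast
  fix v assume v: "v \<in> tangent_S2H2 p \<and> (\<forall>u\<in>tangent_S2H2 p. amb (w - v) u = 0)"
  then have "amb (w - v) e1 = 0" "amb (w - v) e2 = 0" "amb (w - v) n1 = 0" "amb (w - v) n2 = 0"
    using tangent by blast+
  then show "v = ?v"
    by (intro expand[of v, THEN trans]) (use position_tangent[of v] conjunct1[OF v] in \<open>simp add: amb_simps\<close>)
qed

lemma orth_proj_normal:
  assumes N: "N = {n \<in> tangent_S2H2 p. amb n e1 = 0 \<and> amb n e2 = 0}"
  shows "orth_proj N w = amb w n1 *\<^sub>R n1 + amb w n2 *\<^sub>R n2" (is "_ = ?v")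
  unfolding orth_proj_def
proof (rule the_equality)
  have "amb (w - ?v) u = 0" if u: "u \<in> N" for u
  proof -
    have "u = amb u n1 *\<^sub>R n1 + amb u n2 *\<^sub>R n2"
      by (rule expand[of u, THEN trans]) (use u position_tangent[of u] in \<open>simp add: N\<close>)
    then have "amb (w - ?v) u = amb (w - ?v) (\<dots>)" by (rule arg_cong)
    also have "\<dots> = 0" by (simp only: frame_simps) (simp add: algebra_simps)
    finally show ?thesis .
  qed
  moreover have "?v \<in> N" by (simp add: N tangent_S2H2_iff frame_simps)
  ultimately show "?v \<in> N \<and> (\<forall>u\<in>N. amb (w - ?v) u = 0)" by blast
  fix v assume v: "v \<in> N \<and> (\<forall>u\<in>N. amb (w - v) u = 0)"
  have "n1 \<in> N" "n2 \<in> N" using tangent by (simp_all add: N frame_simps)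
  then have "amb (w - v) n1 = 0" "amb (w - v) n2 = 0" using v by blast+
  then show "v = ?v"
    by (intro expand[of v, THEN trans])
      (use position_tangent[of v] conjunct1[OF v] in \<open>simp add: N amb_simps\<close>)
qed

end

section \<open>Surfaces in the product\<close>

text \<open>Differentiate the two constants \<open>amb (f x) (f x) = 0\<close> and
  \<open>amb (f x) (prod_str (f x)) = 2\<close>.\<close>

lemma push_tangent:
  assumes U: "open U" and f: "smooth_on U f" "\<And>x. x \<in> U \<Longrightarrow> f x \<in> S2 \<times> H2" and q: "q \<in> U"
  shows "push f q v \<in> tangent_S2H2 (f q)"
proof -
  have d: "(f has_derivative fd f q) (at q)" by (rule smooth_on_has_derivative[OF U f(1) q])
  have d': "((\<lambda>x. prod_str (f x)) has_derivative (\<lambda>v. prod_str (fd f q v))) (at q)"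
    by (rule bounded_linear.has_derivative[OF bounded_linear_prod_str d])
  have "fd (\<lambda>x. amb (f x) (f x)) q = fd (\<lambda>x. 0) q"
    by (rule fd_cong[OF U q]) (use S2H2_iff_amb f in simp)
  moreover have "fd (\<lambda>x. amb (f x) (f x)) q v = amb (f q) (fd f q v) + amb (fd f q v) (f q)"
    by (rule fd_eqI[OF amb.FDERIV[OF d d]])
  moreover have "fd (\<lambda>x. amb (f x) (prod_str (f x))) q = fd (\<lambda>x. 2) q"
    by (rule fd_cong[OF U q]) (use S2H2_iff_amb f in simp)
  moreover have "fd (\<lambda>x. amb (f x) (prod_str (f x))) q v
      = amb (f q) (prod_str (fd f q v)) + amb (fd f q v) (prod_str (f q))"
    by (rule fd_eqI[OF amb.FDERIV[OF d d']])
  ultimately show ?thesis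
    by (simp add: tangent_S2H2_iff push_def amb_commute[of "fd f q v"] amb_prod_str[of "f q", symmetric])
qed

text \<open>Let G be the matrix of \<open>g\<close> and M the matrix with columns \<open>E1\<close>,
  \<open>E2\<close>. Orthonormality says that M^T G M is the identity, so the inverse of G is M M^T;
  this is \<open>inv\<close>, with \<open>d\<close> = det G and \<open>m\<close> = det M.\<close>

lemma metric_trace_orthonormal:
  fixes g :: "complex \<Rightarrow> complex \<Rightarrow> real" and B :: "complex \<Rightarrow> complex \<Rightarrow> r33"
  assumes g: "\<And>v. linear (g v)" "\<And>v w. g v w = g w v"
    and B: "\<And>v. linear (B v)" "\<And>w. linear (\<lambda>v. B v w)"
    and E: "g E1 E1 = 1" "g E2 E2 = 1" "g E1 E2 = 0"
  shows "metric_trace g B = B E1 E1 + B E2 E2"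
proof -
  define x1 y1 x2 y2 where xy: "x1 = Re E1" "y1 = Im E1" "x2 = Re E2" "y2 = Im E2"
  define p r t where prt: "p = g 1 1" "r = g 1 \<i>" "t = g \<i> \<i>"
  have gl: "linear (\<lambda>v. g v w)" for w using g(1)[of w] by (simp add: g(2)[of _ w])
  have gexp: "g v w = Re v * Re w * p + (Re v * Im w + Im v * Re w) * r + Im v * Im w * t" for v w
    using linear_complex_expand[OF g(1), of v w] linear_complex_expand[OF gl, of v 1] linear_complex_expand[OF gl, of v \<i>]
      g(2)[of \<i> 1] by (simp add: prt algebra_simps)
  have Bexp: "B v w = (Re v * Re w) *\<^sub>R B 1 1 + (Re v * Im w) *\<^sub>R B 1 \<i> + (Im v * Re w) *\<^sub>R B \<i> 1 + (Im v * Im w) *\<^sub>R B \<i> \<i>" for v w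
    using linear_complex_expand[OF B(1), of v w] linear_complex_expand[OF B(2), of v 1] linear_complex_expand[OF B(2), of v \<i>]
    by (simp add: algebra_simps)
  have eqs: "p * x1 * x1 + 2 * r * x1 * y1 + t * y1 * y1 = 1" "p * x2 * x2 + 2 * r * x2 * y2 + t * y2 * y2 = 1"
     "p * x1 * x2 + r * (x1 * y2 + x2 * y1) + t * y1 * y2 = 0"
    using E unfolding gexp xy by (simp_all add: algebra_simps)
  define d m where "d = p * t - r * r" and "m = x1 * y2 - x2 * y1"
  have dm: "d * (m * m) = 1" "p * (m * m) = y1 * y1 + y2 * y2" "t * (m * m) = x1 * x1 + x2 * x2"
    "- r * (m * m) = x1 * y1 + x2 * y2"
    using eqs unfolding d_def m_def by algebra+
  then have "m \<noteq> 0" "d \<noteq> 0" by auto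
  then have md: "m * m = 1 / d" using dm(1) by (simp add: field_simps)
  have inv: "p / d = y1 * y1 + y2 * y2" "t / d = x1 * x1 + x2 * x2" "- r / d = x1 * y1 + x2 * y2"
    using dm(2-4) unfolding md by simp_all
  have "metric_trace g B = (t / d) *\<^sub>R B 1 1 + (- r / d) *\<^sub>R B 1 \<i> + (- r / d) *\<^sub>R B \<i> 1 + (p / d) *\<^sub>R B \<i> \<i>"
    unfolding metric_trace_def using g(2)[of \<i> 1]
    by (simp add: prt d_def scaleR_diff_right scaleR_add_right)
  also have "\<dots> = B E1 E1 + B E2 E2"
    unfolding inv by (subst (3 4) Bexp) (simp add: xy algebra_simps)
  finally show ?thesis .
qed

section \<open>Geometry of the surface at one point, in an orthonormal frame\<close>

locale point_frame =
  fixes f :: "complex \<Rightarrow> r33" and U :: "complex set" and q E1 E2 :: complex and n1 n2 :: r33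
  assumes U: "open U" and f: "smooth_on U f" and f_in: "\<And>x. x \<in> U \<Longrightarrow> f x \<in> S2 \<times> H2" and q: "q \<in> U"
    and ortho: "ortho_frame (f q) (push f q E1) (push f q E2) n1 n2"
begin

sublocale ortho_frame "f q" "push f q E1" "push f q E2" n1 n2 by (rule ortho)

lemma linear_push: "linear (push f q)"
  using fd_linear_arg[OF U f q] by (simp add: push_def[abs_def])

lemma coord_expand: "v = amb (push f q v) (push f q E1) *\<^sub>R E1 + amb (push f q v) (push f q E2) *\<^sub>R E2"
proof -
  define L where "L v = Complex (amb (push f q v) (push f q E1)) (amb (push f q v) (push f q E2))" for v
  have lin: "linear L"
    by (rule linearI) (auto simp: L_def complex_eq_iff linear_add[OF linear_push] linear_scale[OF linear_push] amb_simps)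
  have LE: "L (a *\<^sub>R E1 + b *\<^sub>R E2) = Complex a b" for a b
    by (simp add: L_def linear_add[OF linear_push] linear_scale[OF linear_push] frame_simps)
  have "surj L"
  proof (rule surjI)
    show "L (Re z *\<^sub>R E1 + Im z *\<^sub>R E2) = z" for z by (simp add: LE)
  qed
  then have "inj L" using lin linear_surjective_imp_injective by blast
  moreover have "L (amb (push f q v) (push f q E1) *\<^sub>R E1 + amb (push f q v) (push f q E2) *\<^sub>R E2) = L v"
    unfolding LE by (simp add: L_def)
  ultimately show ?thesis by (simp add: inj_eq)
qed

lemma push_expand: "push f q v = amb (push f q v) (push f q E1) *\<^sub>R push f q E1 + amb (push f q v) (push f q E2) *\<^sub>R push f q E2"
  by (subst coord_expand[of v]) (simp only: linear_add[OF linear_push] linear_scale[OF linear_push])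

lemma push_normal: "amb (push f q v) n1 = 0" "amb (push f q v) n2 = 0"
  by (subst push_expand, simp add: frame_simps)+

lemma normal_space_eq: "normal_space f q = {n \<in> tangent_S2H2 (f q). amb n (push f q E1) = 0 \<and> amb n (push f q E2) = 0}"
proof -
  have "amb n (push f q v) = 0" if "amb n (push f q E1) = 0" "amb n (push f q E2) = 0" for n v
    by (subst push_expand) (simp add: amb_simps that)
  then show ?thesis unfolding normal_space_def by blast
qed

lemma normal_part:
  "orth_proj (normal_space f q) (orth_proj (tangent_S2H2 (f q)) w) = amb w n1 *\<^sub>R n1 + amb w n2 *\<^sub>R n2"
  by (simp add: orth_proj_normal[OF normal_space_eq] orth_proj_tangent frame_simps)

lemma second_ff_eq: "second_ff f q v w = amb (fd (\<lambda>x. push f x w) q v) n1 *\<^sub>R n1 + amb (fd (\<lambda>x. push f x w) q v) n2 *\<^sub>R n2"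
  by (simp add: second_ff_def cov_deriv_def normal_part)

lemma normal_conn_eq: "normal_conn f N q v = amb (fd N q v) n1 *\<^sub>R n1 + amb (fd N q v) n2 *\<^sub>R n2"
  by (simp add: normal_conn_def cov_deriv_def normal_part)

lemma second_deriv_swap: "fd (\<lambda>x. push f x w) q v = fd (\<lambda>x. push f x v) q w"
  unfolding push_def by (rule fd_fd_swap[OF U f q])

lemma linear_second_deriv: "linear (fd (\<lambda>x. push f x w) q)" "linear (\<lambda>w. fd (\<lambda>x. push f x w) q v)"
proof -
  show "linear (fd (\<lambda>x. push f x w) q)" for w
    unfolding push_def by (rule fd_linear_arg[OF U smooth_on_fd[OF f] q])
  then show "linear (\<lambda>w. fd (\<lambda>x. push f x w) q v)"
    unfolding second_deriv_swap[of _ v] .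
qed

lemma second_ff_commute: "second_ff f q v w = second_ff f q w v"
  by (simp add: second_ff_eq second_deriv_swap[of v w])

lemma linear_second_ff: "linear (second_ff f q v)" "linear (\<lambda>v. second_ff f q v w)"
proof -
  show "linear (\<lambda>v. second_ff f q v w)" for w
    unfolding second_ff_eq
    by (rule linearI) (simp_all add: linear_add[OF linear_second_deriv(1)] linear_scale[OF linear_second_deriv(1)]
        amb_simps algebra_simps)
  moreover have "second_ff f q v = (\<lambda>w. second_ff f q w v)" by (rule ext) (rule second_ff_commute)
  ultimately show "linear (second_ff f q v)" by simp
qed

lemma mean_curv_eq: "mean_curv f q = (1/2) *\<^sub>R (second_ff f q E1 E1 + second_ff f q E2 E2)"
proof -
  have "linear (first_ff f q v)" for v
    unfolding first_ff_def
    by (rule linearI) (simp_all add: linear_add[OF linear_push] linear_scale[OF linear_push] amb_simps)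
  then have "metric_trace (first_ff f q) (second_ff f q) = second_ff f q E1 E1 + second_ff f q E2 E2"
    by (intro metric_trace_orthonormal linear_second_ff) (simp_all add: first_ff_def amb_commute frame_simps)
  then show ?thesis by (simp add: mean_curv_def)
qed

text \<open>The Hopf coefficient is the (2,0)-part of the symmetric form \<open>B\<close>. If it
  vanishes, \<open>B\<close> is a multiple of the conformal metric, and this can be tested in any
  orthonormal frame.\<close>

lemma hopf_vanishes_frame:
  assumes conf: "\<And>v w. first_ff f q v w = \<rho> * (v \<bullet> w)" and hopf: "hopf_coeff f q = 0"
  defines "B \<equiv> \<lambda>v w. 4 * amb (second_ff f q v w) (mean_curv f q) + amb (prod_str (push f q v)) (push f q w)"
  shows "B E1 E1 = B E2 E2" "B E1 E2 = 0"
proof -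
  have lin: "linear (B v)" "linear (\<lambda>v. B v w)" for v w
    unfolding B_def
    by (rule linearI; simp add: linear_add[OF linear_second_ff(1)] linear_scale[OF linear_second_ff(1)]
      linear_add[OF linear_second_ff(2)] linear_scale[OF linear_second_ff(2)]
      linear_add[OF linear_push] linear_scale[OF linear_push] amb_simps prod_str_simps algebra_simps)+
  have sym: "B v w = B w v" for v w
    unfolding B_def by (simp only: second_ff_commute[of v w] amb_prod_str_commute[of "push f q v"])
  have Bexp: "B v w = Re v * Re w * B 1 1 + (Re v * Im w + Im v * Re w) * B 1 \<i> + Im v * Im w * B \<i> \<i>" for v w
    using linear_complex_expand[OF lin(1), of v w] linear_complex_expand[OF lin(2), of v 1] linear_complex_expand[OF lin(2), of v \<i>]
    by (simp add: sym[of \<i> 1] algebra_simps)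
  have half: "B (a *\<^sub>R v) (b *\<^sub>R w) = a * b * B v w" for a b v w
    using linear_scale[OF lin(1), of "a *\<^sub>R v" b w] linear_scale[OF lin(2), of a v w] by simp
  have "hopf_coeff f q = complexify B del_z del_z"
    unfolding hopf_coeff_def complexify_def B_def by (simp add: complex_eq_iff)
  also have "\<dots> = Complex ((B 1 1 - B \<i> \<i>) / 4) (- B 1 \<i> / 2)"
    using half[of "1/2" 1 "1/2" 1] half[of "-1/2" \<i> "-1/2" \<i>] half[of "1/2" 1 "-1/2" \<i>] half[of "-1/2" \<i> "1/2" 1]
    unfolding complexify_def del_z_def by (simp add: complex_eq_iff sym[of \<i> 1])
  finally have B: "B 1 1 = B \<i> \<i>" "B 1 \<i> = 0" using hopf by (simp_all add: complex_eq_iff)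
  have B_inner: "B v w = B 1 1 * (v \<bullet> w)" for v w
    unfolding Bexp[of v w] B by (simp add: B(1) inner_complex_def algebra_simps)
  have E: "\<rho> * (E1 \<bullet> E1) = 1" "\<rho> * (E2 \<bullet> E2) = 1" "\<rho> * (E1 \<bullet> E2) = 0"
    using frame_simps by (simp_all add: conf[symmetric] first_ff_def)
  then have "\<rho> \<noteq> 0" by auto
  moreover have "\<rho> * (E1 \<bullet> E1) = \<rho> * (E2 \<bullet> E2)" using E by simp
  ultimately have "E1 \<bullet> E1 = E2 \<bullet> E2" "E1 \<bullet> E2 = 0" using E(3) by simp_all
  then show "B E1 E1 = B E2 E2" "B E1 E2 = 0"
    using B_inner[of E1 E1] B_inner[of E2 E2] B_inner[of E1 E2] by simp_all
qed

text \<open>Tensoriality of the second fundamental form and invariance of the mean curvature vector.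
  They carry the information on the Hopf differential from one chart to another.\<close>

lemma change_coord:
  assumes U': "open U'" and f': "smooth_on U' f'" "\<And>x. x \<in> U' \<Longrightarrow> f' x \<in> S2 \<times> H2"
    and \<phi>: "smooth_on U \<phi>" "\<phi> ` U \<subseteq> U'" and eq: "\<And>x. x \<in> U \<Longrightarrow> f x = f' (\<phi> x)"
  defines "D \<equiv> fd \<phi> q"
  shows "push f q v = push f' (\<phi> q) (D v)"
    and "point_frame f' U' (\<phi> q) (D E1) (D E2) n1 n2"
    and "second_ff f q v w = second_ff f' (\<phi> q) (D v) (D w)"
    and "mean_curv f q = mean_curv f' (\<phi> q)"
proof -
  have q': "\<phi> x \<in> U'" if "x \<in> U" for x using \<phi>(2) that by blast
  have d\<phi>: "(\<phi> has_derivative fd \<phi> x) (at x)" if "x \<in> U" for x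
    by (rule smooth_on_has_derivative[OF U \<phi>(1) that])
  have push': "push f x v = push f' (\<phi> x) (fd \<phi> x v)" if "x \<in> U" for x v
  proof -
    have "fd f x = fd (\<lambda>x. f' (\<phi> x)) x" by (rule fd_cong[OF U that eq])
    moreover have "fd (\<lambda>x. f' (\<phi> x)) x v = fd f' (\<phi> x) (fd \<phi> x v)"
      by (rule fd_eqI[OF has_derivative_compose[OF d\<phi>[OF that] smooth_on_has_derivative[OF U' f'(1) q'[OF that]]]])
    ultimately show ?thesis by (simp add: push_def)
  qed
  show push: "push f q v = push f' (\<phi> q) (D v)" for v unfolding D_def by (rule push'[OF q])
  have ortho': "ortho_frame (f' (\<phi> q)) (push f' (\<phi> q) (D E1)) (push f' (\<phi> q) (D E2)) n1 n2"
    using ortho_frame_axioms by (simp add: push eq[OF q])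
  show pf: "point_frame f' U' (\<phi> q) (D E1) (D E2) n1 n2"
    by (intro point_frame.intro U' f' q'[OF q] ortho')
  interpret f': point_frame f' U' "\<phi> q" "D E1" "D E2" n1 n2 by (rule pf)
  have lin': "linear (push f' y)" if "y \<in> U'" for y
    using fd_linear_arg[OF U' f'(1) that] by (simp add: push_def[abs_def])
  \<comment> \<open>The second derivative of \<open>\<phi>\<close> enters only through a vector
    tangent to the surface, which the normal vectors do not see.\<close>
  have D2: "fd (\<lambda>x. push f x w) q v = fd (\<lambda>y. push f' y (D w)) (\<phi> q) (D v)
      + push f' (\<phi> q) (fd (\<lambda>x. fd \<phi> x w) q v)" for v w
  proof -
    have pd: "((\<lambda>x. push f' (\<phi> x) a) has_derivative (\<lambda>v. fd (\<lambda>y. push f' y a) (\<phi> q) (D v))) (at q)" for a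
      unfolding D_def push_def
      by (rule has_derivative_compose[OF d\<phi>[OF q] smooth_on_has_derivative[OF U' smooth_on_fd[OF f'(1)] q'[OF q]]])
    have dd: "((\<lambda>x. fd \<phi> x w) has_derivative (\<lambda>v. fd (\<lambda>x. fd \<phi> x w) q v)) (at q)"
      by (rule smooth_on_has_derivative[OF U smooth_on_fd[OF \<phi>(1)] q])
    have "fd (\<lambda>x. push f x w) q = fd (\<lambda>x. Re (fd \<phi> x w) *\<^sub>R push f' (\<phi> x) 1 + Im (fd \<phi> x w) *\<^sub>R push f' (\<phi> x) \<i>) q"
    proof (rule fd_cong[OF U q])
      fix x assume x: "x \<in> U"
      show "push f x w = Re (fd \<phi> x w) *\<^sub>R push f' (\<phi> x) 1 + Im (fd \<phi> x w) *\<^sub>R push f' (\<phi> x) \<i>"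
        unfolding push'[OF x] by (rule linear_complex_expand[OF lin'[OF q'[OF x]]])
    qed
    then have "fd (\<lambda>x. push f x w) q v = fd (\<lambda>x. Re (fd \<phi> x w) *\<^sub>R push f' (\<phi> x) 1 + Im (fd \<phi> x w) *\<^sub>R push f' (\<phi> x) \<i>) q v"
      by (rule fun_cong)
    also have "\<dots> = (Re (D w) *\<^sub>R fd (\<lambda>y. push f' y 1) (\<phi> q) (D v) + Re (fd (\<lambda>x. fd \<phi> x w) q v) *\<^sub>R push f' (\<phi> q) 1)
      + (Im (D w) *\<^sub>R fd (\<lambda>y. push f' y \<i>) (\<phi> q) (D v) + Im (fd (\<lambda>x. fd \<phi> x w) q v) *\<^sub>R push f' (\<phi> q) \<i>)"
      unfolding D_def
      by (rule fd_eqI) (intro has_derivative_add has_derivative_scaleR pd[unfolded D_def] has_derivative_Re has_derivative_Im dd)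
    also have "\<dots> = (Re (D w) *\<^sub>R fd (\<lambda>y. push f' y 1) (\<phi> q) (D v) + Im (D w) *\<^sub>R fd (\<lambda>y. push f' y \<i>) (\<phi> q) (D v))
       + push f' (\<phi> q) (fd (\<lambda>x. fd \<phi> x w) q v)"
      by (simp add: linear_complex_expand[OF lin'[OF q'[OF q]], of "fd (\<lambda>x. fd \<phi> x w) q v"])
    also have "Re (D w) *\<^sub>R fd (\<lambda>y. push f' y 1) (\<phi> q) (D v) + Im (D w) *\<^sub>R fd (\<lambda>y. push f' y \<i>) (\<phi> q) (D v)
        = fd (\<lambda>y. push f' y (D w)) (\<phi> q) (D v)"
      by (rule linear_complex_expand[OF f'.linear_second_deriv(2), symmetric])
    finally show ?thesis .
  qed
  show ff: "second_ff f q v w = second_ff f' (\<phi> q) (D v) (D w)" for v w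
    by (simp add: second_ff_eq f'.second_ff_eq D2 amb_simps f'.push_normal)
  show "mean_curv f q = mean_curv f' (\<phi> q)"
    by (simp add: mean_curv_eq f'.mean_curv_eq ff)
qed

end

section \<open>The algebraic core\<close>

text \<open>\<open>E\<close> is the integrability condition; \<open>E1\<close> and \<open>E2\<close>
  are its two derivatives with \<open>H\<close> and \<open>k\<close> eliminated. Being linear in
  \<open>c\<close> and \<open>s\<close>, they determine these from \<open>U\<close> and
  \<open>T\<close>; the unit condition then leaves finitely many pairs \<open>(x, y)\<close>, all
  with the same sum.\<close>

lemma compatibility_algebra:
  fixes c s T U k H :: real
  assumes cs: "c * c + s * s = 1" and cU: "c * U - s * T = 1"
    and E: "H = k * (U * U - T * T)" and H: "H \<noteq> 0"
    and E1: "(U * U - T * T) * (6 * s * T * U - 3 * c * T * T - c * U * U) = U * (U * U + T * T)"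
    and E2: "(U * U - T * T) * (6 * c * T * U - 3 * s * U * U - s * T * T) = T * (U * U + T * T)"
  shows "U * U + T * T = 28 / 3"
proof -
  define x y where "x = U * U" and "y = T * T"
  have W: "x - y \<noteq> 0" using E H by (auto simp: x_def y_def)
  have pos: "x \<ge> 0" "y \<ge> 0" by (simp_all add: x_def y_def)
  have N: "x + y \<noteq> 0" using W pos by auto
  \<comment> \<open>In \<open>T\<close> times \<open>E1\<close> minus \<open>U\<close> times
    \<open>E2\<close> the right-hand sides cancel. The result is homogeneous linear in
    \<open>c\<close>, \<open>s\<close>, so together with \<open>cU\<close> it determines
    both.\<close>
  have "(U * U - T * T) * (s * U * (3 * x + 7 * y) - c * T * (3 * y + 7 * x)) = 0"
    using E1 E2 unfolding x_def y_def by algebra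
  then have ratio: "s * U * (3 * x + 7 * y) = c * T * (3 * y + 7 * x)"
    using W by (simp add: x_def y_def)
  have c: "3 * c * (x - y) * (x + y) = U * (3 * x + 7 * y)"
    using ratio cU unfolding x_def y_def by algebra
  have s: "3 * s * (x - y) * (x + y) = T * (3 * y + 7 * x)"
    using ratio cU unfolding x_def y_def by algebra
  \<comment> \<open>This is \<open>U\<close> times \<open>E1\<close> plus \<open>T\<close> times
    \<open>E2\<close>. Inserting \<open>c\<close> and \<open>s\<close> gives a homogeneous cubic,
    which fixes the ratio of \<open>x\<close> and \<open>y\<close>; the scale comes from
    \<open>cs\<close>.\<close>
  have "(x - y) * (s * T * (3 * x - y) + c * U * (3 * y - x)) = (x + y) * (x + y)"
    using E1 E2 unfolding x_def y_def by algebra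
  then have "y * (3 * y + 7 * x) * (3 * x - y) + x * (3 * x + 7 * y) * (3 * y - x) = 3 * (x + y) * (x + y) * (x + y)"
    using c s unfolding x_def y_def by algebra
  then have "(x + y) * ((3 * x - y) * (x - 3 * y)) = 0" by algebra
  then have cases: "y = 3 * x \<or> x = 3 * y" using N by auto
  have "9 * (x - y) * (x - y) * (x + y) * (x + y) * (c * c + s * s)
      = x * (3 * x + 7 * y) * (3 * x + 7 * y) + y * (3 * y + 7 * x) * (3 * y + 7 * x)"
    using c s unfolding x_def y_def by algebra
  then have sq: "9 * (x - y) * (x - y) * (x + y) * (x + y)
      = x * (3 * x + 7 * y) * (3 * x + 7 * y) + y * (3 * y + 7 * x) * (3 * y + 7 * x)"
    using cs by simp
  from cases have "x + y = 28 / 3"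
  proof
    assume y: "y = 3 * x"
    \<comment> \<open>For y = 3x the two sides of \<open>sq\<close> are 9 * 4 * 16 x^4 = 576 x^4 and
      (24^2 + 3 * 16^2) x^3 = 1344 x^3. Hence x = 7/3 and x + y = 4x = 28/3.\<close>
    then have "x * x * x * (576 * x - 1344) = 0" using sq by algebra
    moreover have "x \<noteq> 0" using y N by auto
    ultimately show ?thesis using y by simp
  next
    assume x: "x = 3 * y"
    then have "y * y * y * (576 * y - 1344) = 0" using sq by algebra
    moreover have "y \<noteq> 0" using x N by auto
    ultimately show ?thesis using x by simp
  qed
  then show ?thesis by (simp add: x_def y_def)
qed

text \<open>\<open>\<tau>1\<close>, \<open>\<tau>2\<close>, \<open>k1\<close>, \<open>k2\<close>
  stand for derivatives along \<open>e1\<close> and \<open>e2\<close>, and \<open>m2\<close>,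
  \<open>m1\<close> for the mixed second derivatives of \<open>\<tau>\<close>. The first two
  equations \<open>m\<close> are the derivatives of \<open>2 * k * \<tau>2 = B * U\<close> along
  \<open>e1\<close> and of \<open>2 * k * \<tau>1 = A * T\<close> along \<open>e2\<close>; the third
  is the bracket relation.\<close>

lemma bracket_algebra:
  fixes A B H k c s \<tau> T U P Q R S :: real
  assumes nz: "A \<noteq> 0" "B \<noteq> 0" "H \<noteq> 0" "k \<noteq> 0"
    and cs: "c * c + s * s = 1" and TU: "T = \<tau> * c - s" "U = c + \<tau> * s"
    and shape: "R = H * c + k * U" "P = - H * s + k * T" "Q = H * c - k * U" "S = - H * s - k * T"
    and forms: "\<omega>1 = - B * P / (8 * H * k)" "\<omega>2 = - A * Q / (8 * H * k)"
      "\<theta>1 = - A * P / (8 * H * k)" "\<theta>2 = - B * Q / (8 * H * k)"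
    and \<tau>: "\<tau>1 = A * T / (2 * k)" "\<tau>2 = B * U / (2 * k)"
    and k: "k1 = - A * R / (4 * H)" "k2 = B * S / (4 * H)"
    and m: "2 * (k * m2 + k1 * \<tau>2) = B * (s * \<tau>1 + T * \<theta>1)" "2 * (k * m1 + k2 * \<tau>1) = A * (c * \<tau>2 - U * \<theta>2)"
      "m2 - m1 = - \<omega>1 * \<tau>1 - \<omega>2 * \<tau>2"
  shows "H = k * (U * U - T * T)"
proof -
  \<comment> \<open>The common factor of both mixed derivatives and of the bracket term; cancelling
    it removes \<open>A\<close> and \<open>B\<close>.\<close>
  define N where "N = A * B / (8 * H * k)"
  have "2 * k * m2 = B * (s * \<tau>1 + T * \<theta>1) - 2 * k1 * \<tau>2" using m(1) by (simp add: algebra_simps)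
  also have "\<dots> = N * (T * (4 * H * s - P) + 2 * R * U)"
    unfolding \<tau> forms k N_def using nz by (simp add: field_simps)
  finally have m2: "2 * k * m2 = N * (T * (4 * H * s - P) + 2 * R * U)" .
  have "2 * k * m1 = A * (c * \<tau>2 - U * \<theta>2) - 2 * k2 * \<tau>1" using m(2) by (simp add: algebra_simps)
  also have "\<dots> = N * (U * (4 * H * c + Q) - 2 * S * T)"
    unfolding \<tau> forms k N_def using nz by (simp add: field_simps)
  finally have m1: "2 * k * m1 = N * (U * (4 * H * c + Q) - 2 * S * T)" .
  have "2 * k * (m2 - m1) = N * (P * T + Q * U)"
    unfolding m(3) \<tau> forms N_def using nz by (simp add: field_simps)
  then have "N * (P * T + Q * U) = N * (T * (4 * H * s - P) + 2 * R * U) - N * (U * (4 * H * c + Q) - 2 * S * T)"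
    using m1 m2 by (simp add: right_diff_distrib)
  also have "\<dots> = N * (T * (4 * H * s - P) + 2 * R * U - (U * (4 * H * c + Q) - 2 * S * T))"
    by (simp add: right_diff_distrib)
  finally have "P * T + Q * U = T * (4 * H * s - P) + 2 * R * U - (U * (4 * H * c + Q) - 2 * S * T)"
    using nz by (simp add: N_def)
  then have "H * (c * U - s * T) = k * (U * U - T * T)" unfolding shape by (simp add: algebra_simps)
  moreover have "c * U - s * T = 1" unfolding TU using cs by (simp add: algebra_simps)
  ultimately show ?thesis by simp
qed

text \<open>The two premises are the derivatives of \<open>k * (U * U - T * T)\<close> along
  \<open>e1\<close> and \<open>e2\<close>, which vanish because \<open>H\<close> is constant.
  Replacing \<open>H\<close> by means of \<open>E\<close> makes the remaining \<open>A\<close>,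
  \<open>B\<close>, \<open>H\<close>, \<open>k\<close> common factors, so relations in
  \<open>c\<close>, \<open>s\<close>, \<open>T\<close>, \<open>U\<close> alone result.\<close>

lemma derived_constraint_algebra:
  fixes A B H k c s \<tau> T U P Q R S :: real
  assumes nz: "A \<noteq> 0" "B \<noteq> 0" "H \<noteq> 0" "k \<noteq> 0"
    and shape: "R = H * c + k * U" "P = - H * s + k * T" "Q = H * c - k * U" "S = - H * s - k * T"
    and forms: "\<theta>1 = - A * P / (8 * H * k)" "\<theta>2 = - B * Q / (8 * H * k)"
    and \<tau>: "\<tau>1 = A * T / (2 * k)" "\<tau>2 = B * U / (2 * k)"
    and k: "k1 = - A * R / (4 * H)" "k2 = B * S / (4 * H)"
    and E: "H = k * (U * U - T * T)"
  shows "k * (2 * U * (s * \<tau>1 + T * \<theta>1) - 2 * T * (c * \<tau>1 - U * \<theta>1)) + k1 * (U * U - T * T) = 0 \<Longrightarrow>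
      (U * U - T * T) * (6 * s * T * U - 3 * c * T * T - c * U * U) = U * (U * U + T * T)"
    and "k * (2 * U * (s * \<tau>2 + T * \<theta>2) - 2 * T * (c * \<tau>2 - U * \<theta>2)) + k2 * (U * U - T * T) = 0 \<Longrightarrow>
      (U * U - T * T) * (6 * c * T * U - 3 * s * U * U - s * T * T) = T * (U * U + T * T)"
proof -
  define W where "W = U * U - T * T"
  have HW: "H = k * W" using E by (simp add: W_def)
  {
    assume "k * (2 * U * (s * \<tau>1 + T * \<theta>1) - 2 * T * (c * \<tau>1 - U * \<theta>1)) + k1 * (U * U - T * T) = 0"
    moreover have "k * (2 * U * (s * \<tau>1 + T * \<theta>1) - 2 * T * (c * \<tau>1 - U * \<theta>1)) + k1 * (U * U - T * T)
        = (A / (4 * H)) * (4 * H * s * U * T - 2 * P * U * T - 4 * H * c * T * T - R * W)"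
      unfolding \<tau> forms k W_def[symmetric] using nz by (simp add: field_simps)
    ultimately have "4 * H * s * U * T - 2 * P * U * T - 4 * H * c * T * T - R * W = 0"
      using nz by simp
    then have "k * (W * (6 * s * T * U - 4 * c * T * T - c * W) - U * (2 * T * T + W)) = 0"
      unfolding shape HW by (simp add: algebra_simps)
    then have "W * (6 * s * T * U - 4 * c * T * T - c * W) = U * (2 * T * T + W)" using nz by simp
    then show "(U * U - T * T) * (6 * s * T * U - 3 * c * T * T - c * U * U) = U * (U * U + T * T)"
      unfolding W_def by (simp add: algebra_simps)
  next
    assume "k * (2 * U * (s * \<tau>2 + T * \<theta>2) - 2 * T * (c * \<tau>2 - U * \<theta>2)) + k2 * (U * U - T * T) = 0"
    moreover have "k * (2 * U * (s * \<tau>2 + T * \<theta>2) - 2 * T * (c * \<tau>2 - U * \<theta>2)) + k2 * (U * U - T * T)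
        = (B / (4 * H)) * (4 * H * s * U * U - 2 * Q * U * T - 4 * H * c * T * U + S * W)"
      unfolding \<tau> forms k W_def[symmetric] using nz by (simp add: field_simps)
    ultimately have "4 * H * s * U * U - 2 * Q * U * T - 4 * H * c * T * U + S * W = 0"
      using nz by simp
    then have "k * (W * (6 * c * T * U - 4 * s * U * U + s * W) - T * (2 * U * U - W)) = 0"
      unfolding shape HW by (simp add: algebra_simps)
    then have "W * (6 * c * T * U - 4 * s * U * U + s * W) = T * (2 * U * U - W)" using nz by simp
    then show "(U * U - T * T) * (6 * c * T * U - 3 * s * U * U - s * T * T) = T * (U * U + T * T)"
      unfolding W_def by (simp add: algebra_simps)
  }
qed

section \<open>Frames diagonalising the product structure\<close>

locale diagonal_frame =
  fixes f :: "complex \<Rightarrow> r33" and V :: "complex set" and E1 E2 :: "complex \<Rightarrow> complex"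
  assumes V: "open V" "connected V" "V \<noteq> {}"
    and f: "smooth_on V f" and f_in: "\<And>q. q \<in> V \<Longrightarrow> f q \<in> S2 \<times> H2"
    and E: "smooth_on V E1" "smooth_on V E2"
    and e_unit: "\<And>q. q \<in> V \<Longrightarrow> amb (push f q (E1 q)) (push f q (E1 q)) = 1"
      "\<And>q. q \<in> V \<Longrightarrow> amb (push f q (E2 q)) (push f q (E2 q)) = 1"
    and e_orth: "\<And>q. q \<in> V \<Longrightarrow> amb (push f q (E1 q)) (push f q (E2 q)) = 0"
    and diag: "\<And>q. q \<in> V \<Longrightarrow> amb (prod_str (push f q (E1 q))) (push f q (E2 q)) = 0"
    and transversal: "\<And>q. q \<in> V \<Longrightarrow> (amb (prod_str (push f q (E1 q))) (push f q (E1 q)))\<^sup>2 < 1"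
      "\<And>q. q \<in> V \<Longrightarrow> (amb (prod_str (push f q (E2 q))) (push f q (E2 q)))\<^sup>2 < 1"
begin

definition "e1 x = push f x (E1 x)"
definition "e2 x = push f x (E2 x)"
definition "a x = amb (prod_str (e1 x)) (e1 x)"
definition "b x = amb (prod_str (e2 x)) (e2 x)"
definition "A x = sqrt (1 - (a x)\<^sup>2)"
definition "B x = sqrt (1 - (b x)\<^sup>2)"
definition "n1 x = (1 / A x) *\<^sub>R (prod_str (e1 x) - a x *\<^sub>R e1 x)"
definition "n2 x = (1 / B x) *\<^sub>R (prod_str (e2 x) - b x *\<^sub>R e2 x)"

lemma AB_pos: "q \<in> V \<Longrightarrow> A q > 0" "q \<in> V \<Longrightarrow> B q > 0"
  using transversal by (auto simp: A_def B_def a_def b_def e1_def e2_def)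

lemma AB_square: "q \<in> V \<Longrightarrow> A q * A q = 1 - a q * a q" "q \<in> V \<Longrightarrow> B q * B q = 1 - b q * b q"
  using transversal[of q] by (simp_all add: A_def B_def a_def b_def e1_def e2_def power2_eq_square)

lemma prod_str_e: "q \<in> V \<Longrightarrow> prod_str (e1 q) = a q *\<^sub>R e1 q + A q *\<^sub>R n1 q" "q \<in> V \<Longrightarrow> prod_str (e2 q) = b q *\<^sub>R e2 q + B q *\<^sub>R n2 q"
  using AB_pos[of q] by (simp_all add: n1_def n2_def)

text \<open>Since \<open>prod_str\<close> is an involution, it preserves the plane of
  \<open>e1\<close> and \<open>n1\<close>, with matrix rows (a, A) and (A, -a), and likewise the
  plane of \<open>e2\<close> and \<open>n2\<close>.\<close>

lemma prod_str_n:
  assumes q: "q \<in> V"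
  shows "prod_str (n1 q) = A q *\<^sub>R e1 q - a q *\<^sub>R n1 q" "prod_str (n2 q) = B q *\<^sub>R e2 q - b q *\<^sub>R n2 q"
proof -
  have "A q *\<^sub>R prod_str (n1 q) = A q *\<^sub>R (A q *\<^sub>R e1 q - a q *\<^sub>R n1 q)"
  proof -
    have "e1 q = a q *\<^sub>R prod_str (e1 q) + A q *\<^sub>R prod_str (n1 q)"
      using arg_cong[OF prod_str_e(1)[OF q], of prod_str] by (simp only: prod_str_involution prod_str_simps)
    then have "A q *\<^sub>R prod_str (n1 q) = e1 q - a q *\<^sub>R (a q *\<^sub>R e1 q + A q *\<^sub>R n1 q)"
      unfolding prod_str_e(1)[OF q] by (metis add_diff_cancel_left')
    also have "\<dots> = A q *\<^sub>R (A q *\<^sub>R e1 q - a q *\<^sub>R n1 q)"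
      by (simp add: AB_square(1)[OF q] scaleR_diff_left scaleR_diff_right scaleR_add_right mult.commute)
    finally show ?thesis .
  qed
  then show "prod_str (n1 q) = A q *\<^sub>R e1 q - a q *\<^sub>R n1 q" using AB_pos[OF q] by simp
  have "B q *\<^sub>R prod_str (n2 q) = B q *\<^sub>R (B q *\<^sub>R e2 q - b q *\<^sub>R n2 q)"
  proof -
    have "e2 q = b q *\<^sub>R prod_str (e2 q) + B q *\<^sub>R prod_str (n2 q)"
      using arg_cong[OF prod_str_e(2)[OF q], of prod_str] by (simp only: prod_str_involution prod_str_simps)
    then have "B q *\<^sub>R prod_str (n2 q) = e2 q - b q *\<^sub>R (b q *\<^sub>R e2 q + B q *\<^sub>R n2 q)"
      unfolding prod_str_e(2)[OF q] by (metis add_diff_cancel_left')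
    also have "\<dots> = B q *\<^sub>R (B q *\<^sub>R e2 q - b q *\<^sub>R n2 q)"
      by (simp add: AB_square(2)[OF q] scaleR_diff_left scaleR_diff_right scaleR_add_right mult.commute)
    finally show ?thesis .
  qed
  then show "prod_str (n2 q) = B q *\<^sub>R e2 q - b q *\<^sub>R n2 q" using AB_pos[OF q] by simp
qed

lemma frame:
  assumes q: "q \<in> V"
  shows "point_frame f V q (E1 q) (E2 q) (n1 q) (n2 q)"
proof -
  have t: "e1 q \<in> tangent_S2H2 (f q)" "e2 q \<in> tangent_S2H2 (f q)"
    unfolding e1_def e2_def by (intro push_tangent[OF V(1) f f_in q], assumption)+
  have u: "amb (e1 q) (e1 q) = 1" "amb (e2 q) (e2 q) = 1" "amb (e1 q) (e2 q) = 0" "amb (e2 q) (e1 q) = 0"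
    using e_unit e_orth q by (simp_all add: e1_def e2_def amb_commute)
  have F: "amb (prod_str (e1 q)) (e1 q) = a q" "amb (prod_str (e2 q)) (e2 q) = b q" "amb (prod_str (e1 q)) (e2 q) = 0"
    "amb (prod_str (e2 q)) (e1 q) = 0"
    using diag[OF q] amb_prod_str_commute[of "e2 q" "e1 q"] by (simp_all add: a_def b_def e1_def e2_def)
  have F': "amb (e1 q) (prod_str (e1 q)) = a q" "amb (e2 q) (prod_str (e2 q)) = b q" "amb (e2 q) (prod_str (e1 q)) = 0"
    "amb (e1 q) (prod_str (e2 q)) = 0"
    using F by (simp_all add: amb_prod_str)
  have "amb (n1 q) (n1 q) = (1 / A q) * (1 / A q) * (1 - a q * a q)"
    "amb (n2 q) (n2 q) = (1 / B q) * (1 / B q) * (1 - b q * b q)"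
    by (simp_all add: n1_def n2_def amb_simps u F F' right_diff_distrib)
  then have n: "amb (n1 q) (n1 q) = 1" "amb (n2 q) (n2 q) = 1"
    using AB_pos[OF q] by (simp_all flip: AB_square[OF q])
  have en: "amb (e1 q) (n1 q) = 0" "amb (e1 q) (n2 q) = 0" "amb (e2 q) (n1 q) = 0" "amb (e2 q) (n2 q) = 0" "amb (n1 q) (n2 q) = 0"
    by (simp_all add: n1_def n2_def amb_simps u F F')
  have tn: "n1 q \<in> tangent_S2H2 (f q)" "n2 q \<in> tangent_S2H2 (f q)"
    unfolding n1_def n2_def by (intro tangent_S2H2_scaleR_diff tangent_S2H2_prod_str t)+
  have "ortho_frame (f q) (e1 q) (e2 q) (n1 q) (n2 q)"
    by (intro ortho_frame.intro f_in[OF q] t tn u(1-3) n en)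
  then show ?thesis
    by (intro point_frame.intro V(1) f f_in q) (auto simp: e1_def e2_def)
qed

lemma sm_e: "smooth_on V e1" "smooth_on V e2"
  unfolding e1_def[abs_def] e2_def[abs_def] push_def by (intro smooth_on_fd_field V f E)+

lemma sm_ab: "smooth_on V a" "smooth_on V b"
  unfolding a_def[abs_def] b_def[abs_def] by (intro smooth_intros sm_e V(1))+

lemma sm_AB: "smooth_on V A" "smooth_on V B"
  unfolding A_def[abs_def] B_def[abs_def]
  by (intro smooth_intros sm_ab V(1); use transversal in \<open>simp add: a_def b_def e1_def e2_def\<close>)+

lemma sm_n: "smooth_on V n1" "smooth_on V n2"
proof -
  have "x \<in> V \<Longrightarrow> A x \<noteq> 0" "x \<in> V \<Longrightarrow> B x \<noteq> 0" for x using AB_pos[of x] by auto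
  then show "smooth_on V n1" "smooth_on V n2"
    unfolding n1_def[abs_def] n2_def[abs_def] by (intro smooth_intros sm_e sm_ab sm_AB V(1); simp)+
qed

lemmas sm = f sm_e sm_ab sm_AB sm_n

section \<open>Differentiation rules and structure equations of the frame\<close>

lemma D_eq: "q \<in> V \<Longrightarrow> (\<And>x. x \<in> V \<Longrightarrow> \<phi> x = \<psi> x) \<Longrightarrow> fd \<phi> q v = fd \<psi> q v"
  using fd_cong[OF V(1), of q \<phi> \<psi>] by simp

lemma D_const: "q \<in> V \<Longrightarrow> (\<And>x. x \<in> V \<Longrightarrow> \<phi> x = c) \<Longrightarrow> fd \<phi> q v = 0"
  using D_eq[of q \<phi> "\<lambda>x. c"] by simp

lemmas has_D = smooth_on_has_derivative[OF V(1)]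

lemma D_amb: "smooth_on V G \<Longrightarrow> smooth_on V K \<Longrightarrow> q \<in> V \<Longrightarrow>
    fd (\<lambda>x. amb (G x) (K x)) q v = amb (G q) (fd K q v) + amb (fd G q v) (K q)"
  by (rule fd_eqI[OF amb.FDERIV]) (rule has_D; assumption)+

lemma D_mult: "smooth_on V g \<Longrightarrow> smooth_on V k \<Longrightarrow> q \<in> V \<Longrightarrow>
    fd (\<lambda>x. g x * k x) q v = g q * fd k q v + fd g q v * (k q :: real)"
  by (rule fd_eqI[OF has_derivative_mult]) (rule has_D; assumption)+

lemma D_add: "smooth_on V g \<Longrightarrow> smooth_on V k \<Longrightarrow> q \<in> V \<Longrightarrow> fd (\<lambda>x. g x + k x) q v = fd g q v + fd k q v"
  by (rule fd_eqI[OF has_derivative_add]) (rule has_D; assumption)+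

lemma D_diff: "smooth_on V g \<Longrightarrow> smooth_on V k \<Longrightarrow> q \<in> V \<Longrightarrow> fd (\<lambda>x. g x - k x) q v = fd g q v - fd k q v"
  by (rule fd_eqI[OF has_derivative_diff]) (rule has_D; assumption)+

lemma D_amb_const: "smooth_on V G \<Longrightarrow> smooth_on V K \<Longrightarrow> (\<And>x. x \<in> V \<Longrightarrow> amb (G x) (K x) = c) \<Longrightarrow> q \<in> V \<Longrightarrow>
    amb (fd G q v) (K q) = - amb (G q) (fd K q v)"
  using D_amb[of G K q v] D_const[of q "\<lambda>x. amb (G x) (K x)" c v] by simp

lemma D_prod_str: "smooth_on V G \<Longrightarrow> q \<in> V \<Longrightarrow> fd (\<lambda>x. prod_str (G x)) q v = prod_str (fd G q v)"
  by (rule fd_bounded_linear[OF V(1) _ _ bounded_linear_prod_str])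

lemma frame_props:
  assumes q: "q \<in> V"
  shows "amb (e1 q) (e1 q) = 1" "amb (e2 q) (e2 q) = 1" "amb (n1 q) (n1 q) = 1" "amb (n2 q) (n2 q) = 1"
    "amb (e1 q) (e2 q) = 0" "amb (e1 q) (n1 q) = 0" "amb (e1 q) (n2 q) = 0" "amb (e2 q) (n1 q) = 0" "amb (e2 q) (n2 q) = 0" "amb (n1 q) (n2 q) = 0"
    "amb (e2 q) (e1 q) = 0" "amb (n1 q) (e1 q) = 0" "amb (n2 q) (e1 q) = 0" "amb (n1 q) (e2 q) = 0" "amb (n2 q) (e2 q) = 0" "amb (n2 q) (n1 q) = 0"
    "amb (f q) (e1 q) = 0" "amb (f q) (e2 q) = 0" "amb (f q) (n1 q) = 0" "amb (f q) (n2 q) = 0"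
    "amb (e1 q) (f q) = 0" "amb (e2 q) (f q) = 0" "amb (n1 q) (f q) = 0" "amb (n2 q) (f q) = 0"
proof -
  interpret point_frame f V q "E1 q" "E2 q" "n1 q" "n2 q" by (rule frame[OF q])
  note fs = frame_simps[folded e1_def e2_def]
  show "amb (e1 q) (e1 q) = 1" "amb (e2 q) (e2 q) = 1" "amb (n1 q) (n1 q) = 1" "amb (n2 q) (n2 q) = 1"
    "amb (e1 q) (e2 q) = 0" "amb (e1 q) (n1 q) = 0" "amb (e1 q) (n2 q) = 0" "amb (e2 q) (n1 q) = 0" "amb (e2 q) (n2 q) = 0" "amb (n1 q) (n2 q) = 0"
    "amb (e2 q) (e1 q) = 0" "amb (n1 q) (e1 q) = 0" "amb (n2 q) (e1 q) = 0" "amb (n1 q) (e2 q) = 0" "amb (n2 q) (e2 q) = 0" "amb (n2 q) (n1 q) = 0"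
    "amb (f q) (e1 q) = 0" "amb (f q) (e2 q) = 0" "amb (f q) (n1 q) = 0" "amb (f q) (n2 q) = 0"
    "amb (e1 q) (f q) = 0" "amb (e2 q) (f q) = 0" "amb (n1 q) (f q) = 0" "amb (n2 q) (f q) = 0"
    by (simp_all add: fs)
qed

lemma fd_f: "fd f q (E1 q) = e1 q" "fd f q (E2 q) = e2 q"
  by (simp_all add: e1_def e2_def push_def)

text \<open>The connection forms of the tangent frame (\<open>\<omega>\<close>) and of the normal
  frame (\<open>\<theta>\<close>).\<close>

definition "\<omega> q v = amb (fd e1 q v) (e2 q)"
definition "\<theta> q v = amb (fd n1 q v) (n2 q)"

lemma connection:
  assumes q: "q \<in> V"
  shows "amb (fd e1 q v) (e1 q) = 0" "amb (fd e2 q v) (e2 q) = 0" "amb (fd e2 q v) (e1 q) = - \<omega> q v"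
    "amb (fd n1 q v) (n1 q) = 0" "amb (fd n2 q v) (n2 q) = 0" "amb (fd n2 q v) (n1 q) = - \<theta> q v"
    "amb (fd n1 q v) (e1 q) = - amb (fd e1 q v) (n1 q)" "amb (fd n1 q v) (e2 q) = - amb (fd e2 q v) (n1 q)"
    "amb (fd n2 q v) (e1 q) = - amb (fd e1 q v) (n2 q)" "amb (fd n2 q v) (e2 q) = - amb (fd e2 q v) (n2 q)"
proof -
  note D = D_amb_const[OF _ _ _ q, of _ _ _ v]
  note fp = frame_props
  show "amb (fd e1 q v) (e1 q) = 0" using D[OF sm(2,2) fp(1)] by (simp add: amb_commute)
  show "amb (fd e2 q v) (e2 q) = 0" using D[OF sm(3,3) fp(2)] by (simp add: amb_commute)
  show "amb (fd n1 q v) (n1 q) = 0" using D[OF sm_n(1,1) fp(3)] by (simp add: amb_commute)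
  show "amb (fd n2 q v) (n2 q) = 0" using D[OF sm_n(2,2) fp(4)] by (simp add: amb_commute)
  show "amb (fd e2 q v) (e1 q) = - \<omega> q v" using D[OF sm_e(2,1) fp(11)] by (simp add: \<omega>_def amb_commute)
  show "amb (fd n2 q v) (n1 q) = - \<theta> q v" using D[OF sm_n(2,1) fp(16)] by (simp add: \<theta>_def amb_commute)
  show "amb (fd n1 q v) (e1 q) = - amb (fd e1 q v) (n1 q)" using D[OF sm_n(1) sm_e(1) fp(12)] by (simp add: amb_commute)
  show "amb (fd n1 q v) (e2 q) = - amb (fd e2 q v) (n1 q)" using D[OF sm_n(1) sm_e(2) fp(14)] by (simp add: amb_commute)
  show "amb (fd n2 q v) (e1 q) = - amb (fd e1 q v) (n2 q)" using D[OF sm_n(2) sm_e(1) fp(13)] by (simp add: amb_commute)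
  show "amb (fd n2 q v) (e2 q) = - amb (fd e2 q v) (n2 q)" using D[OF sm_n(2) sm_e(2) fp(15)] by (simp add: amb_commute)
qed

text \<open>\<open>prod_str\<close> is a constant linear map of flat space, so differentiating its
  matrix entries in the frame involves only the derivatives of the frame vectors. The entries used
  are \<open>a\<close>, \<open>b\<close> and the zeros at \<open>(e1, e2)\<close> and
  \<open>(e1, n2)\<close>.\<close>

lemma parallel_prod_str:
  assumes q: "q \<in> V"
  shows "fd a q v = 2 * A q * amb (fd e1 q v) (n1 q)" "fd b q v = 2 * B q * amb (fd e2 q v) (n2 q)"
    "(b q - a q) * \<omega> q v = - A q * amb (fd e2 q v) (n1 q) - B q * amb (fd e1 q v) (n2 q)"
    "A q * \<theta> q v = B q * \<omega> q v - (a q + b q) * amb (fd e1 q v) (n2 q)"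
proof -
  have D: "fd (\<lambda>x. amb (prod_str (G x)) (K x)) q v = amb (fd K q v) (prod_str (G q)) + amb (fd G q v) (prod_str (K q))"
    if "smooth_on V G" "smooth_on V K" for G K
    using D_amb[OF smooth_on_prod_str[OF V(1) that(1)] that(2) q, of v] D_prod_str[OF that(1) q, of v]
    by (simp add: amb_prod_str[of "fd G q v"] amb_commute[of "prod_str (G q)"])
  note con = connection[OF q] prod_str_e[OF q] prod_str_n[OF q] amb_simps
  show "fd a q v = 2 * A q * amb (fd e1 q v) (n1 q)"
    using D[OF sm_e(1,1)] unfolding a_def[abs_def] by (simp add: con a_def[symmetric])
  show "fd b q v = 2 * B q * amb (fd e2 q v) (n2 q)"
    using D[OF sm_e(2,2)] unfolding b_def[abs_def] by (simp add: con b_def[symmetric])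
  have "fd (\<lambda>x. amb (prod_str (e1 x)) (e2 x)) q v = 0"
    by (rule D_const[OF q]) (simp add: diag e1_def e2_def)
  then show "(b q - a q) * \<omega> q v = - A q * amb (fd e2 q v) (n1 q) - B q * amb (fd e1 q v) (n2 q)"
    using D[OF sm_e(1,2)] by (simp add: con \<omega>_def[symmetric] algebra_simps)
  have "fd (\<lambda>x. amb (prod_str (e1 x)) (n2 x)) q v = 0"
    by (rule D_const[OF q]) (simp add: prod_str_e frame_props amb_simps)
  then show "A q * \<theta> q v = B q * \<omega> q v - (a q + b q) * amb (fd e1 q v) (n2 q)"
    using D[OF sm_e(1) sm_n(2)] by (simp add: con \<omega>_def[symmetric] algebra_simps)
qed

text \<open>The frame fields come from variable coordinate fields; their variation adds only a
  tangent vector to the derivative.\<close>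

lemma second_ff_frame:
  assumes q: "q \<in> V"
  shows "second_ff f q v (E1 q) = amb (fd e1 q v) (n1 q) *\<^sub>R n1 q + amb (fd e1 q v) (n2 q) *\<^sub>R n2 q"
    "second_ff f q v (E2 q) = amb (fd e2 q v) (n1 q) *\<^sub>R n1 q + amb (fd e2 q v) (n2 q) *\<^sub>R n2 q"
proof -
  interpret point_frame f V q "E1 q" "E2 q" "n1 q" "n2 q" by (rule frame[OF q])
  have "fd e1 q v = fd (\<lambda>x. push f x (E1 q)) q v + push f q (fd E1 q v)"
    "fd e2 q v = fd (\<lambda>x. push f x (E2 q)) q v + push f q (fd E2 q v)"
    unfolding e1_def[abs_def] e2_def[abs_def] push_def
    by (rule fd_along_field[OF V(1) f E(1) q], rule fd_along_field[OF V(1) f E(2) q])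
  then show "second_ff f q v (E1 q) = amb (fd e1 q v) (n1 q) *\<^sub>R n1 q + amb (fd e1 q v) (n2 q) *\<^sub>R n2 q"
    "second_ff f q v (E2 q) = amb (fd e2 q v) (n1 q) *\<^sub>R n1 q + amb (fd e2 q v) (n2 q) *\<^sub>R n2 q"
    by (simp_all add: second_ff_eq amb_simps push_normal)
qed

text \<open>Components of the second fundamental form h in the normal frame: h(e1,e1) = R n1 + P n2,
  h(e2,e2) = Q n1 + S n2 and h(e1,e2) = Y1 n1 + Y2 n2.\<close>

definition "R q = amb (fd e1 q (E1 q)) (n1 q)"
definition "P q = amb (fd e1 q (E1 q)) (n2 q)"
definition "Q q = amb (fd e2 q (E2 q)) (n1 q)"
definition "S q = amb (fd e2 q (E2 q)) (n2 q)"
definition "Y1 q = amb (fd e2 q (E1 q)) (n1 q)"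
definition "Y2 q = amb (fd e2 q (E1 q)) (n2 q)"

lemma second_ff_sym:
  assumes q: "q \<in> V"
  shows "amb (fd e1 q (E2 q)) (n1 q) = Y1 q" "amb (fd e1 q (E2 q)) (n2 q) = Y2 q"
proof -
  interpret point_frame f V q "E1 q" "E2 q" "n1 q" "n2 q" by (rule frame[OF q])
  have eq: "second_ff f q (E2 q) (E1 q) = second_ff f q (E1 q) (E2 q)" by (rule second_ff_commute)
  show "amb (fd e1 q (E2 q)) (n1 q) = Y1 q" "amb (fd e1 q (E2 q)) (n2 q) = Y2 q"
    using arg_cong[OF eq, of "\<lambda>w. amb w (n1 q)"] arg_cong[OF eq, of "\<lambda>w. amb w (n2 q)"]
    by (simp_all add: second_ff_frame[OF q] frame_props[OF q] amb_simps Y1_def Y2_def)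
qed

lemma mean_curv_frame: "q \<in> V \<Longrightarrow> mean_curv f q = ((R q + Q q) / 2) *\<^sub>R n1 q + ((P q + S q) / 2) *\<^sub>R n2 q"
  using point_frame.mean_curv_eq[OF frame, of q]
  by (simp add: second_ff_frame R_def P_def Q_def S_def algebra_simps add_divide_distrib)

lemma frame_derivs:
  assumes q: "q \<in> V"
  shows "fd a q (E1 q) = 2 * A q * R q" "fd a q (E2 q) = 2 * A q * Y1 q"
    "fd b q (E1 q) = 2 * B q * Y2 q" "fd b q (E2 q) = 2 * B q * S q"
    "(b q - a q) * \<omega> q (E1 q) = - A q * Y1 q - B q * P q" "(b q - a q) * \<omega> q (E2 q) = - A q * Q q - B q * Y2 q"
    "A q * \<theta> q (E1 q) = B q * \<omega> q (E1 q) - (a q + b q) * P q" "A q * \<theta> q (E2 q) = B q * \<omega> q (E2 q) - (a q + b q) * Y2 q"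
  by (simp_all add: parallel_prod_str[OF q] second_ff_sym[OF q] R_def P_def Q_def S_def Y1_def Y2_def)

end

locale adapted_frame = diagonal_frame +
  assumes H_nz: "\<And>q. q \<in> V \<Longrightarrow> mean_curv f q \<noteq> 0"
    and H_parallel: "\<And>q v. q \<in> V \<Longrightarrow> normal_conn f (mean_curv f) q v = 0"
    and hopf: "\<And>q. q \<in> V \<Longrightarrow> 4 * amb (second_ff f q (E1 q) (E1 q)) (mean_curv f q) + amb (prod_str (push f q (E1 q))) (push f q (E1 q))
        = 4 * amb (second_ff f q (E2 q) (E2 q)) (mean_curv f q) + amb (prod_str (push f q (E2 q))) (push f q (E2 q))"
      "\<And>q. q \<in> V \<Longrightarrow> amb (second_ff f q (E1 q) (E2 q)) (mean_curv f q) = 0"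
begin

text \<open>Umbilic here refers to the compression of \<open>prod_str\<close>. If
  \<open>a = b\<close> throughout, equal derivatives give R = Y2 and Y1 = S, while the equation for
  \<open>\<omega>\<close> loses its left side and gives Y1 = -P and Q = -Y2. Both traces then
  vanish.\<close>

lemma not_umbilic_everywhere: "\<exists>q\<in>V. a q \<noteq> b q"
proof (rule ccontr)
  assume "\<not> ?thesis"
  then have eq: "x \<in> V \<Longrightarrow> a x = b x" for x by blast
  obtain q where q: "q \<in> V" using V(3) by blast
  have AB: "A q = B q" by (simp add: A_def B_def eq[OF q])
  have "fd a q v = fd b q v" for v by (rule D_eq[OF q eq])
  then have "R q = Y2 q" "Y1 q = S q"
    using frame_derivs(1-4)[OF q] AB AB_pos[OF q] by (simp_all add: mult_left_cancel[of "2 * B q"])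
  moreover have "A q * (Y1 q + P q) = 0" "A q * (Q q + Y2 q) = 0"
    using frame_derivs(5,6)[OF q] AB eq[OF q] by (simp_all add: algebra_simps)
  then have "Y1 q = - P q" "Q q = - Y2 q" using AB_pos[OF q] by (simp_all add: add_eq_0_iff)
  ultimately have "mean_curv f q = 0" by (simp add: mean_curv_frame[OF q])
  with H_nz[OF q] show False by blast
qed

end

section \<open>Frames without umbilic points\<close>

context adapted_frame
begin

lemma normal_prod_str_f: "q \<in> V \<Longrightarrow> amb (n1 q) (prod_str (f q)) = 0" "q \<in> V \<Longrightarrow> amb (n2 q) (prod_str (f q)) = 0"
proof -
  assume q: "q \<in> V"
  interpret point_frame f V q "E1 q" "E2 q" "n1 q" "n2 q" by (rule frame[OF q])
  show "amb (n1 q) (prod_str (f q)) = 0" "amb (n2 q) (prod_str (f q)) = 0" by (rule position)+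
qed

lemma sm_coeffs: "smooth_on V R" "smooth_on V P" "smooth_on V Q" "smooth_on V S"
  unfolding R_def[abs_def] P_def[abs_def] Q_def[abs_def] S_def[abs_def]
  by (intro smooth_on_amb smooth_on_fd_field V(1) sm E)+

text \<open>Torsion-freeness: the pushed-forward Lie bracket is the difference of derivatives of
  \<open>e2\<close> and \<open>e1\<close>, whose tangential components are values of
  \<open>\<omega>\<close>. \<open>G\<close> may be vector-valued, so normal fields and scalar
  functions are both covered.\<close>

lemma bracket:
  fixes G :: "complex \<Rightarrow> 'b::real_inner"
  assumes G: "smooth_on V G" and q: "q \<in> V"
  shows "fd (\<lambda>x. fd G x (E2 x)) q (E1 q) - fd (\<lambda>x. fd G x (E1 x)) q (E2 q)
    = - \<omega> q (E1 q) *\<^sub>R fd G q (E1 q) - \<omega> q (E2 q) *\<^sub>R fd G q (E2 q)"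
proof -
  interpret point_frame f V q "E1 q" "E2 q" "n1 q" "n2 q" by (rule frame[OF q])
  define br where "br = fd E2 q (E1 q) - fd E1 q (E2 q)"
  have "push f q br = fd e2 q (E1 q) - fd e1 q (E2 q)"
    using fd_bracket[OF V(1) f E q] unfolding br_def e1_def[abs_def] e2_def[abs_def] push_def by simp
  then have "amb (push f q br) (e1 q) = - \<omega> q (E1 q)" "amb (push f q br) (e2 q) = - \<omega> q (E2 q)"
    by (simp_all add: amb_simps connection[OF q] \<omega>_def)
  then have "br = - \<omega> q (E1 q) *\<^sub>R E1 q + - \<omega> q (E2 q) *\<^sub>R E2 q"
    using coord_expand[of br, folded e1_def e2_def] by simp
  then have "fd G q br = - \<omega> q (E1 q) *\<^sub>R fd G q (E1 q) + - \<omega> q (E2 q) *\<^sub>R fd G q (E2 q)"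
    by (simp only: linear_add[OF fd_linear_arg[OF V(1) G q]] linear_scale[OF fd_linear_arg[OF V(1) G q]])
  then show ?thesis
    using fd_bracket[OF V(1) G E q] unfolding br_def by simp
qed

text \<open>The Weingarten formula in flat space for a field parallel in the normal bundle. The
  component along \<open>f q\<close> is the trace of the ambient curvature; the one along
  \<open>prod_str (f q)\<close> vanishes because \<xi> is normal to the surface.\<close>

lemma parallel_normal_deriv:
  assumes \<xi>: "smooth_on V \<xi>" "\<And>x. x \<in> V \<Longrightarrow> \<xi> x = r x *\<^sub>R n1 x + t x *\<^sub>R n2 x"
    and parallel: "amb (fd \<xi> q v) (n1 q) = 0" "amb (fd \<xi> q v) (n2 q) = 0" and q: "q \<in> V"
  shows "fd \<xi> q v = - amb (\<xi> q) (fd e1 q v) *\<^sub>R e1 q - amb (\<xi> q) (fd e2 q v) *\<^sub>R e2 q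
     - (amb (\<xi> q) (prod_str (fd f q v)) / 2) *\<^sub>R f q"
proof -
  interpret point_frame f V q "E1 q" "E2 q" "n1 q" "n2 q" by (rule frame[OF q])
  note D = D_amb_const[OF \<xi>(1) _ _ q, of _ 0 v]
  have "amb (fd \<xi> q v) (e1 q) = - amb (\<xi> q) (fd e1 q v)" "amb (fd \<xi> q v) (e2 q) = - amb (\<xi> q) (fd e2 q v)"
    by (rule D; simp add: sm \<xi>(2) amb_simps frame_props)+
  moreover have "amb (fd \<xi> q v) (f q) = - amb (\<xi> q) (fd f q v)"
    by (rule D; simp add: sm \<xi>(2) amb_simps frame_props)
  moreover have "amb (fd \<xi> q v) (prod_str (f q)) = - amb (\<xi> q) (fd (\<lambda>x. prod_str (f x)) q v)"
    by (rule D) (simp_all add: smooth_on_prod_str[OF V(1) f] \<xi>(2) amb_simps normal_prod_str_f)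
  moreover have "amb (\<xi> q) (fd f q v) = 0"
    using push_normal[of v] by (simp add: \<xi>(2)[OF q] amb_simps push_def amb_commute)
  ultimately show ?thesis
    by (subst expand[of "fd \<xi> q v", folded e1_def e2_def]) (simp add: parallel D_prod_str[OF f q])
qed

lemma parallel_normal_deriv_frame:
  assumes \<xi>: "smooth_on V \<xi>" "\<And>x. x \<in> V \<Longrightarrow> \<xi> x = r x *\<^sub>R n1 x + t x *\<^sub>R n2 x"
    and parallel: "\<And>v. amb (fd \<xi> q v) (n1 q) = 0" "\<And>v. amb (fd \<xi> q v) (n2 q) = 0" and q: "q \<in> V"
  shows "fd \<xi> q (E1 q) = - (r q * R q + t q * P q) *\<^sub>R e1 q - (r q * Y1 q + t q * Y2 q) *\<^sub>R e2 q - (A q * r q / 2) *\<^sub>R f q"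
    "fd \<xi> q (E2 q) = - (r q * Y1 q + t q * Y2 q) *\<^sub>R e1 q - (r q * Q q + t q * S q) *\<^sub>R e2 q - (B q * t q / 2) *\<^sub>R f q"
proof -
  have *: "fd \<xi> q v = - amb (\<xi> q) (fd e1 q v) *\<^sub>R e1 q - amb (\<xi> q) (fd e2 q v) *\<^sub>R e2 q
     - (amb (\<xi> q) (prod_str (fd f q v)) / 2) *\<^sub>R f q" for v
    by (rule parallel_normal_deriv[where r = r and t = t, OF \<xi>(1) \<xi>(2) parallel(1) parallel(2) q])
  show "fd \<xi> q (E1 q) = - (r q * R q + t q * P q) *\<^sub>R e1 q - (r q * Y1 q + t q * Y2 q) *\<^sub>R e2 q - (A q * r q / 2) *\<^sub>R f q"
    "fd \<xi> q (E2 q) = - (r q * Y1 q + t q * Y2 q) *\<^sub>R e1 q - (r q * Q q + t q * S q) *\<^sub>R e2 q - (B q * t q / 2) *\<^sub>R f q"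
    by (simp_all add: * fd_f prod_str_e[OF q] \<xi>(2)[OF q] amb_simps frame_props[OF q] amb_commute[of "n1 q" "fd _ q _"] amb_commute[of "n2 q" "fd _ q _"]
      second_ff_sym[OF q] R_def[symmetric] P_def[symmetric] Q_def[symmetric] S_def[symmetric] Y1_def[symmetric] Y2_def[symmetric])
qed

section \<open>Smoothness and constant length of the mean curvature vector\<close>

lemma sm_mean_curv: "smooth_on V (mean_curv f)"
proof (rule smooth_on_cong[OF V(1)])
  show "smooth_on V (\<lambda>q. ((R q + Q q) / 2) *\<^sub>R n1 q + ((P q + S q) / 2) *\<^sub>R n2 q)"
    by (intro smooth_intros sm_coeffs sm V(1)) simp_all
qed (simp add: mean_curv_frame)

lemma mean_curv_parallel:
  assumes q: "q \<in> V"
  shows "amb (fd (mean_curv f) q v) (n1 q) = 0" "amb (fd (mean_curv f) q v) (n2 q) = 0"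
proof -
  interpret point_frame f V q "E1 q" "E2 q" "n1 q" "n2 q" by (rule frame[OF q])
  have eq: "amb (fd (mean_curv f) q v) (n1 q) *\<^sub>R n1 q + amb (fd (mean_curv f) q v) (n2 q) *\<^sub>R n2 q = 0"
    using H_parallel[OF q, of v] by (simp add: normal_conn_eq)
  show "amb (fd (mean_curv f) q v) (n1 q) = 0" "amb (fd (mean_curv f) q v) (n2 q) = 0"
    using arg_cong[OF eq, of "\<lambda>w. amb w (n1 q)"] arg_cong[OF eq, of "\<lambda>w. amb w (n2 q)"]
    by (simp_all add: amb_simps frame_props[OF q])
qed

lemma mean_curv_norm_const: "\<exists>h>0. \<forall>q\<in>V. amb (mean_curv f q) (mean_curv f q) = h * h"
proof -
  let ?N = "\<lambda>x. amb (mean_curv f x) (mean_curv f x)"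
  have sm: "smooth_on V ?N" by (intro smooth_on_amb V(1) sm_mean_curv)
  have "fd ?N q = (\<lambda>v. 0)" if q: "q \<in> V" for q
  proof
    fix v
    have "amb (fd (mean_curv f) q v) (mean_curv f q) = 0"
      by (simp add: mean_curv_frame[OF q] amb_simps mean_curv_parallel[OF q])
    then show "fd ?N q v = 0"
      using D_amb[OF sm_mean_curv sm_mean_curv q, of v] by (simp add: amb_commute)
  qed
  then have d: "(?N has_derivative (\<lambda>v. 0)) (at q)" if "q \<in> V" for q
    using has_D[OF sm that] that by simp
  obtain q0 where q0: "q0 \<in> V" using V(3) by blast
  have const: "?N q = ?N q0" if "q \<in> V" for q
    by (rule has_derivative_zero_unique_connected[OF V(1,2) d that q0])
  have "?N q0 = ((R q0 + Q q0) / 2)\<^sup>2 + ((P q0 + S q0) / 2)\<^sup>2"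
    by (simp add: mean_curv_frame[OF q0] amb_simps frame_props[OF q0] power2_eq_square)
  moreover have "(R q0 + Q q0) / 2 \<noteq> 0 \<or> (P q0 + S q0) / 2 \<noteq> 0"
    using H_nz[OF q0] by (auto simp: mean_curv_frame[OF q0])
  ultimately have "?N q0 > 0" by (simp only: sum_power2_gt_zero_iff)
  then show ?thesis
    using const by (intro exI[of _ "sqrt (?N q0)"]) simp
qed

end

section \<open>The parallel normal frame and its shape operators\<close>

locale nonumbilic_frame = adapted_frame +
  fixes H :: real
  assumes H_pos: "H > 0" and H_norm: "\<And>q. q \<in> V \<Longrightarrow> amb (mean_curv f q) (mean_curv f q) = H * H"
    and distinct: "\<And>q. q \<in> V \<Longrightarrow> a q \<noteq> b q"
begin

text \<open>\<open>e3\<close> is the unit mean curvature vector, with components (c, -s) along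
  \<open>n1\<close> and \<open>n2\<close>, and \<open>e4\<close> is \<open>e3\<close> turned by a
  right angle in the normal plane.\<close>

definition "c q = (R q + Q q) / (2 * H)"
definition "s q = - (P q + S q) / (2 * H)"
definition "e3 q = c q *\<^sub>R n1 q + (- s q) *\<^sub>R n2 q"
definition "e4 q = s q *\<^sub>R n1 q + c q *\<^sub>R n2 q"

lemma sm_cs: "smooth_on V c" "smooth_on V s"
  unfolding c_def[abs_def] s_def[abs_def] using H_pos by (intro smooth_intros sm_coeffs V(1); simp)+

lemma sm_e34: "smooth_on V e3" "smooth_on V e4"
  unfolding e3_def[abs_def] e4_def[abs_def] by (intro smooth_intros sm_cs sm V(1))+

lemma trace_e3: "R q + Q q = 2 * H * c q" "P q + S q = - 2 * H * s q"
  using H_pos by (simp_all add: c_def s_def)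

lemma mean_curv_e3: "q \<in> V \<Longrightarrow> mean_curv f q = H *\<^sub>R e3 q"
  by (simp add: mean_curv_frame trace_e3 e3_def scaleR_diff_right)

lemma cs_unit: "q \<in> V \<Longrightarrow> c q * c q + s q * s q = 1"
proof -
  assume q: "q \<in> V"
  have "(H * H) * (c q * c q + s q * s q) = (H * H) * 1"
    using H_norm[OF q] by (simp add: mean_curv_e3[OF q] e3_def amb_simps frame_props[OF q] algebra_simps)
  then show ?thesis using H_pos by simp
qed

lemma e3_parallel:
  assumes q: "q \<in> V"
  shows "amb (fd e3 q v) (n1 q) = 0" "amb (fd e3 q v) (n2 q) = 0"
proof -
  have "fd (mean_curv f) q v = fd (\<lambda>x. H *\<^sub>R e3 x) q v" by (rule D_eq[OF q mean_curv_e3])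
  also have "\<dots> = H *\<^sub>R fd e3 q v" by (rule fd_bounded_linear[OF V(1) sm_e34(1) q bounded_linear_scaleR_right])
  finally show "amb (fd e3 q v) (n1 q) = 0" "amb (fd e3 q v) (n2 q) = 0"
    using mean_curv_parallel[OF q, of v] H_pos by (simp_all add: amb_simps)
qed

text \<open>As \<open>e3\<close> is parallel, the angle between the frames \<open>n1, n2\<close> and
  \<open>e3, e4\<close> changes exactly by the normal connection form.\<close>

lemma D_cs:
  assumes q: "q \<in> V"
  shows "fd c q v = - s q * \<theta> q v" "fd s q v = c q * \<theta> q v"
proof -
  have "fd c q v = fd (\<lambda>x. amb (e3 x) (n1 x)) q v"
    by (rule D_eq[OF q]) (simp add: e3_def amb_simps frame_props)
  also have "\<dots> = - s q * \<theta> q v"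
    unfolding D_amb[OF sm_e34(1) sm_n(1) q] e3_parallel[OF q]
    by (simp add: e3_def amb_simps amb_commute[of "n1 q" "fd _ q _"] amb_commute[of "n2 q" "fd _ q _"] connection[OF q] \<theta>_def)
  finally show "fd c q v = - s q * \<theta> q v" .
  have "fd s q v = fd (\<lambda>x. - amb (e3 x) (n2 x)) q v"
    by (rule D_eq[OF q]) (simp add: e3_def amb_simps frame_props)
  also have "\<dots> = - fd (\<lambda>x. amb (e3 x) (n2 x)) q v"
    by (rule fd_bounded_linear[OF V(1) _ q bounded_linear_minus[OF bounded_linear_ident]])
      (intro smooth_on_amb V(1) sm_e34 sm_n)
  also have "\<dots> = c q * \<theta> q v"
    unfolding D_amb[OF sm_e34(1) sm_n(2) q] e3_parallel[OF q]
    by (simp add: e3_def amb_simps amb_commute[of "n1 q" "fd _ q _"] amb_commute[of "n2 q" "fd _ q _"] connection[OF q])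
  finally show "fd s q v = c q * \<theta> q v" .
qed

lemma e4_parallel:
  assumes q: "q \<in> V"
  shows "amb (fd e4 q v) (n1 q) = 0" "amb (fd e4 q v) (n2 q) = 0"
proof -
  have "fd s q v = fd (\<lambda>x. amb (e4 x) (n1 x)) q v"
    by (rule D_eq[OF q]) (simp add: e4_def amb_simps frame_props)
  then show "amb (fd e4 q v) (n1 q) = 0"
    unfolding D_amb[OF sm_e34(2) sm_n(1) q] D_cs[OF q]
    by (simp add: e4_def amb_simps amb_commute[of "n1 q" "fd _ q _"] amb_commute[of "n2 q" "fd _ q _"] connection[OF q] \<theta>_def)
  have "fd c q v = fd (\<lambda>x. amb (e4 x) (n2 x)) q v"
    by (rule D_eq[OF q]) (simp add: e4_def amb_simps frame_props)
  then show "amb (fd e4 q v) (n2 q) = 0"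
    unfolding D_amb[OF sm_e34(2) sm_n(2) q] D_cs[OF q]
    by (simp add: e4_def amb_simps amb_commute[of "n1 q" "fd _ q _"] amb_commute[of "n2 q" "fd _ q _"] connection[OF q])
qed

text \<open>The combinations of \<open>R, P\<close>, of \<open>Q, S\<close> and of
  \<open>Y1, Y2\<close> are the matrix entries of the shape operator of \<open>e3\<close>. Since the
  mean curvature vector is \<open>H *\<^sub>R e3\<close>, the Hopf differential constrains exactly
  this operator.\<close>

lemma hopf_frame:
  assumes q: "q \<in> V"
  shows "4 * H * ((c q * R q - s q * P q) - (c q * Q q - s q * S q)) = b q - a q"
    "c q * Y1 q - s q * Y2 q = 0"
proof -
  show "4 * H * ((c q * R q - s q * P q) - (c q * Q q - s q * S q)) = b q - a q"
    using hopf(1)[OF q]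
    by (simp add: second_ff_frame[OF q] mean_curv_e3[OF q] e3_def amb_simps frame_props[OF q]
        a_def[symmetric, unfolded e1_def] b_def[symmetric, unfolded e2_def]
        R_def[symmetric] P_def[symmetric] Q_def[symmetric] S_def[symmetric] algebra_simps)
  show "c q * Y1 q - s q * Y2 q = 0"
    using hopf(2)[OF q] H_pos
    by (simp add: second_ff_frame[OF q] mean_curv_e3[OF q] e3_def amb_simps frame_props[OF q]
        Y1_def[symmetric] Y2_def[symmetric] algebra_simps)
qed

lemma D_e3:
  assumes q: "q \<in> V"
  shows "fd e3 q (E1 q) = - (c q * R q + - s q * P q) *\<^sub>R e1 q - (c q * Y1 q + - s q * Y2 q) *\<^sub>R e2 q - (A q * c q / 2) *\<^sub>R f q"
    "fd e3 q (E2 q) = - (c q * Y1 q + - s q * Y2 q) *\<^sub>R e1 q - (c q * Q q + - s q * S q) *\<^sub>R e2 q - (B q * - s q / 2) *\<^sub>R f q"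
  by (rule parallel_normal_deriv_frame[where r = c and t = "\<lambda>x. - s x", OF sm_e34(1) e3_def e3_parallel[OF q] q])+

lemma D_e4:
  assumes q: "q \<in> V"
  shows "fd e4 q (E1 q) = - (s q * R q + c q * P q) *\<^sub>R e1 q - (s q * Y1 q + c q * Y2 q) *\<^sub>R e2 q - (A q * s q / 2) *\<^sub>R f q"
    "fd e4 q (E2 q) = - (s q * Y1 q + c q * Y2 q) *\<^sub>R e1 q - (s q * Q q + c q * S q) *\<^sub>R e2 q - (B q * c q / 2) *\<^sub>R f q"
  by (rule parallel_normal_deriv_frame[where r = s and t = c, OF sm_e34(2) e4_def e4_parallel[OF q] q])+

text \<open>The Ricci equation: both shape operators commute because the normal bundle is flat and the
  ambient curvature has no component \<open>R(e1, e2, n1, n2)\<close>.\<close>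

lemma off_diagonal_zero:
  assumes q: "q \<in> V"
  shows "Y1 q = 0" "Y2 q = 0"
proof -
  let ?L1 = "\<lambda>x. fd e3 x (E1 x)" and ?L2 = "\<lambda>x. fd e3 x (E2 x)"
  have sm: "smooth_on V ?L1" "smooth_on V ?L2" by (intro smooth_on_fd_field V(1) sm_e34 E)+
  have L: "amb (?L1 x) (e4 x) = 0" "amb (?L2 x) (e4 x) = 0" if "x \<in> V" for x
    using that by (simp_all add: D_e3 e4_def amb_simps frame_props)
  \<comment> \<open>The \<open>e4\<close>-components of the derivatives of \<open>e3\<close> vanish
    identically, so second derivatives of \<open>e3\<close> can be traded for products of first
    derivatives.\<close>
  have "amb (fd ?L2 q (E1 q)) (e4 q) = - amb (?L2 q) (fd e4 q (E1 q))"
    "amb (fd ?L1 q (E2 q)) (e4 q) = - amb (?L1 q) (fd e4 q (E2 q))"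
    by (rule D_amb_const[OF sm(2) sm_e34(2) _ q], erule L(2)) (rule D_amb_const[OF sm(1) sm_e34(2) _ q], erule L(1))
  moreover have "amb (fd ?L2 q (E1 q) - fd ?L1 q (E2 q)) (e4 q) = 0"
    unfolding bracket[OF sm_e34(1) q] by (simp add: amb_simps L[OF q])
  ultimately have "amb (?L2 q) (fd e4 q (E1 q)) = amb (?L1 q) (fd e4 q (E2 q))"
    by (simp add: amb_simps)
  \<comment> \<open>The components along \<open>f q\<close> drop out because \<open>f q\<close> is
    null; this is where the ambient curvature disappears.\<close>
  moreover have "amb (?L2 q) (fd e4 q (E1 q)) = (c q * Q q - s q * S q) * (s q * Y1 q + c q * Y2 q)"
    "amb (?L1 q) (fd e4 q (E2 q)) = (c q * R q - s q * P q) * (s q * Y1 q + c q * Y2 q)"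
    using S2H2_iff_amb(1)[OF f_in[OF q]]
    by (simp_all add: D_e3[OF q] D_e4[OF q] hopf_frame(2)[OF q] amb_simps frame_props[OF q]) (simp_all add: algebra_simps)
  ultimately have eq: "((c q * R q - s q * P q) - (c q * Q q - s q * S q)) * (s q * Y1 q + c q * Y2 q) = 0"
    by (simp only: left_diff_distrib diff_self)
  \<comment> \<open>The shape operator of \<open>e3\<close> is diagonal with distinct eigenvalues,
    so the off-diagonal entry of the commuting operator of \<open>e4\<close> must vanish.\<close>
  have "(c q * R q - s q * P q) - (c q * Q q - s q * S q) \<noteq> 0"
    using hopf_frame(1)[OF q] distinct[OF q] by auto
  with eq have y: "s q * Y1 q + c q * Y2 q = 0" by simp
  have "Y1 q = (c q * c q + s q * s q) * Y1 q" "Y2 q = (c q * c q + s q * s q) * Y2 q"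
    by (simp_all add: cs_unit[OF q])
  then show "Y1 q = 0" "Y2 q = 0" using y hopf_frame(2)[OF q] by algebra+
qed

text \<open>Eigenvalue of the shape operator of \<open>e4\<close> on \<open>e1\<close>. On
  \<open>e2\<close> it is the negative, since \<open>e4\<close> is orthogonal to the mean curvature
  vector.\<close>

definition "\<mu> q = s q * R q + c q * P q"

lemma trace_e4: "q \<in> V \<Longrightarrow> s q * Q q + c q * S q = - \<mu> q"
  using H_pos by (simp add: \<mu>_def c_def s_def field_simps)

lemma D_e4_diag:
  assumes q: "q \<in> V"
  shows "fd e4 q (E1 q) = - \<mu> q *\<^sub>R e1 q - (A q * s q / 2) *\<^sub>R f q"
    "fd e4 q (E2 q) = \<mu> q *\<^sub>R e2 q - (B q * c q / 2) *\<^sub>R f q"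
  by (simp_all add: D_e4[OF q] off_diagonal_zero[OF q] trace_e4[OF q] \<mu>_def[symmetric])

lemma sm_\<mu>: "smooth_on V \<mu>"
  unfolding \<mu>_def[abs_def] by (intro smooth_intros sm_cs sm_coeffs V(1))

text \<open>The components along \<open>e1\<close> and \<open>e2\<close> of \<open>bracket\<close>
  for \<open>e4\<close>. The terms with \<open>A\<close> and \<open>B\<close> stem from the
  position-vector part of the derivative of \<open>e4\<close>.\<close>

lemma codazzi:
  assumes q: "q \<in> V"
  shows "fd \<mu> q (E1 q) = - 2 * \<mu> q * \<omega> q (E2 q) - A q * s q / 2"
    "fd \<mu> q (E2 q) = 2 * \<mu> q * \<omega> q (E1 q) + B q * c q / 2"
proof -
  let ?L1 = "\<lambda>x. fd e4 x (E1 x)" and ?L2 = "\<lambda>x. fd e4 x (E2 x)"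
  have smL: "smooth_on V ?L1" "smooth_on V ?L2" by (intro smooth_on_fd_field V(1) sm_e34 E)+
  have fe: "amb (f q) (fd e1 q v) = - amb (fd f q v) (e1 q)" "amb (f q) (fd e2 q v) = - amb (fd f q v) (e2 q)" for v
    using D_amb_const[OF f sm_e(1) frame_props(17) q, of v] D_amb_const[OF f sm_e(2) frame_props(18) q, of v] by simp_all
  have L: "amb (?L1 x) (e1 x) = - \<mu> x" "amb (?L1 x) (e2 x) = 0" "amb (?L2 x) (e1 x) = 0" "amb (?L2 x) (e2 x) = \<mu> x"
    if "x \<in> V" for x
    using that by (simp_all add: D_e4_diag amb_simps frame_props)
  have D: "fd (\<lambda>x. amb (G x) (K x)) q v = amb (G q) (fd K q v) + amb (fd G q v) (K q)"
    if "smooth_on V G" "smooth_on V K" for G K v by (rule D_amb[OF that q])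
  have minus: "fd (\<lambda>x. - \<mu> x) q v = - fd \<mu> q v" for v
    by (rule fd_bounded_linear[OF V(1) sm_\<mu> q bounded_linear_minus[OF bounded_linear_ident]])
  have ee: "amb (e1 q) (fd e1 q v) = 0" "amb (e2 q) (fd e2 q v) = 0" "amb (e1 q) (fd e2 q v) = - \<omega> q v" "amb (e2 q) (fd e1 q v) = \<omega> q v" for v
    using connection[OF q, of v] by (simp_all add: amb_commute \<omega>_def)
  note ds = D_e4_diag[OF q] amb_simps frame_props[OF q] fe fd_f ee
  have 1: "amb (fd ?L2 q (E1 q)) (e1 q) = - \<mu> q * \<omega> q (E1 q) - B q * c q / 2"
    using D[OF smL(2) sm_e(1), of "E1 q"] D_const[OF q L(3), where v = "E1 q"] by (simp add: ds)
  have 2: "amb (fd ?L1 q (E2 q)) (e1 q) = - fd \<mu> q (E2 q)"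
    using D[OF smL(1) sm_e(1), of "E2 q"] D_eq[OF q L(1), where v = "E2 q"] by (simp add: ds minus)
  have 3: "amb (fd ?L2 q (E1 q)) (e2 q) = fd \<mu> q (E1 q)"
    using D[OF smL(2) sm_e(2), of "E1 q"] D_eq[OF q L(4), where v = "E1 q"] by (simp add: ds)
  have 4: "amb (fd ?L1 q (E2 q)) (e2 q) = - \<mu> q * \<omega> q (E2 q) - A q * s q / 2"
    using D[OF smL(1) sm_e(2), of "E2 q"] D_const[OF q L(2), where v = "E2 q"] by (simp add: ds)
  note br = bracket[OF sm_e34(2) q]
  show "fd \<mu> q (E2 q) = 2 * \<mu> q * \<omega> q (E1 q) + B q * c q / 2"
    using arg_cong[OF br, of "\<lambda>w. amb w (e1 q)"] by (simp add: amb_simps 1 2 L[OF q])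
  show "fd \<mu> q (E1 q) = - 2 * \<mu> q * \<omega> q (E2 q) - A q * s q / 2"
    using arg_cong[OF br, of "\<lambda>w. amb w (e2 q)"] by (simp add: amb_simps 3 4 L[OF q])
qed

text \<open>\<open>k\<close> and \<open>-k\<close> are the eigenvalues of the trace-free shape
  operator of \<open>e3\<close>, and \<tau> k and -\<tau> k those of \<open>e4\<close>. So h(e1,e1)
  has trace-free part k (e3 + \<tau> e4), and \<open>U\<close>, \<open>T\<close> are the components
  of e3 + \<tau> e4 along \<open>n1\<close>, \<open>n2\<close>.\<close>

definition "k q = (b q - a q) / (8 * H)"
definition "\<tau> q = \<mu> q / k q"
definition "T q = \<tau> q * c q - s q"
definition "U q = c q + \<tau> q * s q"

lemma k_nz: "q \<in> V \<Longrightarrow> k q \<noteq> 0"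
  using distinct[of q] H_pos by (simp add: k_def)

lemma \<mu>_eq: "q \<in> V \<Longrightarrow> \<mu> q = \<tau> q * k q"
  using k_nz[of q] by (simp add: \<tau>_def)

lemma sm_k: "smooth_on V k" "smooth_on V \<tau>" "smooth_on V T" "smooth_on V U"
proof -
  show k: "smooth_on V k"
    unfolding k_def[abs_def] using H_pos by (intro smooth_intros sm_ab V(1)) simp
  show \<tau>: "smooth_on V \<tau>"
    unfolding \<tau>_def[abs_def] using k_nz by (intro smooth_intros k sm_\<mu> V(1))
  show "smooth_on V T" "smooth_on V U"
    unfolding T_def[abs_def] U_def[abs_def] by (intro smooth_intros \<tau> sm_cs V(1))+
qed

lemma shape:
  assumes q: "q \<in> V"
  shows "R q = H * c q + k q * U q" "P q = - H * s q + k q * T q" "Q q = H * c q - k q * U q" "S q = - H * s q - k q * T q"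
proof -
  have ba: "b q - a q = 8 * H * k q" using H_pos by (simp add: k_def)
  note trace_e3[of q]
  moreover have "(c q * R q - s q * P q) - (c q * Q q - s q * S q) = 2 * k q"
    using hopf_frame(1)[OF q] H_pos unfolding ba by simp
  moreover have "s q * R q + c q * P q = \<tau> q * k q" using \<mu>_eq[OF q] by (simp add: \<mu>_def)
  moreover note cs_unit[OF q] T_def[of q] U_def[of q]
  ultimately have "2 * R q = 2 * (H * c q + k q * U q)" "2 * P q = 2 * (- H * s q + k q * T q)"
    "R q + Q q = 2 * H * c q" "P q + S q = - 2 * H * s q"
    by algebra+
  then show "R q = H * c q + k q * U q" "P q = - H * s q + k q * T q" "Q q = H * c q - k q * U q" "S q = - H * s q - k q * T q"
    by simp_all
qed

lemma forms:
  assumes q: "q \<in> V"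
  shows "\<omega> q (E1 q) = - B q * P q / (8 * H * k q)" "\<omega> q (E2 q) = - A q * Q q / (8 * H * k q)"
    "\<theta> q (E1 q) = - A q * P q / (8 * H * k q)" "\<theta> q (E2 q) = - B q * Q q / (8 * H * k q)"
proof -
  have ba: "8 * H * k q = b q - a q" using H_pos by (simp add: k_def)
  have nz: "b q - a q \<noteq> 0" "A q \<noteq> 0" using distinct[OF q] AB_pos[OF q] by auto
  have o: "(b q - a q) * \<omega> q (E1 q) = - B q * P q" "(b q - a q) * \<omega> q (E2 q) = - A q * Q q"
    using frame_derivs(5,6)[OF q] by (simp_all add: off_diagonal_zero[OF q])
  have t: "A q * \<theta> q (E1 q) = B q * \<omega> q (E1 q) - (a q + b q) * P q" "A q * \<theta> q (E2 q) = B q * \<omega> q (E2 q)"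
    using frame_derivs(7,8)[OF q] by (simp_all add: off_diagonal_zero[OF q])
  \<comment> \<open>The coefficient of \<open>P q\<close> collects to -(B^2 + b^2 - a^2), which is
    -A^2.\<close>
  have "A q * ((b q - a q) * \<theta> q (E1 q)) = A q * (- A q * P q)"
    using o(1) t(1) AB_square[OF q] by algebra
  moreover have "A q * ((b q - a q) * \<theta> q (E2 q)) = A q * (- B q * Q q)"
    using o(2) t(2) by algebra
  ultimately have "(b q - a q) * \<theta> q (E1 q) = - A q * P q" "(b q - a q) * \<theta> q (E2 q) = - B q * Q q"
    using mult_left_cancel[OF nz(2)] by blast+
  moreover have "x = y / (8 * H * k q)" if "(b q - a q) * x = y" for x y
    unfolding that[symmetric] ba using nz(1) by simp
  ultimately show "\<omega> q (E1 q) = - B q * P q / (8 * H * k q)" "\<omega> q (E2 q) = - A q * Q q / (8 * H * k q)"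
    "\<theta> q (E1 q) = - A q * P q / (8 * H * k q)" "\<theta> q (E2 q) = - B q * Q q / (8 * H * k q)"
    using o by blast+
qed

lemma D_k:
  assumes q: "q \<in> V"
  shows "fd k q (E1 q) = - A q * R q / (4 * H)" "fd k q (E2 q) = B q * S q / (4 * H)"
proof -
  have "fd k q v = (fd b q v - fd a q v) / (8 * H)" for v
    unfolding k_def[abs_def]
    using fd_bounded_linear[OF V(1) smooth_on_diff[OF V(1) sm_ab(2,1)] q bounded_linear_divide, of "8 * H" v]
    by (simp add: D_diff[OF sm_ab(2,1) q])
  then show "fd k q (E1 q) = - A q * R q / (4 * H)" "fd k q (E2 q) = B q * S q / (4 * H)"
    by (simp_all add: frame_derivs[OF q] off_diagonal_zero[OF q])
qed

text \<open>The derivative of \<open>k\<close> and the connection term of \<open>codazzi\<close>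
  combine into a trace, \<open>R + Q\<close> or \<open>P + S\<close>, which is known in terms of
  \<open>H\<close>, \<open>c\<close>, \<open>s\<close>. Hence the gradient is algebraic.\<close>

lemma D_\<tau>:
  assumes q: "q \<in> V"
  shows "fd \<tau> q (E1 q) = A q * T q / (2 * k q)" "fd \<tau> q (E2 q) = B q * U q / (2 * k q)"
proof -
  have prod: "fd \<mu> q v = \<tau> q * fd k q v + fd \<tau> q v * k q" for v
    using D_eq[OF q \<mu>_eq, where v = v] D_mult[OF sm_k(2,1) q, of v] by simp
  have "fd \<tau> q (E1 q) * k q = - 2 * \<mu> q * \<omega> q (E2 q) - A q * s q / 2 + \<tau> q * (A q * R q / (4 * H))"
    using prod[of "E1 q"] by (simp add: codazzi[OF q] D_k[OF q])
  also have "\<dots> = A q * \<tau> q * (R q + Q q) / (4 * H) - A q * s q / 2"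
    unfolding forms[OF q] \<mu>_eq[OF q] using k_nz[OF q] H_pos by (simp add: field_simps)
  also have "\<dots> = A q * T q / 2"
    unfolding shape[OF q] T_def using H_pos by (simp add: field_simps)
  finally show "fd \<tau> q (E1 q) = A q * T q / (2 * k q)"
    using k_nz[OF q] by (simp add: field_simps)
  have "fd \<tau> q (E2 q) * k q = 2 * \<mu> q * \<omega> q (E1 q) + B q * c q / 2 - \<tau> q * (B q * S q / (4 * H))"
    using prod[of "E2 q"] by (simp add: codazzi[OF q] D_k[OF q])
  also have "\<dots> = - B q * \<tau> q * (P q + S q) / (4 * H) + B q * c q / 2"
    unfolding forms[OF q] \<mu>_eq[OF q] using k_nz[OF q] H_pos by (simp add: field_simps)
  also have "\<dots> = B q * U q / 2"
    unfolding shape[OF q] U_def using H_pos by (simp add: field_simps)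
  finally show "fd \<tau> q (E2 q) = B q * U q / (2 * k q)"
    using k_nz[OF q] by (simp add: field_simps)
qed

lemma D_TU:
  assumes q: "q \<in> V"
  shows "fd T q v = c q * fd \<tau> q v - U q * \<theta> q v" "fd U q v = s q * fd \<tau> q v + T q * \<theta> q v"
proof -
  have m: "smooth_on V (\<lambda>x. \<tau> x * c x)" "smooth_on V (\<lambda>x. \<tau> x * s x)" by (intro smooth_intros sm_k sm_cs V(1))+
  show "fd T q v = c q * fd \<tau> q v - U q * \<theta> q v"
    unfolding T_def[abs_def] D_diff[OF m(1) sm_cs(2) q] D_mult[OF sm_k(2) sm_cs(1) q] D_cs[OF q] U_def
    by (simp add: algebra_simps)
  show "fd U q v = s q * fd \<tau> q v + T q * \<theta> q v"
    unfolding U_def[abs_def] D_add[OF sm_cs(1) m(2) q] D_mult[OF sm_k(2) sm_cs(2) q] D_cs[OF q] T_def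
    by (simp add: algebra_simps)
qed

text \<open>With \<open>Y1 = Y2 = 0\<close>, \<open>a\<close> has zero derivative along
  \<open>e2\<close> and \<open>b\<close> along \<open>e1\<close>. This keeps derivatives of
  \<open>A\<close> and \<open>B\<close> out of the integrability condition.\<close>

lemma D_AB:
  assumes q: "q \<in> V"
  shows "fd A q (E2 q) = 0" "fd B q (E1 q) = 0"
proof -
  have "fd (\<lambda>x. A x * A x + a x * a x) q v = 0" "fd (\<lambda>x. B x * B x + b x * b x) q v = 0" for v
    by (rule D_const[OF q, where c = 1], simp add: AB_square)+
  moreover have "smooth_on V (\<lambda>x. A x * A x)" "smooth_on V (\<lambda>x. a x * a x)" "smooth_on V (\<lambda>x. B x * B x)" "smooth_on V (\<lambda>x. b x * b x)"
    by (intro smooth_intros sm V(1))+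
  ultimately have "2 * (A q * fd A q v) + 2 * (a q * fd a q v) = 0" "2 * (B q * fd B q v) + 2 * (b q * fd b q v) = 0" for v
    by (simp_all add: D_add[OF _ _ q] D_mult[OF sm_AB(1,1) q] D_mult[OF sm_AB(2,2) q] D_mult[OF sm_ab(1,1) q] D_mult[OF sm_ab(2,2) q]
        mult.commute[of "fd _ q v"])
  from this(1)[of "E2 q"] this(2)[of "E1 q"] show "fd A q (E2 q) = 0" "fd B q (E1 q) = 0"
    using AB_pos[OF q] by (simp_all add: frame_derivs[OF q] off_diagonal_zero[OF q])
qed

text \<open>The bracket identity for \<tau>. The gradient formulas are differentiated with
  \<open>k\<close> multiplied across, so that no quotient has to be differentiated.\<close>

lemma compatibility:
  assumes q: "q \<in> V"
  shows "H = k q * (U q * U q - T q * T q)"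
proof -
  let ?g1 = "\<lambda>x. fd \<tau> x (E1 x)" and ?g2 = "\<lambda>x. fd \<tau> x (E2 x)"
  have sm_g: "smooth_on V ?g1" "smooth_on V ?g2" by (intro smooth_on_fd_field V(1) sm_k E)+
  have g: "k x * ?g1 x = (A x * T x) / 2" "k x * ?g2 x = (B x * U x) / 2" if "x \<in> V" for x
    using k_nz[OF that] by (simp_all add: D_\<tau>[OF that])
  have half: "fd (\<lambda>x. \<phi> x / 2) q v = fd \<phi> q v / 2" if "smooth_on V \<phi>" for \<phi> :: "complex \<Rightarrow> real" and v
    by (rule fd_bounded_linear[OF V(1) that q bounded_linear_divide])
  have sm_AT: "smooth_on V (\<lambda>x. A x * T x)" "smooth_on V (\<lambda>x. B x * U x)" by (intro smooth_intros sm sm_k V(1))+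
  have "fd (\<lambda>x. k x * ?g2 x) q (E1 q) = fd (\<lambda>x. (B x * U x) / 2) q (E1 q)" by (rule D_eq[OF q g(2)])
  then have 2: "2 * (k q * fd ?g2 q (E1 q) + fd k q (E1 q) * ?g2 q) = B q * fd U q (E1 q)"
    unfolding half[OF sm_AT(2)] D_mult[OF sm_k(1) sm_g(2) q] D_mult[OF sm_AB(2) sm_k(4) q] by (simp add: D_AB[OF q])
  have "fd (\<lambda>x. k x * ?g1 x) q (E2 q) = fd (\<lambda>x. (A x * T x) / 2) q (E2 q)" by (rule D_eq[OF q g(1)])
  then have 1: "2 * (k q * fd ?g1 q (E2 q) + fd k q (E2 q) * ?g1 q) = A q * fd T q (E2 q)"
    unfolding half[OF sm_AT(1)] D_mult[OF sm_k(1) sm_g(1) q] D_mult[OF sm_AB(1) sm_k(3) q] by (simp add: D_AB[OF q])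
  have br: "fd ?g2 q (E1 q) - fd ?g1 q (E2 q) = - \<omega> q (E1 q) * ?g1 q - \<omega> q (E2 q) * ?g2 q"
    using bracket[OF sm_k(2) q] by simp
  have nz: "A q \<noteq> 0" "B q \<noteq> 0" "H \<noteq> 0" using AB_pos[OF q] H_pos by auto
  show ?thesis
    by (rule bracket_algebra[OF nz k_nz[OF q] cs_unit[OF q] T_def U_def shape[OF q] forms[OF q] D_\<tau>[OF q] D_k[OF q]
          2[unfolded D_TU[OF q]] 1[unfolded D_TU[OF q]] br])
qed

text \<open>\<open>H\<close> is constant, so \<open>compatibility\<close> can be differentiated
  along both frame fields. The resulting value of U^2 + T^2 equals 1 + \<tau>^2.\<close>

lemma \<tau>_const:
  assumes q: "q \<in> V"
  shows "\<tau> q * \<tau> q = 25 / 3"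
proof -
  have smq: "smooth_on V (\<lambda>x. U x * U x)" "smooth_on V (\<lambda>x. T x * T x)" "smooth_on V (\<lambda>x. U x * U x - T x * T x)"
    by (intro smooth_intros sm_k V(1))+
  have D: "k q * (2 * U q * fd U q v - 2 * T q * fd T q v) + fd k q v * (U q * U q - T q * T q) = 0" for v
    using D_const[OF q, of "\<lambda>x. k x * (U x * U x - T x * T x)" H v, OF compatibility[symmetric]]
    unfolding D_mult[OF sm_k(1) smq(3) q] D_diff[OF smq(1,2) q] D_mult[OF sm_k(4,4) q] D_mult[OF sm_k(3,3) q]
    by (simp add: algebra_simps)
  have nz: "A q \<noteq> 0" "B q \<noteq> 0" "H \<noteq> 0" using AB_pos[OF q] H_pos by auto
  note alg = derived_constraint_algebra[OF nz k_nz[OF q] shape[OF q] forms(3,4)[OF q] D_\<tau>[OF q] D_k[OF q] compatibility[OF q]]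
  have "c q * U q - s q * T q = 1"
    using cs_unit[OF q] unfolding T_def U_def by (simp add: algebra_simps)
  from compatibility_algebra[OF cs_unit[OF q] this compatibility[OF q] nz(3)
      alg(1)[OF D[of "E1 q", unfolded D_TU[OF q]]] alg(2)[OF D[of "E2 q", unfolded D_TU[OF q]]]]
  have "U q * U q + T q * T q = 28 / 3" .
  moreover have "U q * U q + T q * T q = 1 + \<tau> q * \<tau> q"
    using cs_unit[OF q] unfolding T_def U_def by algebra
  ultimately show ?thesis by simp
qed

lemma contradiction: False
proof -
  obtain q where q: "q \<in> V" using V(3) by blast
  have "\<tau> q \<noteq> 0" using \<tau>_const[OF q] by auto
  moreover have "fd (\<lambda>x. \<tau> x * \<tau> x) q v = 0" for v by (rule D_const[OF q \<tau>_const])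
  ultimately have "fd \<tau> q v = 0" for v by (simp add: D_mult[OF sm_k(2,2) q])
  then have "T q = 0" "U q = 0"
    using D_\<tau>[OF q] AB_pos[OF q] k_nz[OF q] by simp_all
  then show False using compatibility[OF q] H_pos by simp
qed

end

section \<open>From the surface to an adapted frame\<close>

text \<open>The premises say that the compression of \<open>prod_str\<close> to the plane has
  eigenvalue 1 or -1. On a tangent eigenvector the form of one factor then vanishes, and both factor
  forms are definite.\<close>

lemma degenerate_direction:
  assumes p: "p \<in> S2 \<times> H2" and t: "v \<in> tangent_S2H2 p" "w \<in> tangent_S2H2 p"
    and on: "amb v v = 1" "amb w w = 1" "amb v w = 0"
  defines "m11 \<equiv> amb (prod_str v) v" and "m12 \<equiv> amb (prod_str v) w" and "m22 \<equiv> amb (prod_str w) w"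
  shows "(1 - m11) * (1 - m22) = m12 * m12 \<Longrightarrow> \<exists>s t. (s \<noteq> 0 \<or> t \<noteq> 0) \<and> snd (s *\<^sub>R v + t *\<^sub>R w) = 0"
    and "(1 + m11) * (1 + m22) = m12 * m12 \<Longrightarrow> \<exists>s t. (s \<noteq> 0 \<or> t \<noteq> 0) \<and> fst (s *\<^sub>R v + t *\<^sub>R w) = 0"
proof -
  have on': "amb w v = 0" "amb (prod_str w) v = m12" using on
    by (simp_all add: amb_commute[of w v] m12_def amb_prod_str_commute[of w v])
  have q1: "amb (s *\<^sub>R v + t *\<^sub>R w) (s *\<^sub>R v + t *\<^sub>R w) = s * s + t * t" for s t
    by (simp add: amb_simps on on')
  have q2: "amb (prod_str (s *\<^sub>R v + t *\<^sub>R w)) (s *\<^sub>R v + t *\<^sub>R w) = s * s * m11 + 2 * s * t * m12 + t * t * m22" for s t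
    by (simp add: amb_simps prod_str_simps on' m11_def[symmetric] m12_def[symmetric] m22_def[symmetric] algebra_simps)
  have tan: "s *\<^sub>R v + t *\<^sub>R w \<in> tangent_S2H2 p" for s t
    using t by (simp add: tangent_S2H2_iff amb_simps)
  have snd0: "snd (s *\<^sub>R v + t *\<^sub>R w) = 0" if "s * s * (1 - m11) - 2 * s * t * m12 + t * t * (1 - m22) = 0" for s t
  proof -
    let ?z = "s *\<^sub>R v + t *\<^sub>R w"
    have "lorentz (snd ?z) (snd ?z) = 0"
      using q1[of s t] q2[of s t] that unfolding amb_split by (simp add: algebra_simps)
    moreover have "snd ?z \<in> tangent_H2 (snd p)" using tan[of s t] by (simp add: tangent_S2H2_def mem_Times_iff)
    ultimately show ?thesis using lorentz_tangent_nonneg(2)[of "snd p" "snd ?z"] p by (simp add: mem_Times_iff)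
  qed
  have fst0: "fst (s *\<^sub>R v + t *\<^sub>R w) = 0" if "s * s * (1 + m11) + 2 * s * t * m12 + t * t * (1 + m22) = 0" for s t
  proof -
    let ?z = "s *\<^sub>R v + t *\<^sub>R w"
    have "fst ?z \<bullet> fst ?z = 0"
      using q1[of s t] q2[of s t] that unfolding amb_split by (simp add: algebra_simps)
    then show ?thesis by simp
  qed
  {
    assume d: "(1 - m11) * (1 - m22) = m12 * m12"
    show "\<exists>s t. (s \<noteq> 0 \<or> t \<noteq> 0) \<and> snd (s *\<^sub>R v + t *\<^sub>R w) = 0"
    proof (cases "m11 = 1")
      case True
      then show ?thesis using snd0[of 1 0] by (intro exI[of _ 1] exI[of _ 0]) simp
    next
      case False
      \<comment> \<open>The vector (m12, 1 - m11) is annihilated by the first row of the identity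
        minus the compression, hence by both rows, as the determinant is zero.\<close>
      have "m12 * m12 * (1 - m11) - 2 * m12 * (1 - m11) * m12 + (1 - m11) * (1 - m11) * (1 - m22) = 0"
        using d by algebra
      then show ?thesis using snd0[of m12 "1 - m11"] False by (intro exI[of _ m12] exI[of _ "1 - m11"]) simp
    qed
  next
    assume d: "(1 + m11) * (1 + m22) = m12 * m12"
    show "\<exists>s t. (s \<noteq> 0 \<or> t \<noteq> 0) \<and> fst (s *\<^sub>R v + t *\<^sub>R w) = 0"
    proof (cases "m11 = - 1")
      case True
      then show ?thesis using fst0[of 1 0] by (intro exI[of _ 1] exI[of _ 0]) simp
    next
      case False
      have "m12 * m12 * (1 + m11) + 2 * (- m12) * (1 + m11) * m12 + (1 + m11) * (1 + m11) * (1 + m22) = 0"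
        using d by algebra
      then show ?thesis using fst0[of "- m12" "1 + m11"] False
        by (intro exI[of _ "- m12"] exI[of _ "1 + m11"]) (auto simp: add_eq_0_iff)
    qed
  }
qed

text \<open>The Hopf condition is required in every orthonormal frame, because the eigenframe is
  constructed only later.\<close>

locale conformal_patch =
  fixes f :: "complex \<Rightarrow> r33" and W :: "complex set" and g :: "complex \<Rightarrow> real"
  assumes W: "open W" and f: "smooth_on W f" and f_in: "\<And>x. x \<in> W \<Longrightarrow> f x \<in> S2 \<times> H2"
    and g_pos: "\<And>x. x \<in> W \<Longrightarrow> g x > 0" and conformal: "\<And>x v w. x \<in> W \<Longrightarrow> first_ff f x v w = g x * (v \<bullet> w)"
    and H_nz: "\<And>x. x \<in> W \<Longrightarrow> mean_curv f x \<noteq> 0"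
    and H_parallel: "\<And>x v. x \<in> W \<Longrightarrow> normal_conn f (mean_curv f) x v = 0"
    and hopf: "\<And>x E1 E2 n1 n2. point_frame f W x E1 E2 n1 n2 \<Longrightarrow>
        4 * amb (second_ff f x E1 E1) (mean_curv f x) + amb (prod_str (push f x E1)) (push f x E1)
          = 4 * amb (second_ff f x E2 E2) (mean_curv f x) + amb (prod_str (push f x E2)) (push f x E2) \<and>
        4 * amb (second_ff f x E1 E2) (mean_curv f x) + amb (prod_str (push f x E1)) (push f x E2) = 0"
begin

definition "r x = 1 / sqrt (g x)"
definition "Z1 x = r x *\<^sub>R push f x 1"
definition "Z2 x = r x *\<^sub>R push f x \<i>"
definition "m11 x = amb (prod_str (Z1 x)) (Z1 x)"
definition "m12 x = amb (prod_str (Z1 x)) (Z2 x)"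
definition "m22 x = amb (prod_str (Z2 x)) (Z2 x)"

text \<open>Up to a constant factor, the product of the squared Jacobians of the two projections.\<close>

definition "\<psi> x = ((1 - m11 x) * (1 - m22 x) - m12 x * m12 x) * ((1 + m11 x) * (1 + m22 x) - m12 x * m12 x)"

lemma sm_r: "smooth_on W r"
proof -
  have "smooth_on W g"
  proof (rule smooth_on_cong[OF W])
    show "smooth_on W (\<lambda>x. amb (fd f x 1) (fd f x 1))" by (intro smooth_intros W f)
    show "amb (fd f x 1) (fd f x 1) = g x" if "x \<in> W" for x
      using conformal[OF that, of 1 1] by (simp add: first_ff_def push_def)
  qed
  then show ?thesis
    unfolding r_def[abs_def] using g_pos by (intro smooth_intros W) (auto simp: less_imp_neq[THEN not_sym])
qed

lemma sm_Z: "smooth_on W Z1" "smooth_on W Z2"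
  unfolding Z1_def[abs_def] Z2_def[abs_def] push_def by (intro smooth_intros sm_r W f)+

lemma sm_m: "smooth_on W m11" "smooth_on W m12" "smooth_on W m22"
  unfolding m11_def[abs_def] m12_def[abs_def] m22_def[abs_def] by (intro smooth_intros sm_Z W)+

lemma Z_orthonormal:
  assumes "x \<in> W"
  shows "amb (Z1 x) (Z1 x) = 1" "amb (Z2 x) (Z2 x) = 1" "amb (Z1 x) (Z2 x) = 0" "amb (Z2 x) (Z1 x) = 0"
proof -
  have "r x * (r x * g x) = 1"
    using g_pos[OF assms] by (simp add: r_def real_sqrt_mult_self field_simps flip: power2_eq_square)
  moreover have "amb (push f x v) (push f x w) = g x * (v \<bullet> w)" for v w
    using conformal[OF assms] by (simp add: first_ff_def)
  ultimately show "amb (Z1 x) (Z1 x) = 1" "amb (Z2 x) (Z2 x) = 1" "amb (Z1 x) (Z2 x) = 0" "amb (Z2 x) (Z1 x) = 0"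
    unfolding Z1_def Z2_def by (simp_all add: amb_simps inner_complex_def)
qed

lemma Z_tangent:
  assumes "x \<in> W"
  shows "Z1 x \<in> tangent_S2H2 (f x)" "Z2 x \<in> tangent_S2H2 (f x)"
  using push_tangent[OF W f f_in assms, of 1] push_tangent[OF W f f_in assms, of \<i>]
  by (simp_all add: Z1_def Z2_def tangent_S2H2_iff amb_simps)

lemma push_Z: "x \<in> W \<Longrightarrow> push f x ((r x * s) *\<^sub>R 1 + (r x * t) *\<^sub>R \<i>) = s *\<^sub>R Z1 x + t *\<^sub>R Z2 x"
  using fd_linear_arg[OF W f] by (simp add: Z1_def Z2_def push_def linear_add linear_scale mult.commute)

text \<open>Rotating the conformal frame \<open>Z1, Z2\<close> into principal directions of the product structure.\<close>

lemma rotated_frame: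
  assumes V: "open V" "connected V" "V \<noteq> {}" "V \<subseteq> W" and \<psi>: "\<And>x. x \<in> V \<Longrightarrow> \<psi> x \<noteq> 0"
    and \<zeta>\<eta>: "smooth_on V \<zeta>" "smooth_on V \<eta>" "\<And>x. x \<in> V \<Longrightarrow> \<zeta> x * \<zeta> x + \<eta> x * \<eta> x = 1"
    and diag: "\<And>x. x \<in> V \<Longrightarrow> (\<zeta> x * \<zeta> x - \<eta> x * \<eta> x) * m12 x = \<zeta> x * \<eta> x * (m11 x - m22 x)"
  defines "E1 \<equiv> \<lambda>x. (r x * \<zeta> x) *\<^sub>R 1 + (r x * \<eta> x) *\<^sub>R \<i>" and "E2 \<equiv> \<lambda>x. (r x * - \<eta> x) *\<^sub>R 1 + (r x * \<zeta> x) *\<^sub>R \<i>"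
  shows "adapted_frame f V E1 E2"
    and "\<And>x. x \<in> V \<Longrightarrow> (diagonal_frame.a f E1 x - diagonal_frame.b f E2 x)\<^sup>2 = (m11 x - m22 x)\<^sup>2 + 4 * (m12 x)\<^sup>2"
proof -
  have sub: "smooth_on V \<phi>" if "smooth_on W \<phi>" for \<phi> :: "complex \<Rightarrow> 'z::real_normed_vector"
    by (rule smooth_on_subset[OF that V(4)])
  have xW: "x \<in> W" if "x \<in> V" for x using that V(4) by blast
  have e: "push f x (E1 x) = \<zeta> x *\<^sub>R Z1 x + \<eta> x *\<^sub>R Z2 x" "push f x (E2 x) = (- \<eta> x) *\<^sub>R Z1 x + \<zeta> x *\<^sub>R Z2 x" if "x \<in> V" for x
    unfolding E1_def E2_def by (rule push_Z[OF xW[OF that]])+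
  have m: "amb (prod_str (Z1 x)) (Z1 x) = m11 x" "amb (prod_str (Z1 x)) (Z2 x) = m12 x" "amb (prod_str (Z2 x)) (Z1 x) = m12 x" "amb (prod_str (Z2 x)) (Z2 x) = m22 x" for x
    using amb_prod_str_commute[of "Z2 x" "Z1 x"] by (simp_all add: m11_def m12_def m22_def)
  define a' where "a' x = \<zeta> x * \<zeta> x * m11 x + 2 * \<zeta> x * \<eta> x * m12 x + \<eta> x * \<eta> x * m22 x" for x
  define b' where "b' x = \<eta> x * \<eta> x * m11 x - 2 * \<zeta> x * \<eta> x * m12 x + \<zeta> x * \<zeta> x * m22 x" for x
  have ab: "amb (prod_str (push f x (E1 x))) (push f x (E1 x)) = a' x" "amb (prod_str (push f x (E2 x))) (push f x (E2 x)) = b' x" if "x \<in> V" for x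
    unfolding e[OF that] by (simp_all add: amb_simps prod_str_simps m a'_def b'_def algebra_simps)
  have unit: "amb (push f x (E1 x)) (push f x (E1 x)) = 1" "amb (push f x (E2 x)) (push f x (E2 x)) = 1" "amb (push f x (E1 x)) (push f x (E2 x)) = 0" if "x \<in> V" for x
    unfolding e[OF that] using \<zeta>\<eta>(3)[OF that] by (simp_all add: amb_simps Z_orthonormal[OF xW[OF that]] add.commute)
  \<comment> \<open>Trace, determinant and discriminant of the compression are invariant under the
    rotation; \<open>diag\<close> makes the new off-diagonal entry zero.\<close>
  have sum: "a' x + b' x = m11 x + m22 x" and prod: "a' x * b' x = m11 x * m22 x - m12 x * m12 x"
    and diff: "(a' x - b' x) * (a' x - b' x) = (m11 x - m22 x) * (m11 x - m22 x) + 4 * m12 x * m12 x" if "x \<in> V" for x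
    using \<zeta>\<eta>(3)[OF that] diag[OF that] unfolding a'_def b'_def by algebra+
  have lt: "(a' x)\<^sup>2 < 1" "(b' x)\<^sup>2 < 1" if x: "x \<in> V" for x
  proof -
    \<comment> \<open>\<open>\<psi>\<close> is det(1 - M) det(1 + M) for the compression M, so it
      factors over the eigenvalues.\<close>
    have "\<psi> x = ((1 - a' x) * (1 - b' x)) * ((1 + a' x) * (1 + b' x))"
      using sum[OF x] prod[OF x] unfolding \<psi>_def by algebra
    then have "a' x \<noteq> 1" "a' x \<noteq> - 1" "b' x \<noteq> 1" "b' x \<noteq> - 1" using \<psi>[OF x] by auto
    moreover have "\<bar>a' x\<bar> \<le> 1" "\<bar>b' x\<bar> \<le> 1"
      using abs_prod_str_le[OF f_in push_tangent[OF W f f_in]] unit[OF x] ab[OF x] xW[OF x] by metis+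
    ultimately show "(a' x)\<^sup>2 < 1" "(b' x)\<^sup>2 < 1" by (simp_all add: abs_square_less_1)
  qed
  have smE: "smooth_on V E1" "smooth_on V E2"
    unfolding E1_def E2_def by (intro smooth_intros V(1) sub[OF sm_r] \<zeta>\<eta>)+
  interpret D: diagonal_frame f V E1 E2
  proof
    show "amb (prod_str (push f x (E1 x))) (push f x (E2 x)) = 0" if "x \<in> V" for x
      using diag[OF that] unfolding e[OF that] by (simp add: amb_simps prod_str_simps m algebra_simps)
  qed (use V sub[OF f] f_in xW smE unit ab lt in auto)
  show "adapted_frame f V E1 E2"
  proof
    fix x assume x: "x \<in> V"
    show "mean_curv f x \<noteq> 0" "normal_conn f (mean_curv f) x v = 0" for v
      using H_nz H_parallel xW[OF x] by auto
    have "point_frame f W x (E1 x) (E2 x) (D.n1 x) (D.n2 x)"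
      by (intro point_frame.intro W f f_in xW[OF x] point_frame.ortho[OF D.frame[OF x]])
    from hopf[OF this] show
      "4 * amb (second_ff f x (E1 x) (E1 x)) (mean_curv f x) + amb (prod_str (push f x (E1 x))) (push f x (E1 x))
        = 4 * amb (second_ff f x (E2 x) (E2 x)) (mean_curv f x) + amb (prod_str (push f x (E2 x))) (push f x (E2 x))"
      "amb (second_ff f x (E1 x) (E2 x)) (mean_curv f x) = 0"
      using D.diag[OF x] by simp_all
  qed
  fix x assume x: "x \<in> V"
  show "(D.a x - D.b x)\<^sup>2 = (m11 x - m22 x)\<^sup>2 + 4 * (m12 x)\<^sup>2"
    using diff[OF x] ab[OF x] by (simp add: D.a_def D.b_def D.e1_def D.e2_def power2_eq_square)
qed

text \<open>\<open>nonumbilic_frame\<close> needs distinct eigenvalues on all of \<open>V\<close>,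
  while \<open>not_umbilic_everywhere\<close> gives them at one point; the alternative
  \<open>cases\<close> bridges the gap.\<close>

lemma no_principal_frame:
  assumes V: "open V" "connected V" "V \<noteq> {}" "V \<subseteq> W" and \<psi>: "\<And>x. x \<in> V \<Longrightarrow> \<psi> x \<noteq> 0"
    and \<zeta>\<eta>: "smooth_on V \<zeta>" "smooth_on V \<eta>" "\<And>x. x \<in> V \<Longrightarrow> \<zeta> x * \<zeta> x + \<eta> x * \<eta> x = 1"
    and diag: "\<And>x. x \<in> V \<Longrightarrow> (\<zeta> x * \<zeta> x - \<eta> x * \<eta> x) * m12 x = \<zeta> x * \<eta> x * (m11 x - m22 x)"
    and cases: "(\<forall>x\<in>V. m11 x = m22 x \<and> m12 x = 0) \<or> (\<forall>x\<in>V. m11 x \<noteq> m22 x \<or> m12 x \<noteq> 0)"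
  shows False
proof -
  let ?E1 = "\<lambda>x. (r x * \<zeta> x) *\<^sub>R 1 + (r x * \<eta> x) *\<^sub>R \<i>" and ?E2 = "\<lambda>x. (r x * - \<eta> x) *\<^sub>R 1 + (r x * \<zeta> x) *\<^sub>R \<i>"
  interpret D: adapted_frame f V ?E1 ?E2
    by (rule rotated_frame(1)[OF V \<psi> \<zeta>\<eta> diag])
  have diff: "(D.a x - D.b x)\<^sup>2 = (m11 x - m22 x)\<^sup>2 + 4 * (m12 x)\<^sup>2" if "x \<in> V" for x
    by (rule rotated_frame(2)[OF V \<psi> \<zeta>\<eta> diag that])
  obtain q where q: "q \<in> V" "D.a q \<noteq> D.b q" using D.not_umbilic_everywhere by blast
  then have "m11 q \<noteq> m22 q \<or> m12 q \<noteq> 0" using diff[of q] by auto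
  with cases q(1) have all: "\<forall>x\<in>V. m11 x \<noteq> m22 x \<or> m12 x \<noteq> 0" by blast
  have "D.a x \<noteq> D.b x" if x: "x \<in> V" for x
  proof
    assume "D.a x = D.b x"
    then have "(m11 x - m22 x)\<^sup>2 + 4 * (m12 x)\<^sup>2 = 0" using diff[OF x] by simp
    then have "(m11 x - m22 x)\<^sup>2 = 0 \<and> (m12 x)\<^sup>2 = 0"
      by (smt (verit) zero_le_power2)
    then show False using all x by auto
  qed
  moreover obtain h where "h > 0" "\<forall>q\<in>V. amb (mean_curv f q) (mean_curv f q) = h * h"
    using D.mean_curv_norm_const by blast
  ultimately interpret N: nonumbilic_frame f V ?E1 ?E2 h by unfold_locales auto
  show False by (rule N.contradiction)
qed

text \<open>The contradiction may be found anywhere in the open set where \<open>\<psi>\<close> is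
  nonzero: on a ball around \<open>x0\<close> if all its points are umbilic, otherwise on a ball
  around some non-umbilic \<open>x1\<close> carrying smooth eigenvectors.\<close>

lemma degenerate:
  assumes x0: "x0 \<in> W"
  shows "\<psi> x0 = 0"
proof (rule ccontr)
  assume \<psi>0: "\<psi> x0 \<noteq> 0"
  have sm_\<psi>: "smooth_on W \<psi>"
    unfolding \<psi>_def[abs_def] by (intro smooth_intros sm_m W)
  define V0 where "V0 = {x \<in> W. \<psi> x \<noteq> 0}"
  have nz_open: "open {x \<in> G. \<phi> x \<noteq> 0}" if "open G" "smooth_on G \<phi>" for G and \<phi> :: "complex \<Rightarrow> real"
  proof -
    have "open (G \<inter> \<phi> -` (- {0}))"
      by (rule continuous_open_preimage[OF smooth_on_imp_continuous_on[OF that(2)] that(1)]) (rule open_Compl, rule closed_singleton)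
    moreover have "G \<inter> \<phi> -` (- {0}) = {x \<in> G. \<phi> x \<noteq> 0}" by blast
    ultimately show ?thesis by simp
  qed
  have V0: "open V0" "V0 \<subseteq> W" "x0 \<in> V0" using nz_open[OF W sm_\<psi>] x0 \<psi>0 by (auto simp: V0_def)
  show False
  proof (cases "\<forall>x\<in>V0. m11 x = m22 x \<and> m12 x = 0")
    case True
    obtain e where e: "e > 0" "ball x0 e \<subseteq> V0" using V0 open_contains_ball by blast
    \<comment> \<open>Every direction is principal here, so the unrotated frame serves.\<close>
    show False
      by (rule no_principal_frame[of "ball x0 e" "\<lambda>_. 1" "\<lambda>_. 0"])
        (use e True V0 in \<open>auto simp: V0_def smooth_on_const subset_iff\<close>)
  next
    case False
    define d where "d x = (m11 x - m22 x) / 2" for x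
    from False obtain x1 where x1: "x1 \<in> V0" "d x1 \<noteq> 0 \<or> m12 x1 \<noteq> 0" by (auto simp: d_def)
    have sm_d: "smooth_on W d" unfolding d_def by (intro smooth_intros sm_m W) simp
    define V1 where "V1 = {x \<in> V0. d x * d x + m12 x * m12 x \<noteq> 0}"
    have sum_nz: "d x * d x + m12 x * m12 x \<noteq> 0 \<longleftrightarrow> d x \<noteq> 0 \<or> m12 x \<noteq> 0" for x
      by (simp add: sum_squares_eq_zero_iff)
    have V1: "open V1" "V1 \<subseteq> V0" "V1 \<subseteq> W" "x1 \<in> V1"
    proof -
      have "smooth_on V0 (\<lambda>x. d x * d x + m12 x * m12 x)"
        by (intro smooth_intros V0 smooth_on_subset[OF sm_d] smooth_on_subset[OF sm_m(2)])
      then show "open V1" unfolding V1_def by (rule nz_open[OF V0(1)])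
    qed (use x1 V0 sum_nz in \<open>auto simp: V1_def\<close>)
    have pos: "d x * d x + m12 x * m12 x > 0" if "x \<in> V1" for x
      using that by (simp add: V1_def sum_squares_gt_zero_iff sum_squares_eq_zero_iff)
    text \<open>The sign of the eigenvalue difference is chosen so that \<open>(d + \<epsilon>, m12)\<close> is an eigenvector
      that does not vanish at \<open>x1\<close>.\<close>
    define \<sigma> where "\<sigma> = (if d x1 \<ge> 0 then 1 else - 1 :: real)"
    define \<epsilon> where "\<epsilon> x = \<sigma> * sqrt (d x * d x + m12 x * m12 x)" for x
    have \<epsilon>2: "\<epsilon> x * \<epsilon> x = d x * d x + m12 x * m12 x" if "x \<in> V1" for x
    proof -
      have "\<epsilon> x * \<epsilon> x = (\<sigma> * \<sigma>) * (sqrt (d x * d x + m12 x * m12 x) * sqrt (d x * d x + m12 x * m12 x))"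
        by (simp add: \<epsilon>_def)
      also have "\<dots> = d x * d x + m12 x * m12 x" using pos[OF that] by (simp add: \<sigma>_def)
      finally show ?thesis .
    qed
    have sm1: "smooth_on V1 d" "smooth_on V1 m12" by (rule smooth_on_subset[OF _ V1(3)], rule sm_d sm_m)+
    have sm_\<epsilon>: "smooth_on V1 \<epsilon>"
      unfolding \<epsilon>_def by (intro smooth_intros V1 sm1) (use pos in auto)
    define V2 where "V2 = {x \<in> V1. d x + \<epsilon> x \<noteq> 0}"
    have "d x1 + \<epsilon> x1 \<noteq> 0"
    proof -
      have "sqrt (d x1 * d x1 + m12 x1 * m12 x1) > 0" using pos[OF V1(4)] by simp
      then show ?thesis by (cases "d x1 \<ge> 0"; simp only: \<epsilon>_def \<sigma>_def if_True if_False; linarith)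
    qed
    then have V2: "open V2" "x1 \<in> V2" "V2 \<subseteq> V1"
      using V1(4) nz_open[OF V1(1) smooth_on_add[OF V1(1) sm1(1) sm_\<epsilon>]] by (auto simp: V2_def)
    obtain e where e: "e > 0" "ball x1 e \<subseteq> V2" using V2 open_contains_ball by blast
    define V where "V = ball x1 e"
    have V: "open V" "connected V" "V \<noteq> {}" "V \<subseteq> V2" "V \<subseteq> V1" "V \<subseteq> V0" "V \<subseteq> W"
      using e V2 V1 V0 by (auto simp: V_def)
    \<comment> \<open>Length of the eigenvector; dividing by it gives the cosine and sine of the
      rotation angle.\<close>
    define \<nu> where "\<nu> x = sqrt ((d x + \<epsilon> x) * (d x + \<epsilon> x) + m12 x * m12 x)" for x
    have \<nu>_arg: "(d x + \<epsilon> x) * (d x + \<epsilon> x) + m12 x * m12 x > 0" if "x \<in> V" for x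
      using that V(4) by (auto simp: V2_def sum_squares_gt_zero_iff)
    then have \<nu>: "\<nu> x > 0" "\<nu> x * \<nu> x = (d x + \<epsilon> x) * (d x + \<epsilon> x) + m12 x * m12 x" if "x \<in> V" for x
      using that by (auto simp: \<nu>_def less_imp_le)
    have smV: "smooth_on V d" "smooth_on V m12" "smooth_on V \<epsilon>"
      using smooth_on_subset V(5) sm1 sm_\<epsilon> by blast+
    have sm_\<nu>: "smooth_on V \<nu>"
      unfolding \<nu>_def by (intro smooth_intros V smV) (use \<nu>_arg in auto)
    show False
    proof (rule no_principal_frame[of V "\<lambda>x. (d x + \<epsilon> x) / \<nu> x" "\<lambda>x. m12 x / \<nu> x"])
      show "smooth_on V (\<lambda>x. (d x + \<epsilon> x) / \<nu> x)" "smooth_on V (\<lambda>x. m12 x / \<nu> x)"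
        by (intro smooth_intros V smV sm_\<nu>; use \<nu> in force)+
      fix x assume x: "x \<in> V"
      show "(d x + \<epsilon> x) / \<nu> x * ((d x + \<epsilon> x) / \<nu> x) + m12 x / \<nu> x * (m12 x / \<nu> x) = 1"
      proof -
        have "(d x + \<epsilon> x) / \<nu> x * ((d x + \<epsilon> x) / \<nu> x) + m12 x / \<nu> x * (m12 x / \<nu> x)
            = ((d x + \<epsilon> x) * (d x + \<epsilon> x) + m12 x * m12 x) / (\<nu> x * \<nu> x)"
          by (simp add: add_divide_distrib[of "(d x + \<epsilon> x) * (d x + \<epsilon> x)"])
        then show ?thesis unfolding \<nu>(2)[OF x, symmetric] using \<nu>(1)[OF x] by simp
      qed
      have dm: "m11 x - m22 x = 2 * d x" by (simp add: d_def)
      have "x \<in> V1" using x V(5) by blast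
      \<comment> \<open>By \<open>\<epsilon>2\<close>, the difference of squares on the left is
        \<open>2 * d x * (d x + \<epsilon> x)\<close>.\<close>
      then have "((d x + \<epsilon> x) * (d x + \<epsilon> x) - m12 x * m12 x) * m12 x = (d x + \<epsilon> x) * m12 x * (2 * d x)"
        using \<epsilon>2[of x] by algebra
      then have "((d x + \<epsilon> x) * (d x + \<epsilon> x) - m12 x * m12 x) * m12 x / (\<nu> x * \<nu> x) = (d x + \<epsilon> x) * m12 x * (2 * d x) / (\<nu> x * \<nu> x)"
        by simp
      then show "((d x + \<epsilon> x) / \<nu> x * ((d x + \<epsilon> x) / \<nu> x) - m12 x / \<nu> x * (m12 x / \<nu> x)) * m12 x
          = (d x + \<epsilon> x) / \<nu> x * (m12 x / \<nu> x) * (m11 x - m22 x)"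
        unfolding dm by (simp add: diff_divide_distrib[symmetric])
    next
      have "d x \<noteq> 0 \<or> m12 x \<noteq> 0" if "x \<in> V" for x
        using that V(5) sum_nz[of x] by (auto simp: V1_def)
      then show "(\<forall>x\<in>V. m11 x = m22 x \<and> m12 x = 0) \<or> (\<forall>x\<in>V. m11 x \<noteq> m22 x \<or> m12 x \<noteq> 0)"
        by (auto simp: d_def)
    qed (use V in \<open>auto simp: V0_def\<close>)
  qed
qed

end

section \<open>From charts to the surface\<close>

lemma coord_facts:
  assumes "is_coord X c"
  shows "open (coord_image c)" "fst c \<subseteq> topspace X" "inj_on (snd c) (fst c)"
    "\<And>p. p \<in> fst c \<Longrightarrow> coord_inv c (snd c p) = p" "\<And>x. x \<in> coord_image c \<Longrightarrow> coord_inv c x \<in> fst c"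
    "\<And>x. x \<in> coord_image c \<Longrightarrow> snd c (coord_inv c x) = x"
    "\<And>U. openin X U \<Longrightarrow> U \<subseteq> fst c \<Longrightarrow> open (snd c ` U)"
proof -
  have o: "openin X (fst c)" and h: "homeomorphic_map (subtopology X (fst c)) (top_of_set (coord_image c)) (snd c)"
    and op: "open (coord_image c)"
    using assms by (auto simp: is_coord_def)
  show "open (coord_image c)" by (rule op)
  show sub: "fst c \<subseteq> topspace X" by (rule openin_subset[OF o])
  have ts: "topspace (subtopology X (fst c)) = fst c" using sub by auto
  show inj: "inj_on (snd c) (fst c)"
    using homeomorphic_imp_injective_map[OF h] unfolding ts .
  show "coord_inv c (snd c p) = p" if "p \<in> fst c" for p
    unfolding coord_inv_def by (rule inv_into_f_f[OF inj that])
  show "coord_inv c x \<in> fst c" "snd c (coord_inv c x) = x" if "x \<in> coord_image c" for x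
    using that unfolding coord_inv_def coord_image_def by (rule inv_into_into, rule f_inv_into_f)
  fix U assume U: "openin X U" "U \<subseteq> fst c"
  then have "openin (subtopology X (fst c)) U"
    by (simp add: openin_open_subtopology[OF o])
  then have "openin (top_of_set (coord_image c)) (snd c ` U)"
    using homeomorphic_map_openness[OF h, of U] U(2) unfolding ts by blast
  then show "open (snd c ` U)" using openin_open_trans op by blast
qed

context
  fixes X :: "'a topology" and A :: "'a coord set" and Phi :: "'a \<Rightarrow> r33"
  assumes surface: "smooth_surface X A" and pmc: "PMC X A Phi" and hopf: "hopf_vanishes X A Phi"
begin

lemma chart:
  assumes c: "c \<in> A"
  shows "is_coord X c" "smooth_on (coord_image c) (Phi \<circ> coord_inv c)"
    "\<And>x. x \<in> coord_image c \<Longrightarrow> (Phi \<circ> coord_inv c) x \<in> S2 \<times> H2"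
proof -
  show ic: "is_coord X c" using surface c by (simp add: smooth_surface_def)
  have im: "immersion_S2H2 X A Phi" using pmc by (simp add: PMC_def)
  show "smooth_on (coord_image c) (Phi \<circ> coord_inv c)" using im c by (simp add: immersion_S2H2_def)
  show "(Phi \<circ> coord_inv c) x \<in> S2 \<times> H2" if "x \<in> coord_image c" for x
  proof -
    have "coord_inv c x \<in> topspace X" using coord_facts(2,5)[OF ic] that by blast
    then show ?thesis using im by (simp add: immersion_S2H2_def)
  qed
qed

text \<open>\<open>hopf_vanishes\<close> may choose a different conformal chart at each point. The
  frame is carried to that chart on the overlap, where the condition holds, and the tensors are
  carried back.\<close>

lemma hopf_in_chart:
  assumes c: "c \<in> A" and pf: "point_frame (Phi \<circ> coord_inv c) (coord_image c) x E1 E2 n1 n2"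
  defines "f \<equiv> Phi \<circ> coord_inv c"
  shows "4 * amb (second_ff f x E1 E1) (mean_curv f x) + amb (prod_str (push f x E1)) (push f x E1)
          = 4 * amb (second_ff f x E2 E2) (mean_curv f x) + amb (prod_str (push f x E2)) (push f x E2) \<and>
        4 * amb (second_ff f x E1 E2) (mean_curv f x) + amb (prod_str (push f x E1)) (push f x E2) = 0"
proof -
  note cf = coord_facts[OF chart(1)[OF c]]
  have x: "x \<in> coord_image c" by (rule point_frame.q[OF pf])
  define p where "p = coord_inv c x"
  have p: "p \<in> fst c" "snd c p = x" using cf(5,6)[OF x] by (simp_all add: p_def)
  have "p \<in> topspace X" using p(1) cf(2) by blast
  then obtain d where d: "d \<in> A" "p \<in> fst d" "conformal_coord Phi d" "hopf_coeff (Phi \<circ> coord_inv d) (snd d p) = 0"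
    using hopf unfolding hopf_vanishes_def by blast
  note df = coord_facts[OF chart(1)[OF d(1)]]
  define U where "U = snd c ` (fst c \<inter> fst d)"
  define g where "g = Phi \<circ> coord_inv d"
  define \<phi> where "\<phi> = snd d \<circ> coord_inv c"
  have dom: "open U" "x \<in> U" "U \<subseteq> coord_image c"
  proof -
    have "openin X (fst c \<inter> fst d)"
      using chart(1)[OF c] chart(1)[OF d(1)] by (auto simp: is_coord_def)
    then show "open U" unfolding U_def by (rule cf(7)) blast
    show "x \<in> U" unfolding U_def using p d(2) by blast
    show "U \<subseteq> coord_image c" unfolding U_def coord_image_def by blast
  qed
  have \<phi>: "smooth_on U \<phi>"
    using surface c d(1) unfolding smooth_surface_def smooth_compatible_def U_def \<phi>_def by blast
  have \<phi>U: "\<phi> y \<in> coord_image d" "f y = g (\<phi> y)" if y: "y \<in> U" for y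
  proof -
    obtain z where z: "z \<in> fst c" "z \<in> fst d" "y = snd c z"
      using y unfolding U_def by blast
    then show "\<phi> y \<in> coord_image d" "f y = g (\<phi> y)"
      using cf(4)[OF z(1)] df(4)[OF z(2)] by (simp_all add: \<phi>_def coord_image_def f_def g_def)
  qed
  have \<phi>x: "\<phi> x = snd d p" by (simp add: \<phi>_def p_def)
  interpret point_frame f U x E1 E2 n1 n2
    using pf chart[OF c] dom unfolding f_def[symmetric]
    by (intro point_frame.intro) (auto intro: smooth_on_subset point_frame.ortho)
  have "\<phi> ` U \<subseteq> coord_image d" using \<phi>U(1) by blast
  note change = change_coord[OF df(1) chart(2,3)[OF d(1), folded g_def] \<phi> this \<phi>U(2)]
  obtain u where u: "\<And>v w. first_ff g (\<phi> x) v w = exp (2 * u (\<phi> x)) * (v \<bullet> w)"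
    using d(3) \<phi>U(1)[OF dom(2)] unfolding conformal_coord_def g_def by blast
  have "hopf_coeff g (\<phi> x) = 0" using d(4) by (simp add: \<phi>x g_def)
  from point_frame.hopf_vanishes_frame[OF change(2) u this]
  show ?thesis by (simp add: change(1,3,4))
qed

lemma tangent_meets_factor:
  assumes p: "p \<in> topspace X"
  shows "\<not> tangent_surface A Phi p \<inter> (tangent_S2 (fst (Phi p)) \<times> {0}) \<subseteq> {0} \<or>
     \<not> tangent_surface A Phi p \<inter> ({0} \<times> tangent_H2 (snd (Phi p))) \<subseteq> {0}"
proof -
  \<comment> \<open>This chart is conformal on its whole domain, but its Hopf coefficient is known
    to vanish only at \<open>p\<close>; the other points are covered by
    \<open>hopf_in_chart\<close>.\<close>
  obtain c where c: "c \<in> A" "p \<in> fst c" "conformal_coord Phi c"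
    using hopf p unfolding hopf_vanishes_def by blast
  note cf = coord_facts[OF chart(1)[OF c(1)]]
  define f where "f = Phi \<circ> coord_inv c"
  obtain u where u: "\<And>x v w. x \<in> coord_image c \<Longrightarrow> first_ff f x v w = exp (2 * u x) * (v \<bullet> w)"
    using c(3) unfolding conformal_coord_def f_def by blast
  interpret conformal_patch f "coord_image c" "\<lambda>x. exp (2 * u x)"
  proof
    show "mean_curv f x \<noteq> 0" "normal_conn f (mean_curv f) x v = 0" if "x \<in> coord_image c" for x v
      using pmc c(1) that by (auto simp: PMC_def Let_def f_def)
  qed (use cf(1) chart[OF c(1)] u hopf_in_chart[OF c(1)] in \<open>auto simp: f_def\<close>)
  define x where "x = snd c p"
  have x: "x \<in> coord_image c" using c(2) by (simp add: x_def coord_image_def)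
  have fx: "f x = Phi p" using cf(4)[OF c(2)] by (simp add: f_def x_def)
  note dir = degenerate_direction[OF f_in[OF x] Z_tangent[OF x] Z_orthonormal(1,2,3)[OF x]]
  have nz: "s *\<^sub>R Z1 x + t *\<^sub>R Z2 x \<noteq> 0" if "s \<noteq> 0 \<or> t \<noteq> 0" for s t
  proof
    assume "s *\<^sub>R Z1 x + t *\<^sub>R Z2 x = 0"
    then have "amb (s *\<^sub>R Z1 x + t *\<^sub>R Z2 x) (s *\<^sub>R Z1 x + t *\<^sub>R Z2 x) = 0" by (simp add: amb_simps)
    then have "s * s + t * t = 0" by (simp add: amb_simps Z_orthonormal[OF x])
    then show False using that by (simp add: sum_squares_eq_zero_iff)
  qed
  have ts: "s *\<^sub>R Z1 x + t *\<^sub>R Z2 x \<in> tangent_surface A Phi p" for s t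
    using push_Z[OF x, of s t, symmetric] c(1,2) unfolding tangent_surface_def f_def x_def by blast
  have tan: "s *\<^sub>R Z1 x + t *\<^sub>R Z2 x \<in> tangent_S2 (fst (Phi p)) \<times> tangent_H2 (snd (Phi p))" for s t
    using Z_tangent[OF x] fx by (auto simp: tangent_S2H2_def[symmetric] tangent_S2H2_iff amb_simps)
  have deg: "(1 - m11 x) * (1 - m22 x) = m12 x * m12 x \<or> (1 + m11 x) * (1 + m22 x) = m12 x * m12 x"
    using degenerate[OF x] by (simp add: \<psi>_def)
  have not_sub: "\<not> B \<inter> C \<subseteq> {0}" if "z \<in> B" "z \<in> C" "z \<noteq> 0" for z :: r33 and B C
    using that by blast
  from deg show ?thesis
  proof
    assume "(1 - m11 x) * (1 - m22 x) = m12 x * m12 x"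
    then obtain s t where st: "s \<noteq> 0 \<or> t \<noteq> 0" "snd (s *\<^sub>R Z1 x + t *\<^sub>R Z2 x) = 0"
      using dir(1) unfolding m11_def m12_def m22_def by blast
    have "s *\<^sub>R Z1 x + t *\<^sub>R Z2 x \<in> tangent_S2 (fst (Phi p)) \<times> {0}"
      using tan[of s t] st(2) by (simp add: mem_Times_iff)
    from not_sub[OF ts this nz[OF st(1)]] show ?thesis by (rule disjI1)
  next
    assume "(1 + m11 x) * (1 + m22 x) = m12 x * m12 x"
    then obtain s t where st: "s \<noteq> 0 \<or> t \<noteq> 0" "fst (s *\<^sub>R Z1 x + t *\<^sub>R Z2 x) = 0"
      using dir(2) unfolding m11_def m12_def m22_def by blast
    have "s *\<^sub>R Z1 x + t *\<^sub>R Z2 x \<in> {0} \<times> tangent_H2 (snd (Phi p))"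
      using tan[of s t] st(2) by (simp add: mem_Times_iff)
    from not_sub[OF ts this nz[OF st(1)]] show ?thesis by (rule disjI2)
  qed
qed

end

theorem theorem3p10:
  fixes X :: "'a topology" and A :: "'a coord set" and Phi :: "'a \<Rightarrow> (real^3) \<times> (real^3)"
  assumes "smooth_surface X A"
    and "PMC X A Phi"
    and "hopf_vanishes X A Phi"
  shows "\<forall>p\<in>topspace X.
     \<not> tangent_surface A Phi p \<inter> (tangent_S2 (fst (Phi p)) \<times> {0}) \<subseteq> {0} \<or>
     \<not> tangent_surface A Phi p \<inter> ({0} \<times> tangent_H2 (snd (Phi p))) \<subseteq> {0}"
  using tangent_meets_factor[OF assms] by blast

end
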